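(* Let $X$ be a real Banach space and $T,S:X\rightrightarrows X^*$ maximal monotone operators with $D_T\cap\overline{D_S}\subset D_S$. (1) If $T$ is $\mathcal C_1$-maximal, $\overline{D_S}\in\mathcal C_1(T)$, and there exists $x_0\in D_T\cap D_S$ such that $S$ is directionally inf bounded at $x_0$, then $T+S$ is maximal monotone. (2) If $T$ is $\mathcal C_0$-maximal and $D_T\cap\mathrm{int}\,D_S\ne\emptyset$, then $T+S$ is maximal monotone.
   Context: Sums are $(T+S)(x)=T(x)+S(x)$. $I_C$ is the indicator function of $C$ and $\partial I_C$ its normal cone operator. $\mathcal C_0(T)=\{C\subset X: C$ closed, convex, $D_T\cap\mathrm{int}\,C\ne\emptyset\}$; $\mathcal C_1(T)=\{C\subset X: C$ closed, convex, and $\bigcup_{\lambda>0}\lambda(\mathrm{co}\,D_T-C)$ is a closed subspace of $X\}$. $T$ is $\mathcal C_i$-maximal if $T+\partial I_C$ is maximal monotone for every $C\in\mathcal C_i(T)$. For $x\in X$, $A\subset X$, $K_{x,A}=\{(1-t)x+ta:0\le t\le1,\ a\in A\}$. A monotone $S$ is directionally inf bounded at $x\in D_S$ if for every $y\in X$ there exist $\epsilon>0$, $M>0$ such that for every $z\in K_{y,B(x,\epsilon)}\cap D_S$ there is $z^*\in S(z)$ with $\langle z^*,z-y\rangle\le M\|z-y\|$. *)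

theory Defs
  imports "HOL-Analysis.Analysis"
begin

type_synonym 'a mop = "'a \<Rightarrow> ('a \<Rightarrow>\<^sub>L real) set"

definition dom_op :: "'a mop \<Rightarrow> 'a set" where
  "dom_op T = {x. T x \<noteq> {}}"

definition monotone_op :: "('a::real_normed_vector) mop \<Rightarrow> bool" where
  "monotone_op T \<longleftrightarrow>
     (\<forall>x y x' y'. x' \<in> T x \<longrightarrow> y' \<in> T y \<longrightarrow> blinfun_apply (x' - y') (x - y) \<ge> 0)"

definition maximal_monotone :: "('a::real_normed_vector) mop \<Rightarrow> bool" where
  "maximal_monotone T \<longleftrightarrow> monotone_op T \<and>
     (\<forall>T'. monotone_op T' \<and> (\<forall>x. T x \<subseteq> T' x) \<longrightarrow> T' = T)"

definition sum_op :: "('a::real_normed_vector) mop \<Rightarrow> 'a mop \<Rightarrow> 'a mop" where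
  "sum_op T S = (\<lambda>x. {a + b | a b. a \<in> T x \<and> b \<in> S x})"

text \<open>Normal cone operator = subdifferential of the indicator function I_C
  (0 on C, +\<infinity> off C): empty outside C, and at x \<in> C it is
  {x'. \<forall>y. I_C y \<ge> I_C x + x'(y - x)} = {x'. \<forall>c \<in> C. x'(c - x) \<le> 0}.\<close>
definition normal_cone :: "('a::real_normed_vector) set \<Rightarrow> 'a mop" where
  "normal_cone C = (\<lambda>x. if x \<in> C then {x'. \<forall>c\<in>C. blinfun_apply x' (c - x) \<le> 0} else {})"

definition C0 :: "('a::real_normed_vector) mop \<Rightarrow> 'a set set" where
  "C0 T = {C. closed C \<and> convex C \<and> dom_op T \<inter> interior C \<noteq> {}}"

definition C1 :: "('a::real_normed_vector) mop \<Rightarrow> 'a set set" where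
  "C1 T = {C. closed C \<and> convex C \<and>
     (let U = (\<Union>r\<in>{0::real<..}. (\<lambda>v. r *\<^sub>R v) ` {a - c | a c. a \<in> convex hull (dom_op T) \<and> c \<in> C})
      in closed U \<and> subspace U)}"

definition C0_maximal :: "('a::real_normed_vector) mop \<Rightarrow> bool" where
  "C0_maximal T \<longleftrightarrow> (\<forall>C\<in>C0 T. maximal_monotone (sum_op T (normal_cone C)))"

definition C1_maximal :: "('a::real_normed_vector) mop \<Rightarrow> bool" where
  "C1_maximal T \<longleftrightarrow> (\<forall>C\<in>C1 T. maximal_monotone (sum_op T (normal_cone C)))"

definition Kset :: "'a::real_vector \<Rightarrow> 'a set \<Rightarrow> 'a set" where
  "Kset x A = {(1 - t) *\<^sub>R x + t *\<^sub>R a | t a. 0 \<le> t \<and> t \<le> 1 \<and> a \<in> A}"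

definition dir_inf_bounded :: "('a::real_normed_vector) mop \<Rightarrow> 'a \<Rightarrow> bool" where
  "dir_inf_bounded S x \<longleftrightarrow> x \<in> dom_op S \<and>
     (\<forall>y. \<exists>\<epsilon>>0. \<exists>M>0. \<forall>z \<in> Kset y (ball x \<epsilon>) \<inter> dom_op S.
        \<exists>z'\<in>S z. blinfun_apply z' (z - y) \<le> M * norm (z - y))"

end

(*
Write D for the closure of the domain of S; in (2) an interior point of the domain makes D convex and S
directionally inf bounded, so both parts have the same proof.

Let (y, y') be monotonically related to T + S. Directional inf boundedness bounds S from above by a linear functional
on a thin cone C with vertex y, and maximality of T + N_(D Int C) then gives y in dom T Int dom S. Hence for every pair
(y, y') the infimum of (t + s - y')(x - y) over the graph of T + S is at most 0. A separation argument turns this into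
approximate solutions (x, t, s) in a convexification of the graphs: x -> 0 and t + s -> 0 pointwise (after translating
(y, y') to the origin).

It remains to find f with f in S(0) and -f in T(0), that is, with f <= u'(u) on the graph of S and -f <= d'(d) on that
of T. By Hahn-Banach it is enough to bound the approximate s uniformly on D near x0. Domain points of S close to x0 need
not suffice, because the vertex x of the bound varies; but if the bound failed, a gliding hump over the approximate
solutions would produce a single vertex y at which S is not bounded near x0.
*)
theory Submission
  imports Defs
begin

section \<open>The Hahn-Banach theorem\<close>

text \<open>No limit of the functionals s is extracted: Hahn-Banach is applied to the upper limit of
  s along a filter of approximate solutions, so one-sided estimates and a lower bound by a multiple
  of the norm suffice. All this takes place on the closed subspace U generated by the differences of
  the two domains, where Baire's theorem turns estimates at single points into estimates on a ball.

  The convexification treats the operators asymmetrically. Upper bounds for s are needed at points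
  of the domain of S, so s is tested against the graph of S. Lower bounds are needed on the whole
  Fitzpatrick epigraph of T, which is closed and convex as the Baire argument requires, so t is
  tested against that epigraph.

  Uniform boundedness does not apply to S directly: directional inf boundedness promises only one
  good element of each S(z), with a bound depending on the vertex. The hump therefore sums weighted
  vertices instead of functionals. Later steps must not spoil earlier ones, although s may be very
  negative near x0; a reverse bound, small relative to the supremum of s, prevents this.\<close>

definition sublinear :: "('a::real_vector \<Rightarrow> real) \<Rightarrow> bool" where
  "sublinear p \<longleftrightarrow> (\<forall>x y. p (x + y) \<le> p x + p y) \<and> (\<forall>x t. 0 < t \<longrightarrow> p (t *\<^sub>R x) = t * p x)"

lemma sublinear_add: "sublinear p \<Longrightarrow> p (x + y) \<le> p x + p y"
  by (simp add: sublinear_def)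

lemma sublinear_scale: "sublinear p \<Longrightarrow> 0 < t \<Longrightarrow> p (t *\<^sub>R x) = t * p x"
  by (simp add: sublinear_def)

lemma sublinear_zero:
  assumes "sublinear p" shows "p 0 = 0"
  using sublinear_scale[OF assms, of 2 0] by simp

lemma sublinear_minus:
  assumes "sublinear p" shows "- p (- x) \<le> p x"
  using sublinear_add[OF assms, of x "- x"] sublinear_zero[OF assms] by simp

text \<open>The inequality for \<open>inverse t\<close> at the point \<open>t *\<^sub>R x\<close> is
  the reverse of the one for \<open>t\<close> at \<open>x\<close>.\<close>

lemma sublinearI:
  assumes "\<And>x y. p (x + y) \<le> p x + p y" and le: "\<And>x t. 0 < t \<Longrightarrow> p (t *\<^sub>R x) \<le> t * p x"
  shows "sublinear p"
  unfolding sublinear_def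
proof (intro conjI allI impI)
  fix x and t :: real assume t: "0 < t"
  have "p (inverse t *\<^sub>R (t *\<^sub>R x)) \<le> inverse t * p (t *\<^sub>R x)"
    using t by (intro le) simp
  hence "t * p x \<le> p (t *\<^sub>R x)"
    using t by (simp add: field_simps)
  with le[OF t, of x] show "p (t *\<^sub>R x) = t * p x" by simp
qed (rule assms)

text \<open>Supplies the bounds of chains for Zorn's lemma. The infimum is finite since
  \<open>- p (- x)\<close> lies below every member, and subadditive since of two members of a chain
  one lies below both.\<close>

lemma sublinear_INF:
  fixes Q :: "('a::real_vector \<Rightarrow> real) set"
  assumes ne: "Q \<noteq> {}" and sub: "\<And>q. q \<in> Q \<Longrightarrow> sublinear q"
    and chain: "\<And>q q'. q \<in> Q \<Longrightarrow> q' \<in> Q \<Longrightarrow> q \<le> q' \<or> q' \<le> q"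
    and le: "\<And>q. q \<in> Q \<Longrightarrow> q \<le> p"
  shows "sublinear (\<lambda>x. INF q\<in>Q. q x)" and "q \<in> Q \<Longrightarrow> (INF q\<in>Q. q x) \<le> q x"
proof -
  have bdd: "bdd_below ((\<lambda>q. q x) ` Q)" for x
  proof (rule bdd_belowI2)
    fix q assume q: "q \<in> Q"
    have "- p (- x) \<le> - q (- x)"
      using le[OF q] by (auto simp: le_fun_def)
    also have "\<dots> \<le> q x"
      by (rule sublinear_minus[OF sub[OF q]])
    finally show "- p (- x) \<le> q x" .
  qed
  show lower: "(INF q\<in>Q. q x) \<le> q x" if "q \<in> Q" for q x
    by (rule cINF_lower[OF bdd that])
  show "sublinear (\<lambda>x. INF q\<in>Q. q x)"
  proof (rule sublinearI)
    fix x y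
    have le_add: "(INF q\<in>Q. q (x + y)) \<le> q x + q' y" if q: "q \<in> Q" and q': "q' \<in> Q" for q q'
    proof -
      obtain r where r: "r \<in> Q" "r \<le> q" "r \<le> q'"
        using chain[OF q q'] q q' by blast
      have "(INF q\<in>Q. q (x + y)) \<le> r (x + y)" by (rule lower[OF r(1)])
      also have "\<dots> \<le> r x + r y" by (rule sublinear_add[OF sub[OF r(1)]])
      also have "\<dots> \<le> q x + q' y" using r by (auto simp: le_fun_def intro: add_mono)
      finally show ?thesis .
    qed
    have "(INF q\<in>Q. q (x + y)) - q x \<le> (INF q'\<in>Q. q' y)" if "q \<in> Q" for q
      using le_add[OF that] by (intro cINF_greatest[OF ne]) (simp add: diff_le_eq add.commute)
    hence "(INF q\<in>Q. q (x + y)) - (INF q\<in>Q. q y) \<le> (INF q\<in>Q. q x)"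
      by (intro cINF_greatest[OF ne]) (simp add: algebra_simps)
    thus "(INF q\<in>Q. q (x + y)) \<le> (INF q\<in>Q. q x) + (INF q\<in>Q. q y)" by simp
  next
    fix x and t :: real assume t: "0 < t"
    have "(INF q\<in>Q. q (t *\<^sub>R x)) / t \<le> q x" if "q \<in> Q" for q
      using lower[OF that, of "t *\<^sub>R x"] sublinear_scale[OF sub[OF that] t, of x] t
      by (simp add: field_simps)
    hence "(INF q\<in>Q. q (t *\<^sub>R x)) / t \<le> (INF q\<in>Q. q x)"
      by (intro cINF_greatest[OF ne])
    thus "(INF q\<in>Q. q (t *\<^sub>R x)) \<le> t * (INF q\<in>Q. q x)"
      using t by (simp add: field_simps)
  qed
qed

text \<open>Lowering \<open>q\<close> along a direction \<open>v\<close> as far as sublinearity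
  permits gives \<open>r\<close>. Minimality forces \<open>r = q\<close>, and the term
  \<open>t = 1\<close> of the infimum then yields superadditivity of \<open>q\<close>.\<close>

lemma minimal_sublinear_linear:
  assumes q: "sublinear q" and min: "\<And>r. sublinear r \<Longrightarrow> r \<le> q \<Longrightarrow> r = q"
  shows "linear q"
proof -
  have add_ge: "q x + q v \<le> q (x + v)" for x v
  proof -
    define r where "r x = (INF t\<in>{0::real..}. q (x + t *\<^sub>R v) - t * q v)" for x
    have bdd: "bdd_below ((\<lambda>t. q (x + t *\<^sub>R v) - t * q v) ` {0::real..})" for x
    proof (rule bdd_belowI2)
      fix t :: real assume t: "t \<in> {0..}"
      have "t * q v = q (t *\<^sub>R v)"
        using t sublinear_scale[OF q, of t v] sublinear_zero[OF q] by (cases "t = 0") auto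
      also have "\<dots> \<le> q (x + t *\<^sub>R v) + q (- x)"
        using sublinear_add[OF q, of "x + t *\<^sub>R v" "- x"] by simp
      finally show "- q (- x) \<le> q (x + t *\<^sub>R v) - t * q v" by simp
    qed
    have lower: "r x \<le> q (x + t *\<^sub>R v) - t * q v" if "0 \<le> t" for t x
      unfolding r_def by (rule cINF_lower[OF bdd]) (use that in auto)
    have "sublinear r"
    proof (rule sublinearI)
      fix x y
      have *: "r (x + y) - (q (x + t *\<^sub>R v) - t * q v) \<le> r y" if "0 \<le> t" for t
        unfolding r_def[of y]
      proof (rule cINF_greatest)
        fix s :: real assume "s \<in> {0..}"
        hence "r (x + y) \<le> q (x + y + (t + s) *\<^sub>R v) - (t + s) * q v"
          using that by (intro lower) auto
        also have "q (x + y + (t + s) *\<^sub>R v) \<le> q (x + t *\<^sub>R v) + q (y + s *\<^sub>R v)"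
          using sublinear_add[OF q, of "x + t *\<^sub>R v" "y + s *\<^sub>R v"] by (simp add: algebra_simps)
        finally show "r (x + y) - (q (x + t *\<^sub>R v) - t * q v) \<le> q (y + s *\<^sub>R v) - s * q v"
          by (simp add: algebra_simps)
      qed auto
      have "r (x + y) - r y \<le> r x"
        unfolding r_def[of x]
      proof (rule cINF_greatest)
        fix t :: real assume "t \<in> {0..}"
        thus "r (x + y) - r y \<le> q (x + t *\<^sub>R v) - t * q v"
          using *[of t] by simp
      qed auto
      thus "r (x + y) \<le> r x + r y" by simp
    next
      fix x and c :: real assume c: "0 < c"
      have "r (c *\<^sub>R x) / c \<le> r x"
        unfolding r_def[of x]
      proof (rule cINF_greatest)
        fix t :: real assume t: "t \<in> {0..}"
        have "r (c *\<^sub>R x) \<le> q (c *\<^sub>R x + (c * t) *\<^sub>R v) - (c * t) * q v"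
          using t c by (intro lower) auto
        also have "c *\<^sub>R x + (c * t) *\<^sub>R v = c *\<^sub>R (x + t *\<^sub>R v)" by (simp add: algebra_simps)
        also have "q \<dots> = c * q (x + t *\<^sub>R v)" by (rule sublinear_scale[OF q c])
        finally have "r (c *\<^sub>R x) \<le> c * (q (x + t *\<^sub>R v) - t * q v)"
          by (simp add: algebra_simps)
        thus "r (c *\<^sub>R x) / c \<le> q (x + t *\<^sub>R v) - t * q v"
          using c by (simp add: field_simps)
      qed auto
      thus "r (c *\<^sub>R x) \<le> c * r x" using c by (simp add: field_simps)
    qed
    moreover have "r \<le> q"
      using lower[of 0] by (auto simp: le_fun_def)
    ultimately have "r = q" by (rule min)
    thus ?thesis using lower[of 1 x] by simp
  qed
  have add: "q (x + y) = q x + q y" for x y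
    using add_ge[of x y] sublinear_add[OF q, of x y] by simp
  show ?thesis
  proof
    fix x y show "q (x + y) = q x + q y" by (rule add)
  next
    fix c :: real and x
    have neg: "q (- x) = - q x" for x
      using add[of x "- x"] sublinear_zero[OF q] by simp
    show "q (c *\<^sub>R x) = c *\<^sub>R q x"
    proof (cases c "0::real" rule: linorder_cases)
      case less
      have "q (c *\<^sub>R x) = - q ((- c) *\<^sub>R x)" using neg[of "c *\<^sub>R x"] by simp
      also have "\<dots> = c * q x" using sublinear_scale[OF q, of "- c" x] less by simp
      finally show ?thesis by simp
    next
      case equal thus ?thesis using sublinear_zero[OF q] by simp
    next
      case greater thus ?thesis using sublinear_scale[OF q, of c x] by simp
    qed
  qed
qed

theorem Hahn_Banach_sublinear:
  fixes p :: "'a::real_vector \<Rightarrow> real"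
  assumes p: "sublinear p"
  obtains f where "linear f" "\<And>x. f x \<le> p x"
proof -
  define A where "A = {q. sublinear q \<and> q \<le> p}"
  \<comment> \<open>The order is reversed, so that the maximal element from Zorn's lemma is a
    minimal sublinear functional.\<close>
  have "\<exists>m\<in>A. \<forall>a\<in>A. a \<le> m \<longrightarrow> a = m"
  proof (rule predicate_Zorn[where P = "\<lambda>x y. y \<le> x"])
    show "partial_order_on A (relation_of (\<lambda>x y. y \<le> x) A)"
      by (auto simp: partial_order_on_def preorder_on_def refl_on_def trans_def antisym_def relation_of_def)
  next
    fix C assume C: "C \<in> Chains (relation_of (\<lambda>x y. y \<le> x) A)"
    hence CA: "C \<subseteq> A" and ch: "\<And>q q'. q \<in> C \<Longrightarrow> q' \<in> C \<Longrightarrow> q \<le> q' \<or> q' \<le> q"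
      by (auto simp: Chains_def relation_of_def)
    show "\<exists>u\<in>A. \<forall>a\<in>C. u \<le> a"
    proof (cases "C = {}")
      case True
      thus ?thesis using p by (auto simp: A_def)
    next
      case False
      define u where "u = (\<lambda>x. INF q\<in>C. q x)"
      have sub: "\<And>q. q \<in> C \<Longrightarrow> sublinear q" and le: "\<And>q. q \<in> C \<Longrightarrow> q \<le> p"
        using CA by (auto simp: A_def)
      have "sublinear u" unfolding u_def
        by (rule sublinear_INF(1)[OF False sub ch le])
      moreover have uq: "u \<le> q" if "q \<in> C" for q
        unfolding u_def le_fun_def using sublinear_INF(2)[OF False sub ch le that] by auto
      moreover have "u \<le> p" using False uq le order_trans by (metis ex_in_conv)
      ultimately show ?thesis by (auto simp: A_def)
    qed
  qed
  then obtain m where m: "m \<in> A" and min: "\<And>a. a \<in> A \<Longrightarrow> a \<le> m \<Longrightarrow> a = m" by blast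
  have "linear m"
  proof (rule minimal_sublinear_linear)
    show "sublinear m" using m by (simp add: A_def)
    fix r assume "sublinear r" "r \<le> m"
    thus "r = m" using m min[of r] by (auto simp: A_def)
  qed
  thus ?thesis using m that[of m] by (auto simp: A_def le_fun_def)
qed

lemma linear_bounded_blinfun:
  fixes f :: "'a::real_normed_vector \<Rightarrow> real"
  assumes "linear f" "\<And>x. f x \<le> k * norm x"
  obtains F :: "'a \<Rightarrow>\<^sub>L real" where "\<And>x. blinfun_apply F x = f x"
proof -
  have "bounded_linear f"
  proof -
    have "norm (f x) \<le> norm x * k" for x
      using assms(2)[of x] assms(2)[of "- x"] linear_neg[OF assms(1), of x]
      by (auto simp: mult.commute abs_real_def)
    thus ?thesis using assms(1) by (intro bounded_linear_intro[of _ k])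
        (auto simp: linear_add linear_scale)
  qed
  thus ?thesis using that[of "Blinfun f"] by (simp add: bounded_linear_Blinfun_apply)
qed

text \<open>A sandwich theorem of Mazur-Orlicz type. The auxiliary \<open>q\<close> is the largest
  sublinear functional that lies below \<open>p\<close> and satisfies \<open>q w \<le> r\<close> on
  \<open>G\<close>; the lower bound on \<open>G\<close> keeps it finite.\<close>

lemma Hahn_Banach_convex_sublinear:
  fixes G :: "('a::real_vector \<times> real) set"
  assumes p: "sublinear p" and conv: "convex G" and lb: "\<And>w r. (w, r) \<in> G \<Longrightarrow> - p (- w) \<le> r"
  shows "\<exists>f. linear f \<and> (\<forall>x. f x \<le> p x) \<and> (\<forall>(w, r)\<in>G. f w \<le> r)"
proof -
  \<comment> \<open>The alternative \<open>t = 0\<close> puts \<open>p v\<close> itself into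
    \<open>V v\<close>, also for empty \<open>G\<close>.\<close>
  define V where "V v = {t * r + p (v - t *\<^sub>R w) | t w r. 0 \<le> t \<and> (t = 0 \<or> (w, r) \<in> G)}" for v
  define q where "q v = Inf (V v)" for v
  have scale: "p (t *\<^sub>R x) = t * p x" if "0 \<le> t" for t x
    using that sublinear_scale[OF p, of t x] sublinear_zero[OF p] by (cases "t = 0") auto
  have lbV: "- p (- v) \<le> z" if z: "z \<in> V v" for v z
  proof -
    obtain t w r where twr: "z = t * r + p (v - t *\<^sub>R w)" "0 \<le> t" "t = 0 \<or> (w, r) \<in> G"
      using z by (auto simp: V_def)
    have "p (t *\<^sub>R (- w)) \<le> p (v - t *\<^sub>R w) + p (- v)"
      using sublinear_add[OF p, of "v - t *\<^sub>R w" "- v"] by simp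
    moreover have "- (t * p (- w)) \<le> t * r"
      using twr lb[of w r] mult_left_mono[of "- p (- w)" r t] by auto
    ultimately show ?thesis using twr(1) scale[OF twr(2), of "- w"] by linarith
  qed
  have bdd: "bdd_below (V v)" for v using lbV[of _ v] by (auto simp: bdd_below_def)
  have ne: "p v \<in> V v" for v
    unfolding V_def by (rule CollectI, rule exI[of _ 0]) auto
  have low: "q v \<le> z" if "z \<in> V v" for v z
    unfolding q_def using that bdd by (rule cInf_lower)
  have V_add: "\<exists>z''\<in>V (x + y). z'' \<le> z + z'" if z: "z \<in> V x" and z': "z' \<in> V y" for x y z z'
  proof -
    obtain t w r where t: "z = t * r + p (x - t *\<^sub>R w)" "0 \<le> t" "t = 0 \<or> (w, r) \<in> G"
      using z by (auto simp: V_def)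
    obtain t' w' r' where t': "z' = t' * r' + p (y - t' *\<^sub>R w')" "0 \<le> t'" "t' = 0 \<or> (w', r') \<in> G"
      using z' by (auto simp: V_def)
    obtain w'' r'' where w'': "(t + t') *\<^sub>R w'' = t *\<^sub>R w + t' *\<^sub>R w'" "(t + t') * r'' = t * r + t' * r'"
      "t + t' = 0 \<or> (w'', r'') \<in> G"
    proof (cases "t = 0 \<or> t' = 0")
      case True
      thus ?thesis using that[of w r] that[of w' r'] t t' by auto
    next
      case False
      hence pos: "0 < t + t'" using t t' by auto
      have "(t / (t + t')) *\<^sub>R (w, r) + (t' / (t + t')) *\<^sub>R (w', r') \<in> G"
        using False t t' pos by (intro convexD[OF conv]) (auto simp: add_divide_distrib[symmetric])
      thus ?thesis using that[of "(t / (t + t')) *\<^sub>R w + (t' / (t + t')) *\<^sub>R w'" "(t / (t + t')) * r + (t' / (t + t')) * r'"] pos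
        by (auto simp: scaleR_add_right distrib_left)
    qed
    have "(t + t') * r'' + p (x + y - (t + t') *\<^sub>R w'') \<in> V (x + y)"
      unfolding V_def using w''(3) t(2) t'(2) by (intro CollectI exI[of _ "t + t'"] exI[of _ w''] exI[of _ r'']) auto
    moreover have "p (x + y - (t + t') *\<^sub>R w'') \<le> p (x - t *\<^sub>R w) + p (y - t' *\<^sub>R w')"
      using sublinear_add[OF p, of "x - t *\<^sub>R w" "y - t' *\<^sub>R w'"] unfolding w''(1) by (simp add: algebra_simps)
    ultimately show ?thesis using t(1) t'(1) w''(2)
      by (intro bexI[of _ "(t + t') * r'' + p (x + y - (t + t') *\<^sub>R w'')"]) auto
  qed
  have V_scale: "c * z \<in> V (c *\<^sub>R x)" if z: "z \<in> V x" and c: "0 < c" for x z c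
  proof -
    obtain t w r where t: "z = t * r + p (x - t *\<^sub>R w)" "0 \<le> t" "t = 0 \<or> (w, r) \<in> G"
      using z by (auto simp: V_def)
    have "p (c *\<^sub>R x - (c * t) *\<^sub>R w) = c * p (x - t *\<^sub>R w)"
      using sublinear_scale[OF p c, of "x - t *\<^sub>R w"] by (simp add: scaleR_diff_right)
    hence "c * z = (c * t) * r + p (c *\<^sub>R x - (c * t) *\<^sub>R w)"
      unfolding t(1) by (simp add: algebra_simps)
    thus ?thesis unfolding V_def using t c
      by (intro CollectI exI[of _ "c * t"] exI[of _ w] exI[of _ r]) auto
  qed
  have "sublinear q"
  proof (rule sublinearI)
    fix x y
    have "q (x + y) - z \<le> z'" if "z \<in> V x" "z' \<in> V y" for z z'
      using V_add[OF that] low[of _ "x + y"] by force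
    hence "q (x + y) - z \<le> q y" if "z \<in> V x" for z
      unfolding q_def[of y] using ne[of y] that by (intro cInf_greatest) auto
    hence "q (x + y) - q y \<le> z" if "z \<in> V x" for z
      using that by fastforce
    hence "q (x + y) - q y \<le> q x"
      unfolding q_def[of x] using ne[of x] by (intro cInf_greatest) auto
    thus "q (x + y) \<le> q x + q y" by simp
  next
    fix x and c :: real assume c: "0 < c"
    have "q (c *\<^sub>R x) / c \<le> z" if "z \<in> V x" for z
      using low[OF V_scale[OF that c]] c by (simp add: field_simps)
    hence "q (c *\<^sub>R x) / c \<le> q x"
      unfolding q_def[of x] using ne[of x] by (intro cInf_greatest) auto
    thus "q (c *\<^sub>R x) \<le> c * q x" using c by (simp add: field_simps)
  qed
  then obtain f where f: "linear f" "\<And>x. f x \<le> q x" by (rule Hahn_Banach_sublinear) auto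
  have "f x \<le> p x" for x
    using f(2)[of x] low[OF ne, of x] by simp
  moreover have "f w \<le> r" if "(w, r) \<in> G" for w r
  proof -
    have "r \<in> V w" unfolding V_def using that sublinear_zero[OF p]
      by (intro CollectI exI[of _ 1] exI[of _ w] exI[of _ r]) auto
    thus ?thesis using f(2)[of w] low by fastforce
  qed
  ultimately show ?thesis using f(1) by blast
qed

lemma Hahn_Banach_convex:
  fixes G :: "('a::real_normed_vector \<times> real) set"
  assumes conv: "convex G" and lb: "\<And>w r. (w, r) \<in> G \<Longrightarrow> - (k * norm w) \<le> r" and k: "0 \<le> k"
  shows "\<exists>f :: 'a \<Rightarrow>\<^sub>L real. \<forall>(w, r)\<in>G. blinfun_apply f w \<le> r"
proof -
  have sub: "sublinear (\<lambda>x::'a. k * norm x)"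
  proof (rule sublinearI)
    fix x y :: 'a
    show "k * norm (x + y) \<le> k * norm x + k * norm y"
      using mult_left_mono[OF norm_triangle_ineq k, of x y] by (simp only: distrib_left)
  qed simp
  have "\<exists>f. linear f \<and> (\<forall>x. f x \<le> k * norm x) \<and> (\<forall>(w, r)\<in>G. f w \<le> r)"
    by (rule Hahn_Banach_convex_sublinear[OF sub conv]) (simp add: lb)
  then obtain f where f: "linear f" "\<And>x::'a. f x \<le> k * norm x" "\<forall>(w, r)\<in>G. f w \<le> r"
    by blast
  obtain F :: "'a \<Rightarrow>\<^sub>L real" where F: "\<And>x. blinfun_apply F x = f x"
    by (rule linear_bounded_blinfun[OF f(1,2)]) (rule that)
  show ?thesis using f(3) by (intro exI[of _ F]) (simp add: F)
qed

text \<open>Functionals on the dual that are controlled by finitely many evaluations are evaluations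
  at a point. In the induction, a functional \<open>e\<close> that kills \<open>\<Phi>\<close> but
  not \<open>\<phi>0\<close> splits off a multiple of the evaluation at \<open>\<phi>0\<close>; if
  there is no such \<open>e\<close>, the kernel of \<open>\<Phi>\<close> already lies in that of
  \<open>\<phi>0\<close>.\<close>

lemma linear_functional_of_finite_kernel:
  fixes \<Phi> :: "'a::real_normed_vector set" and l :: "('a \<Rightarrow>\<^sub>L real) \<Rightarrow> real"
  assumes "finite \<Phi>" "linear l" "\<And>g. (\<And>\<phi>. \<phi> \<in> \<Phi> \<Longrightarrow> blinfun_apply g \<phi> = 0) \<Longrightarrow> l g = 0"
  shows "\<exists>v. \<forall>g. l g = blinfun_apply g v"
  using assms
proof (induction \<Phi> arbitrary: l rule: finite_induct)
  case empty
  have "l g = blinfun_apply g 0" for g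
    using empty.prems(2)[of g] by simp
  thus ?case by blast
next
  case (insert \<phi>0 \<Phi>)
  show ?case
  proof (cases "\<exists>e::'a \<Rightarrow>\<^sub>L real. (\<forall>\<phi>\<in>\<Phi>. blinfun_apply e \<phi> = 0) \<and> blinfun_apply e \<phi>0 \<noteq> 0")
    case False
    show ?thesis
    proof (rule insert.IH[OF insert.prems(1)])
      fix g :: "'a \<Rightarrow>\<^sub>L real" assume g: "\<And>\<phi>. \<phi> \<in> \<Phi> \<Longrightarrow> blinfun_apply g \<phi> = 0"
      hence "\<forall>\<phi>\<in>\<Phi>. blinfun_apply g \<phi> = 0" by simp
      hence "blinfun_apply g \<phi>0 = 0" using False by metis
      show "l g = 0"
      proof (rule insert.prems(2))
        fix \<phi> assume "\<phi> \<in> insert \<phi>0 \<Phi>"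
        thus "blinfun_apply g \<phi> = 0" using g \<open>blinfun_apply g \<phi>0 = 0\<close> by auto
      qed
    qed
  next
    case True
    then obtain e :: "'a \<Rightarrow>\<^sub>L real" where e: "\<forall>\<phi>\<in>\<Phi>. blinfun_apply e \<phi> = 0" "blinfun_apply e \<phi>0 \<noteq> 0" by auto
    define a where "a = l e / blinfun_apply e \<phi>0"
    have "\<exists>v. \<forall>g. l g - a * blinfun_apply g \<phi>0 = blinfun_apply g v"
    proof (rule insert.IH)
      show "linear (\<lambda>g. l g - a * blinfun_apply g \<phi>0)"
        by (rule linearI) (simp_all add: linear_add[OF insert.prems(1)] linear_scale[OF insert.prems(1)]
          blinfun.add_left blinfun.scaleR_left algebra_simps)
      fix g :: "'a \<Rightarrow>\<^sub>L real" assume g: "\<And>\<phi>. \<phi> \<in> \<Phi> \<Longrightarrow> blinfun_apply g \<phi> = 0"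
      define b where "b = blinfun_apply g \<phi>0 / blinfun_apply e \<phi>0"
      have "l (g - b *\<^sub>R e) = 0"
      proof (rule insert.prems(2))
        fix \<phi> assume "\<phi> \<in> insert \<phi>0 \<Phi>"
        thus "blinfun_apply (g - b *\<^sub>R e) \<phi> = 0"
          using g e by (auto simp: blinfun.diff_left blinfun.scaleR_left b_def)
      qed
      thus "l g - a * blinfun_apply g \<phi>0 = 0"
        by (simp add: linear_diff[OF insert.prems(1)] linear_scale[OF insert.prems(1)] a_def b_def mult.commute)
    qed
    then obtain v where v: "\<forall>g. l g - a * blinfun_apply g \<phi>0 = blinfun_apply g v" by auto
    have "l g = blinfun_apply g (v + a *\<^sub>R \<phi>0)" for g
      using v[rule_format, of g] by (simp add: blinfun.add_right blinfun.scaleR_right)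
    thus ?thesis by blast
  qed
qed

text \<open>The first \<open>n\<close> weights add up to \<open>1 - (1/2) ^ n\<close>, so a partial
  sum becomes a convex combination once the missing weight is placed on a point of \<open>K\<close>;
  in the limit this correction disappears.\<close>

lemma sums_half_powers_mem:
  fixes K :: "'a::real_normed_vector set"
  assumes K: "closed K" "convex K" and c: "\<And>k. c k \<in> K" and s: "(\<lambda>k. (1/2) ^ Suc k *\<^sub>R c k) sums x"
  shows "x \<in> K"
proof -
  have "(\<Sum>k<n. (1/2) ^ Suc k *\<^sub>R c k) + (1/2) ^ n *\<^sub>R z \<in> K" if "z \<in> K" for n z
    using that
  proof (induction n arbitrary: z)
    case (Suc n)
    have "(1/2::real) *\<^sub>R c n + (1/2::real) *\<^sub>R z \<in> K"
      using Suc.prems c by (intro convexD[OF K(2)]) auto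
    from Suc.IH[OF this] show ?case by (simp add: scaleR_add_right add.assoc)
  qed auto
  from this[OF c[of 0]] have "(\<Sum>k<n. (1/2) ^ Suc k *\<^sub>R c k) + (1/2) ^ n *\<^sub>R c 0 \<in> K" for n .
  moreover have "(\<lambda>n. (\<Sum>k<n. (1/2) ^ Suc k *\<^sub>R c k) + (1/2) ^ n *\<^sub>R c 0) \<longlonglongrightarrow> x + 0 *\<^sub>R c 0"
    using s unfolding sums_def
    by (intro tendsto_add tendsto_scaleR tendsto_const LIMSEQ_power_zero) auto
  ultimately have "x + 0 *\<^sub>R c 0 \<in> K"
    by (rule closed_sequentially[OF K(1)])
  thus ?thesis by simp
qed

section \<open>Baire category and normal cones\<close>

text \<open>Baire's theorem in \<open>U\<close> gives a ball around some \<open>w1\<close> in the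
  closure of a multiple of \<open>A (Suc n)\<close>. Absorption of
  \<open>(- 1 / ?n) *\<^sub>R w1\<close> and convexity move the centre to the origin.\<close>

lemma Baire_absorbing:
  fixes A :: "nat \<Rightarrow> 'a::banach set"
  assumes U: "closed U" "subspace U" and conv: "\<And>n. convex (A n)" and AU: "\<And>n. A n \<subseteq> U"
    and mono: "\<And>m n. m \<le> n \<Longrightarrow> A m \<subseteq> A n"
    and absorb: "\<And>w. w \<in> U \<Longrightarrow> \<exists>n\<ge>1. (1 / real n) *\<^sub>R w \<in> A n"
  obtains n \<delta> where "0 < \<delta>" "U \<inter> ball 0 \<delta> \<subseteq> closure (A n)"
proof -
  define B where "B n = U \<inter> closure ((\<lambda>x. real (Suc n) *\<^sub>R x) ` A (Suc n))" for n
  have "\<exists>n. (top_of_set U) interior_of (B n) \<noteq> {}"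
  proof (rule ccontr)
    assume "\<not> ?thesis"
    hence "(top_of_set U) interior_of (\<Union> (range B)) = {}"
      by (intro Baire_category_alt)
        (auto simp: B_def completely_metrizable_space_closedin completely_metrizable_space_euclidean U
          closedin_closed_Int)
    moreover have "\<Union> (range B) = U"
    proof
      show "U \<subseteq> \<Union> (range B)"
      proof
        fix w assume w: "w \<in> U"
        then obtain n where n: "n \<ge> 1" "(1 / real n) *\<^sub>R w \<in> A n" using absorb by blast
        then obtain m where m: "n = Suc m" by (cases n) auto
        have "w = real (Suc m) *\<^sub>R ((1 / real n) *\<^sub>R w)" using m by simp
        hence "w \<in> (\<lambda>x. real (Suc m) *\<^sub>R x) ` A (Suc m)" using n m by blast
        thus "w \<in> \<Union> (range B)" using w closure_subset by (fastforce simp: B_def)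
      qed
    qed (auto simp: B_def)
    moreover have "(top_of_set U) interior_of U = U"
      by (metis interior_of_topspace topspace_euclidean_subtopology)
    ultimately show False using subspace_0[OF U(2)] by auto
  qed
  then obtain n w1 where "w1 \<in> (top_of_set U) interior_of (B n)" by blast
  then obtain T where T: "openin (top_of_set U) T" "w1 \<in> T" "T \<subseteq> B n"
    by (auto simp: interior_of_def)
  then obtain r where r: "r > 0" "ball w1 r \<inter> U \<subseteq> B n" and w1: "w1 \<in> U"
    by (meson openin_contains_ball order_trans subsetD openin_imp_subset)
  let ?n = "real (Suc n)"
  have "(- 1 / ?n) *\<^sub>R w1 \<in> U" by (rule subspace_scale[OF U(2) w1])
  from absorb[OF this] obtain m where m: "m \<ge> 1" "(1 / real m) *\<^sub>R ((- 1 / ?n) *\<^sub>R w1) \<in> A m" by blast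
  define N where "N = max (Suc n) m"
  \<comment> \<open>With this radius \<open>w\<close> is the convex combination, with weights
    \<open>1 / (1 + real m)\<close> and \<open>real m / (1 + real m)\<close>, of
    \<open>(1 / ?n) *\<^sub>R v\<close>, where \<open>v\<close> is within \<open>r\<close> of
    \<open>w1\<close>, and the absorbed point of \<open>A m\<close>.\<close>
  define \<delta> where "\<delta> = r / ((1 + real m) * ?n)"
  have "0 < \<delta>" using r m by (simp add: \<delta>_def)
  moreover have "w \<in> closure (A N)" if w: "w \<in> U \<inter> ball 0 \<delta>" for w
  proof -
    define v where "v = w1 + ((1 + real m) * ?n) *\<^sub>R w"
    have "norm (((1 + real m) * ?n) *\<^sub>R w) < r"
    proof -
      have "norm w < r / ((1 + real m) * ?n)" using w by (simp add: \<delta>_def)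
      hence "((1 + real m) * ?n) * norm w < r" using m by (simp add: pos_less_divide_eq mult.commute)
      thus ?thesis by (simp only: norm_scaleR) simp
    qed
    moreover have "v \<in> U"
      unfolding v_def using w w1 by (intro subspace_add[OF U(2)] subspace_scale[OF U(2)]) auto
    ultimately have "v \<in> B n" using r by (auto simp: v_def dist_norm)
    hence "v \<in> (\<lambda>x. ?n *\<^sub>R x) ` closure (A (Suc n))" by (auto simp: B_def closure_scaleR)
    then obtain a where a: "a \<in> closure (A (Suc n))" "v = ?n *\<^sub>R a" by auto
    have aN: "a \<in> closure (A N)"
      using a(1) closure_mono[OF mono[of "Suc n" N]] by (auto simp: N_def)
    have mN: "(1 / real m) *\<^sub>R ((- 1 / ?n) *\<^sub>R w1) \<in> closure (A N)"
      using m mono[of m N] closure_subset by (fastforce simp: N_def)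
    have "(1 / (1 + real m)) *\<^sub>R a + (real m / (1 + real m)) *\<^sub>R ((1 / real m) *\<^sub>R ((- 1 / ?n) *\<^sub>R w1)) \<in> closure (A N)"
      using aN mN by (intro convexD[OF convex_closure[OF conv]]) (auto simp: field_simps)
    moreover have "a = (1 / ?n) *\<^sub>R v" using a(2) by simp
    hence "(1 / (1 + real m)) *\<^sub>R a + (real m / (1 + real m)) *\<^sub>R ((1 / real m) *\<^sub>R ((- 1 / ?n) *\<^sub>R w1)) = w"
      using m unfolding v_def by (simp add: scaleR_add_right divide_simps)
    ultimately show ?thesis by simp
  qed
  ultimately show ?thesis using that by blast
qed

text \<open>The iteration behind the open mapping theorem: approximate by a point of
  \<open>A\<close>, double the error, repeat. The series starts with the coefficient
  \<open>1/2\<close>, which is why the radius is halved.\<close>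

lemma ball_subset_of_closure:
  fixes A :: "'a::banach set"
  assumes cs: "\<And>a x. (\<And>k. a k \<in> A) \<Longrightarrow> (\<lambda>k. (1/2) ^ Suc k *\<^sub>R a k) sums x \<Longrightarrow> x \<in> A"
    and U: "subspace U" "A \<subseteq> U" and \<delta>: "0 < \<delta>" "U \<inter> ball 0 \<delta> \<subseteq> closure A"
  shows "U \<inter> ball 0 (\<delta> / 2) \<subseteq> A"
proof
  fix w assume w: "w \<in> U \<inter> ball 0 (\<delta> / 2)"
  define pick where "pick u = (SOME a. a \<in> A \<and> dist a u < \<delta> / 2)" for u
  have pick: "pick u \<in> A \<and> dist (pick u) u < \<delta> / 2" if "u \<in> U \<inter> ball 0 \<delta>" for u
  proof -
    have "u \<in> closure A" using that \<delta> by blast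
    hence "\<exists>a. a \<in> A \<and> dist a u < \<delta> / 2"
      using \<delta>(1) half_gt_zero[of \<delta>] unfolding closure_approachable Bex_def by blast
    thus ?thesis unfolding pick_def by (rule someI_ex)
  qed
  \<comment> \<open>\<open>u n\<close> is the remainder after \<open>n\<close> terms, rescaled by
    \<open>2 ^ Suc n\<close>; approximation within \<open>\<delta> / 2\<close> keeps it in the ball
    of radius \<open>\<delta>\<close>.\<close>
  define u where "u n = ((\<lambda>u. 2 *\<^sub>R (u - pick u)) ^^ n) (2 *\<^sub>R w)" for n
  have u0: "u 0 = 2 *\<^sub>R w" and uSuc: "u (Suc n) = 2 *\<^sub>R (u n - pick (u n))" for n
    by (simp_all add: u_def)
  have uU: "u n \<in> U \<inter> ball 0 \<delta>" for n
  proof (induction n)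
    case 0
    thus ?case using w by (auto simp: u0 subspace_scale[OF U(1)])
  next
    case (Suc n)
    have "u (Suc n) \<in> U"
      unfolding uSuc using Suc pick[OF Suc] U by (intro subspace_scale subspace_diff) auto
    moreover have "norm (u (Suc n)) < \<delta>"
      using pick[OF Suc] by (simp add: uSuc dist_norm norm_minus_commute)
    ultimately show ?case by simp
  qed
  have part: "w - (\<Sum>k<n. (1/2) ^ Suc k *\<^sub>R pick (u k)) = (1/2) ^ Suc n *\<^sub>R u n" for n
  proof (induction n)
    case 0 thus ?case by (simp add: u0)
  next
    case (Suc n)
    have "w - (\<Sum>k<Suc n. (1/2) ^ Suc k *\<^sub>R pick (u k)) = (1/2) ^ Suc n *\<^sub>R u n - (1/2) ^ Suc n *\<^sub>R pick (u n)"
      using Suc by (simp add: algebra_simps)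
    also have "\<dots> = (1/2) ^ Suc (Suc n) *\<^sub>R u (Suc n)"
      by (simp add: uSuc scaleR_diff_right)
    finally show ?case .
  qed
  have "(\<lambda>n. (1/2) ^ Suc n *\<^sub>R u n) \<longlonglongrightarrow> 0"
  proof (rule Lim_null_comparison)
    show "\<forall>\<^sub>F n in sequentially. norm ((1/2) ^ Suc n *\<^sub>R u n) \<le> (1/2) ^ n * \<delta>"
    proof (intro always_eventually allI)
      fix n
      have "norm (u n) \<le> \<delta>" using uU[of n] by simp
      hence "(1/2) ^ Suc n * norm (u n) \<le> (1/2) ^ n * \<delta>"
        using \<delta>(1) by (intro mult_mono) auto
      thus "norm ((1/2) ^ Suc n *\<^sub>R u n) \<le> (1/2) ^ n * \<delta>" by simp
    qed
    show "(\<lambda>n. (1/2) ^ n * \<delta>) \<longlonglongrightarrow> 0"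
      by (intro tendsto_mult_left_zero LIMSEQ_power_zero) auto
  qed
  hence "(\<lambda>n. w - (\<Sum>k<n. (1/2) ^ Suc k *\<^sub>R pick (u k))) \<longlonglongrightarrow> 0"
    by (simp only: part)
  hence "(\<lambda>n. w - (w - (\<Sum>k<n. (1/2) ^ Suc k *\<^sub>R pick (u k)))) \<longlonglongrightarrow> w - 0"
    by (intro tendsto_diff tendsto_const)
  hence "(\<lambda>k. (1/2) ^ Suc k *\<^sub>R pick (u k)) sums w"
    by (simp add: sums_def)
  thus "w \<in> A" using cs[of "\<lambda>k. pick (u k)"] pick[OF uU] by blast
qed

text \<open>Hahn-Banach is applied to the pairs \<open>(p - q, - blinfun_apply n q)\<close> with
  \<open>p\<close> and \<open>q\<close> in the cones spanned at \<open>z\<close> by \<open>C\<close>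
  and \<open>D\<close>: \<open>q = 0\<close> shows that the resulting functional is normal to
  \<open>C\<close>, and \<open>p = 0\<close> that the rest of \<open>n\<close> is normal to
  \<open>D\<close>.\<close>

lemma normal_cone_Int:
  fixes C D :: "'a::real_normed_vector set"
  assumes C: "convex C" and D: "convex D" and x0: "x0 \<in> interior C" "x0 \<in> D"
    and n: "n \<in> normal_cone (D \<inter> C) z"
  obtains n1 n2 where "n1 \<in> normal_cone C z" "n2 \<in> normal_cone D z" "n = n1 + n2"
proof -
  have zCD: "z \<in> C" "z \<in> D" and nle: "\<And>c. c \<in> D \<inter> C \<Longrightarrow> blinfun_apply n (c - z) \<le> 0"
    using n by (auto simp: normal_cone_def split: if_splits)
  obtain e where e: "0 < e" "cball x0 e \<subseteq> C"
    using x0(1) by (meson mem_interior_cball)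
  define KC where "KC = cone hull ((\<lambda>c. c - z) ` C)"
  define KD where "KD = cone hull ((\<lambda>c. c - z) ` D)"
  have KC: "KC = {a *\<^sub>R (c - z) | a c. 0 \<le> a \<and> c \<in> C}" and KD: "KD = {a *\<^sub>R (c - z) | a c. 0 \<le> a \<and> c \<in> D}"
    unfolding KC_def KD_def cone_hull_expl by blast+
  have "convex ((\<lambda>c. c - z) ` C)" "convex ((\<lambda>c. c - z) ` D)"
    using C D by (auto intro: convex_translation_subtract)
  hence conv: "convex KC" "convex KD" unfolding KC_def KD_def by (auto intro: convex_cone_hull)
  have cone: "cone KC" "cone KD" unfolding KC_def KD_def by (auto intro: cone_cone_hull)
  have addC: "x + y \<in> KC" if "x \<in> KC" "y \<in> KC" for x y
    using conv(1) cone(1) that convex_cone[of KC] by blast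
  have addD: "x + y \<in> KD" if "x \<in> KD" "y \<in> KD" for x y
    using conv(2) cone(2) that convex_cone[of KD] by blast
  have inter: "blinfun_apply n v \<le> 0" if vCD: "v \<in> KC" "v \<in> KD" for v
  proof -
    obtain a c b d where v: "v = a *\<^sub>R (c - z)" "0 \<le> a" "c \<in> C" "v = b *\<^sub>R (d - z)" "0 \<le> b" "d \<in> D"
      using vCD unfolding KC KD by blast
    \<comment> \<open>The summand 1 keeps \<open>N\<close> positive when \<open>a\<close> and
      \<open>b\<close> vanish. A point of \<open>C\<close> and a point of \<open>D\<close> both turn
      out to be \<open>z + (1 / N) *\<^sub>R v\<close>, which therefore lies in the
      intersection.\<close>
    define N where "N = a + b + 1"
    have N: "0 < N" "a / N \<le> 1" "b / N \<le> 1" using v by (auto simp: N_def)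
    have "(1 - a / N) *\<^sub>R z + (a / N) *\<^sub>R c \<in> C"
      using N v zCD by (intro convexD_alt[OF C]) auto
    moreover have "(1 - b / N) *\<^sub>R z + (b / N) *\<^sub>R d \<in> D"
      using N v zCD by (intro convexD_alt[OF D]) auto
    moreover have "(1 - a / N) *\<^sub>R z + (a / N) *\<^sub>R c = z + (1 / N) *\<^sub>R v"
      unfolding v(1) by (simp add: algebra_simps)
    moreover have "(1 - b / N) *\<^sub>R z + (b / N) *\<^sub>R d = z + (1 / N) *\<^sub>R v"
      unfolding v(4) by (simp add: algebra_simps)
    ultimately have "blinfun_apply n (z + (1 / N) *\<^sub>R v - z) \<le> 0"
      by (intro nle) auto
    thus ?thesis using N by (simp add: blinfun.scaleR_right divide_le_0_iff)
  qed
  define G where "G = (\<lambda>(p, q). (p - q, - blinfun_apply n q)) ` (KC \<times> KD)"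
  have "linear (\<lambda>(p, q). (p - q, - blinfun_apply n q))"
    by (rule linearI) (auto simp: blinfun.add_right blinfun.scaleR_right algebra_simps)
  hence convG: "convex G" unfolding G_def by (intro convex_linear_image convex_Times conv)
  have lbG: "- (norm n * norm (x0 - z) / e * norm w) \<le> r" if wr: "(w, r) \<in> G" for w r
  proof -
    obtain p q where pq: "p \<in> KC" "q \<in> KD" "w = p - q" "r = - blinfun_apply n q"
      using wr by (auto simp: G_def)
    \<comment> \<open>Interiority of \<open>x0\<close> enters here: moving \<open>p\<close> by
      \<open>g *\<^sub>R (x0 + b - z)\<close> and \<open>q\<close> by
      \<open>g *\<^sub>R (x0 - z)\<close> produces a common point of both cones, at a cost
      proportional to \<open>norm w\<close>.\<close>
    define g where "g = norm w / e"
    define b where "b = - (e / norm w) *\<^sub>R w"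
    have gb: "g *\<^sub>R b = - w" using e by (simp add: g_def b_def)
    have g: "0 \<le> g" using e by (simp add: g_def)
    have "norm b \<le> e" using e by (simp add: b_def)
    hence "x0 + b \<in> C" using e(2) by (auto simp: dist_norm)
    hence "g *\<^sub>R (x0 + b - z) \<in> KC" unfolding KC using g by blast
    hence "p + g *\<^sub>R (x0 + b - z) \<in> KC" by (intro addC pq)
    moreover have "g *\<^sub>R (x0 - z) \<in> KD" unfolding KD using g x0 by blast
    hence "q + g *\<^sub>R (x0 - z) \<in> KD" by (intro addD pq)
    moreover have "p + g *\<^sub>R (x0 + b - z) = q + g *\<^sub>R (x0 - z) + (w + g *\<^sub>R b)"
      using pq(3) by (simp add: algebra_simps)
    ultimately have "blinfun_apply n (q + g *\<^sub>R (x0 - z)) \<le> 0"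
      using gb by (intro inter) auto
    hence "blinfun_apply n q \<le> - (g * blinfun_apply n (x0 - z))"
      by (simp add: blinfun.add_right blinfun.scaleR_right)
    also have "\<dots> \<le> g * (norm n * norm (x0 - z))"
      using g norm_blinfun[of n "x0 - z"] mult_left_mono[of "- blinfun_apply n (x0 - z)" "norm n * norm (x0 - z)" g]
      by (simp add: abs_le_iff)
    finally show ?thesis unfolding pq(4) by (simp add: g_def mult.commute mult.left_commute)
  qed
  have k0: "0 \<le> norm n * norm (x0 - z) / e" using e(1) by simp
  obtain f where f: "\<And>w r. (w, r) \<in> G \<Longrightarrow> blinfun_apply f w \<le> r"
    using Hahn_Banach_convex[OF convG lbG k0] by blast
  have 0: "0 \<in> KC" "0 \<in> KD" unfolding KC KD using zCD by force+
  have "f \<in> normal_cone C z"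
  proof -
    have "blinfun_apply f (c - z) \<le> 0" if "c \<in> C" for c
    proof -
      have "c - z \<in> KC" unfolding KC using that by (intro CollectI exI[of _ 1] exI[of _ c]) auto
      hence "(c - z, 0) \<in> G" unfolding G_def using 0
        by (intro image_eqI[of _ _ "(c - z, 0)"]) auto
      thus ?thesis by (rule f)
    qed
    thus ?thesis using zCD by (simp add: normal_cone_def)
  qed
  moreover have "n - f \<in> normal_cone D z"
  proof -
    have "blinfun_apply (n - f) (d - z) \<le> 0" if "d \<in> D" for d
    proof -
      have "d - z \<in> KD" unfolding KD using that by (intro CollectI exI[of _ 1] exI[of _ d]) auto
      hence "(0 - (d - z), - blinfun_apply n (d - z)) \<in> G" unfolding G_def using 0
        by (intro image_eqI[of _ _ "(0, d - z)"]) auto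
      from f[OF this] show ?thesis
        by (simp add: blinfun.diff_left blinfun.diff_right)
    qed
    thus ?thesis using zCD by (simp add: normal_cone_def)
  qed
  ultimately show ?thesis using that[of f "n - f"] by simp
qed

section \<open>Monotonically related points\<close>

lemma monotone_opD: "monotone_op T \<Longrightarrow> x' \<in> T x \<Longrightarrow> y' \<in> T y \<Longrightarrow> 0 \<le> blinfun_apply (x' - y') (x - y)"
  unfolding monotone_op_def by blast

lemma maximal_monotone_mem:
  fixes T :: "('a::real_normed_vector) mop"
  assumes T: "maximal_monotone T"
    and rel: "\<And>x x'. x' \<in> T x \<Longrightarrow> 0 \<le> blinfun_apply (x' - y') (x - y)"
  shows "y' \<in> T y"
proof -
  define T' where "T' = T(y := insert y' (T y))"
  have mon: "monotone_op T" using T by (simp add: maximal_monotone_def)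
  have rel': "0 \<le> blinfun_apply (y' - x') (y - x)" if "x' \<in> T x" for x x'
    using rel[OF that] by (simp add: blinfun.diff_left blinfun.diff_right)
  have cases: "z' \<in> T z \<or> z = y \<and> z' = y'" if "z' \<in> T' z" for z z'
    using that by (auto simp: T'_def split: if_splits)
  have "monotone_op T'"
    unfolding monotone_op_def
  proof (intro allI impI)
    fix x z x' z' assume "x' \<in> T' x" "z' \<in> T' z"
    with cases[of x' x] cases[of z' z] rel rel' monotone_opD[OF mon]
    show "0 \<le> blinfun_apply (x' - z') (x - z)" by fastforce
  qed
  moreover have "\<forall>x. T x \<subseteq> T' x" by (auto simp: T'_def)
  ultimately have "T' = T" using T unfolding maximal_monotone_def by blast
  thus ?thesis by (metis T'_def fun_upd_same insertI1)
qed

text \<open>Subtracting a normal vector can only increase the pairing with graph points, so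
  maximality absorbs it. This disposes of the part of a normal vector to an intersection that
  belongs to the closure of the domain.\<close>

lemma maximal_monotone_plus_normal_cone:
  fixes S :: "('a::real_normed_vector) mop"
  assumes S: "maximal_monotone S" and x': "x' \<in> S x" and n: "n \<in> normal_cone (closure (dom_op S)) x"
  shows "x' + n \<in> S x"
proof (rule maximal_monotone_mem[OF S])
  fix u u' assume u': "u' \<in> S u"
  hence "u \<in> closure (dom_op S)"
    using closure_subset[of "dom_op S"] by (auto simp: dom_op_def)
  hence "blinfun_apply n (u - x) \<le> 0"
    using n by (auto simp: normal_cone_def split: if_splits)
  moreover have "0 \<le> blinfun_apply (u' - x') (u - x)"
    using S u' x' by (auto simp: maximal_monotone_def intro: monotone_opD)
  ultimately show "0 \<le> blinfun_apply (u' - (x' + n)) (u - x)"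
    by (simp add: blinfun.diff_left blinfun.add_left)
qed

lemma exists_norming_functional:
  fixes e :: "'a::real_normed_vector"
  assumes "e \<noteq> 0"
  obtains \<phi> :: "'a \<Rightarrow>\<^sub>L real" where "blinfun_apply \<phi> e = 1"
proof -
  obtain f :: "'a \<Rightarrow>\<^sub>L real" where "\<forall>(w, r)\<in>{(- e, - norm e)}. blinfun_apply f w \<le> r"
    using Hahn_Banach_convex[of "{(- e, - norm e)}" 1] by auto
  hence "blinfun_apply f e \<ge> norm e" by (simp add: blinfun.minus_right)
  hence "blinfun_apply f e > 0" using assms by (metis less_le_trans zero_less_norm_iff)
  thus ?thesis using that[of "(1 / blinfun_apply f e) *\<^sub>R f"] by (simp add: blinfun.scaleR_left)
qed

text \<open>C is a thin cone with vertex y around the segment to x, cut off just behind x. On it the distance to y is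
  dominated by a linear functional, which will absorb the bound M ||z - y|| of directional inf boundedness.\<close>
lemma exists_cone_neighbourhood:
  fixes x y :: "'a::real_normed_vector"
  assumes ne: "x \<noteq> y" and eps: "0 < \<epsilon>"
  obtains C and \<phi> :: "'a \<Rightarrow>\<^sub>L real" and Q where "closed C" "convex C" "x \<in> interior C" "y \<in> C" "0 < Q"
    "C \<subseteq> Kset y (ball x \<epsilon>)" "\<And>z. z \<in> C \<Longrightarrow> norm (z - y) \<le> Q * blinfun_apply \<phi> (z - y)"
proof -
  define e where "e = x - y"
  have e0: "e \<noteq> 0" "0 < norm e" using ne by (auto simp: e_def)
  obtain \<phi> :: "'a \<Rightarrow>\<^sub>L real" where \<phi>: "blinfun_apply \<phi> e = 1" by (rule exists_norming_functional[OF e0(1)])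
  \<comment> \<open>\<open>\<eta>\<close> is the opening of the cone and \<open>\<theta>\<close> its
    excess beyond height 1, the height of \<open>x\<close>. Heights at most 2 and
    \<open>\<theta> * norm e \<le> \<epsilon> / 4\<close> keep the part beyond \<open>x\<close>
    within \<open>2 * \<eta> + \<epsilon> / 4 < \<epsilon>\<close> of \<open>x\<close>.\<close>
  define \<eta> where "\<eta> = \<epsilon> / 4"
  define \<theta> where "\<theta> = min 1 (\<epsilon> / (4 * norm e))"
  have \<eta>: "0 < \<eta>" and \<theta>: "0 < \<theta>" "\<theta> \<le> 1" "\<theta> * norm e \<le> \<epsilon> / 4"
    using eps e0 by (auto simp: \<eta>_def \<theta>_def min_def field_simps)
  define g where "g z = norm (z - y - blinfun_apply \<phi> (z - y) *\<^sub>R e) - \<eta> * blinfun_apply \<phi> (z - y)" for z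
  define h where "h z = blinfun_apply \<phi> (z - y)" for z
  have gh: "g z = norm (z - y - h z *\<^sub>R e) - \<eta> * h z" for z by (simp add: g_def h_def)
  define C where "C = {z. g z \<le> 0} \<inter> {z. h z \<le> 1 + \<theta>}"
  have cont: "continuous_on UNIV g" "continuous_on UNIV h"
    unfolding g_def h_def by (auto intro!: continuous_intros)
  have 1: "closed C"
    unfolding C_def by (intro closed_Int closed_Collect_le cont continuous_on_const)
  have 2: "convex C"
  proof (rule convexI)
    fix a b and u v :: real assume ab: "a \<in> C" "b \<in> C" and uv: "0 \<le> u" "0 \<le> v" "u + v = 1"
    have "u *\<^sub>R a + v *\<^sub>R b - y = u *\<^sub>R a + v *\<^sub>R b - (u + v) *\<^sub>R y" using uv by simp
    also have "\<dots> = u *\<^sub>R (a - y) + v *\<^sub>R (b - y)" by (simp add: algebra_simps)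
    finally have eq: "u *\<^sub>R a + v *\<^sub>R b - y = u *\<^sub>R (a - y) + v *\<^sub>R (b - y)" .
    have hh: "h (u *\<^sub>R a + v *\<^sub>R b) = u * h a + v * h b"
      unfolding h_def eq by (simp add: blinfun.add_right blinfun.scaleR_right)
    have "g (u *\<^sub>R a + v *\<^sub>R b) \<le> u * g a + v * g b"
    proof -
      have "u *\<^sub>R (a - y) + v *\<^sub>R (b - y) - (u * h a + v * h b) *\<^sub>R e
          = u *\<^sub>R (a - y - h a *\<^sub>R e) + v *\<^sub>R (b - y - h b *\<^sub>R e)"
        by (simp add: algebra_simps)
      hence "norm (u *\<^sub>R (a - y) + v *\<^sub>R (b - y) - (u * h a + v * h b) *\<^sub>R e)
          \<le> u * norm (a - y - h a *\<^sub>R e) + v * norm (b - y - h b *\<^sub>R e)"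
        using norm_triangle_ineq[of "u *\<^sub>R (a - y - h a *\<^sub>R e)" "v *\<^sub>R (b - y - h b *\<^sub>R e)"] uv by simp
      moreover have "u * g a + v * g b = (u * norm (a - y - h a *\<^sub>R e) + v * norm (b - y - h b *\<^sub>R e)) - \<eta> * (u * h a + v * h b)"
        by (simp add: gh distrib_left right_diff_distrib mult.left_commute)
      ultimately show ?thesis by (simp only: gh eq hh)
    qed
    moreover have "u * g a + v * g b \<le> 0"
      using ab uv by (intro add_nonpos_nonpos mult_nonneg_nonpos) (simp_all add: C_def)
    moreover have "u * h a + v * h b \<le> u * (1 + \<theta>) + v * (1 + \<theta>)"
      using ab uv by (intro add_mono mult_left_mono) (auto simp: C_def)
    moreover have "u * (1 + \<theta>) + v * (1 + \<theta>) = 1 + \<theta>" using uv by (metis distrib_right mult_1)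
    ultimately show "u *\<^sub>R a + v *\<^sub>R b \<in> C" unfolding C_def by (auto simp: hh)
  qed
  have 3: "x \<in> interior C"
  proof (rule interiorI)
    show "open ({z. g z < 0} \<inter> {z. h z < 1 + \<theta>})"
      by (intro open_Int open_Collect_less cont continuous_on_const)
    show "x \<in> {z. g z < 0} \<inter> {z. h z < 1 + \<theta>}"
      using \<phi> \<eta> \<theta> by (simp add: g_def h_def e_def[symmetric])
    show "{z. g z < 0} \<inter> {z. h z < 1 + \<theta>} \<subseteq> C" by (auto simp: C_def)
  qed
  have 4: "y \<in> C" using \<theta> by (simp add: C_def g_def h_def)
  have 5: "0 < norm e + \<eta>" by (rule add_pos_pos[OF e0(2) \<eta>])
  have bound: "norm (z - y) \<le> (norm e + \<eta>) * blinfun_apply \<phi> (z - y)" and pos: "0 \<le> h z" if "z \<in> C" for z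
  proof -
    have le: "norm (z - y - h z *\<^sub>R e) \<le> \<eta> * h z" using that by (simp add: C_def g_def h_def)
    hence "0 \<le> \<eta> * h z" by (rule order_trans[OF norm_ge_zero])
    thus pos: "0 \<le> h z" using \<eta> by (simp add: zero_le_mult_iff)
    have "norm (z - y) \<le> norm (z - y - h z *\<^sub>R e) + norm (h z *\<^sub>R e)"
      using norm_triangle_ineq[of "z - y - h z *\<^sub>R e" "h z *\<^sub>R e"] by simp
    thus "norm (z - y) \<le> (norm e + \<eta>) * blinfun_apply \<phi> (z - y)"
      using le pos by (simp add: h_def algebra_simps)
  qed
  have 6: "C \<subseteq> Kset y (ball x \<epsilon>)"
  proof
    fix z assume z: "z \<in> C"
    hence le: "norm (z - y - h z *\<^sub>R e) \<le> \<eta> * h z" and h1: "h z \<le> 1 + \<theta>" and h0: "0 \<le> h z"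
      using pos[OF z] by (auto simp: C_def g_def h_def)
    \<comment> \<open>At height 0 only the vertex remains; up to height 1 the ray from
      \<open>y\<close> through \<open>z\<close> meets height 1 at a point \<open>a\<close> near
      \<open>x\<close>; above height 1 the point \<open>z\<close> is itself near
      \<open>x\<close>.\<close>
    consider "h z = 0" | "0 < h z" "h z \<le> 1" | "1 < h z" using h0 by linarith
    thus "z \<in> Kset y (ball x \<epsilon>)"
    proof cases
      case 1
      hence "z = y" using le by simp
      thus ?thesis unfolding Kset_def using eps
        by (intro CollectI exI[of _ 0] exI[of _ x]) auto
    next
      case 2
      define a where "a = y + (1 / h z) *\<^sub>R (z - y)"
      have "a - x = (1 / h z) *\<^sub>R (z - y - h z *\<^sub>R e)"
        using 2 by (simp add: a_def e_def algebra_simps)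
      hence "norm (a - x) = (1 / h z) * norm (z - y - h z *\<^sub>R e)" using 2 by simp
      hence "norm (a - x) \<le> \<eta>" using le 2 by (simp add: pos_divide_le_eq)
      hence "a \<in> ball x \<epsilon>" using eps by (simp add: dist_norm norm_minus_commute \<eta>_def)
      moreover have "z = (1 - h z) *\<^sub>R y + h z *\<^sub>R a"
        using 2 by (simp add: a_def algebra_simps)
      ultimately show ?thesis unfolding Kset_def using 2
        by (intro CollectI exI[of _ "h z"] exI[of _ a]) auto
    next
      case 3
      have eq: "z - x = (z - y - h z *\<^sub>R e) + (h z - 1) *\<^sub>R e" by (simp add: e_def algebra_simps)
      have "norm (z - x) \<le> norm (z - y - h z *\<^sub>R e) + (h z - 1) * norm e"
        unfolding eq using 3 by (intro order_trans[OF norm_triangle_ineq]) simp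
      also have "\<dots> \<le> \<eta> * 2 + \<theta> * norm e"
      proof (rule add_mono)
        have "\<eta> * h z \<le> \<eta> * 2" using h1 \<theta>(2) \<eta> by (intro mult_left_mono) auto
        thus "norm (z - y - h z *\<^sub>R e) \<le> \<eta> * 2" using le by linarith
        show "(h z - 1) * norm e \<le> \<theta> * norm e" using h1 by (intro mult_right_mono) auto
      qed
      also have "\<dots> < \<epsilon>" using \<theta> eps by (simp add: \<eta>_def)
      finally have "z \<in> ball x \<epsilon>" by (simp add: dist_norm norm_minus_commute)
      thus ?thesis unfolding Kset_def
        by (intro CollectI exI[of _ 1] exI[of _ z]) auto
    qed
  qed
  from 1 2 3 4 5 6 bound show ?thesis by (rule that)
qed

lemma mem_dom_of_monotonically_related:
  fixes T S :: "('a::real_normed_vector) mop"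
  assumes S: "maximal_monotone S" and D: "convex (closure (dom_op S))"
    and dom: "dom_op T \<inter> closure (dom_op S) \<subseteq> dom_op S"
    and max: "\<And>C. closed C \<Longrightarrow> convex C \<Longrightarrow> x0 \<in> interior C
      \<Longrightarrow> maximal_monotone (sum_op T (normal_cone (closure (dom_op S) \<inter> C)))"
    and x0: "x0 \<in> dom_op T \<inter> dom_op S" and bd: "dir_inf_bounded S x0"
    and rel: "\<And>x t s. t \<in> T x \<Longrightarrow> s \<in> S x \<Longrightarrow> 0 \<le> blinfun_apply (t + s - y') (x - y)"
  shows "y \<in> dom_op T \<inter> dom_op S"
proof (cases "y = x0")
  case True thus ?thesis using x0 by simp
next
  case False
  let ?D = "closure (dom_op S)"
  obtain \<epsilon> M where eM: "0 < \<epsilon>" "0 < M"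
    "\<forall>z\<in>Kset y (ball x0 \<epsilon>) \<inter> dom_op S. \<exists>z'\<in>S z. blinfun_apply z' (z - y) \<le> M * norm (z - y)"
    using bd unfolding dir_inf_bounded_def by blast
  obtain C Q \<phi> where C: "closed C" "convex C" "x0 \<in> interior C" "y \<in> C" "0 < Q"
    "C \<subseteq> Kset y (ball x0 \<epsilon>)" "\<And>z. z \<in> C \<Longrightarrow> norm (z - y) \<le> Q * blinfun_apply \<phi> (z - y)"
    by (rule exists_cone_neighbourhood[OF False[symmetric] eM(1)]) (rule that)
  have x0D: "x0 \<in> ?D" using x0 closure_subset[of "dom_op S"] by blast
  \<comment> \<open>The multiple of \<open>\<phi>\<close> pays for the bound on \<open>s\<close>. Of
    the normal vector, \<open>n1\<close> has the right sign because \<open>y\<close> lies in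
    \<open>C\<close>, and \<open>n2\<close> is absorbed into \<open>S\<close>, so that
    \<open>rel\<close> applies to \<open>s + n2\<close>.\<close>
  have "y' - (M * Q) *\<^sub>R \<phi> \<in> sum_op T (normal_cone (?D \<inter> C)) y"
  proof (rule maximal_monotone_mem[OF max[OF C(1-3)]])
    fix z z' assume "z' \<in> sum_op T (normal_cone (?D \<inter> C)) z"
    then obtain t n where t: "t \<in> T z" and n: "n \<in> normal_cone (?D \<inter> C) z" and z': "z' = t + n"
      by (auto simp: sum_op_def)
    have z: "z \<in> ?D" "z \<in> C" using n by (simp_all add: normal_cone_def split: if_splits)
    have "z \<in> dom_op T" using t by (auto simp: dom_op_def)
    hence "z \<in> Kset y (ball x0 \<epsilon>) \<inter> dom_op S" using z dom C(6) by blast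
    then obtain s where s: "s \<in> S z" "blinfun_apply s (z - y) \<le> M * norm (z - y)" using eM(3) by blast
    obtain n1 n2 where n12: "n1 \<in> normal_cone C z" "n2 \<in> normal_cone ?D z" "n = n1 + n2"
      by (rule normal_cone_Int[OF C(2) D C(3) x0D n])
    have "0 \<le> blinfun_apply (t + (s + n2) - y') (z - y)"
      using t maximal_monotone_plus_normal_cone[OF S s(1) n12(2)] by (rule rel)
    moreover have "blinfun_apply n1 (y - z) \<le> 0"
      using n12(1) C(4) z(2) by (simp add: normal_cone_def)
    moreover have "blinfun_apply s (z - y) \<le> (M * Q) * blinfun_apply \<phi> (z - y)"
      using s(2) mult_left_mono[OF C(7)[OF z(2)] less_imp_le[OF eM(2)]] by (simp add: mult.assoc)
    moreover have "blinfun_apply n1 (y - z) = - blinfun_apply n1 (z - y)"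
      by (simp add: blinfun.diff_right)
    ultimately show "0 \<le> blinfun_apply (z' - (y' - (M * Q) *\<^sub>R \<phi>)) (z - y)"
      unfolding z' n12(3) by (simp add: blinfun.diff_left blinfun.add_left blinfun.scaleR_left)
  qed
  then obtain t n where tn: "t \<in> T y" "n \<in> normal_cone (?D \<inter> C) y"
    unfolding sum_op_def by blast
  from tn(2) have "y \<in> ?D" by (simp add: normal_cone_def split: if_splits)
  moreover from tn(1) have "y \<in> dom_op T" by (auto simp: dom_op_def)
  ultimately show ?thesis using dom by blast
qed

section \<open>Approximate solutions at the origin\<close>

text \<open>\<open>S\<close> and \<open>T\<close> are graphs, translated so that the related pair
  becomes the origin. The maximality of the sums with normal cones enters through
  \<open>approx\<close>. Of the segments in directional inf boundedness, \<open>dir_bounded\<close>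
  keeps only the ends near \<open>x0\<close>, where the distance to \<open>y\<close> is bounded and
  the estimate becomes a constant.\<close>

locale monotone_pair =
  fixes S T :: "('a::banach \<times> ('a \<Rightarrow>\<^sub>L real)) set" and x0 :: 'a and s0 t0 :: "'a \<Rightarrow>\<^sub>L real" and U :: "'a set"
  assumes monS: "(x, x') \<in> S \<Longrightarrow> (u, u') \<in> S \<Longrightarrow> 0 \<le> blinfun_apply (x' - u') (x - u)"
    and monT: "(x, x') \<in> T \<Longrightarrow> (u, u') \<in> T \<Longrightarrow> 0 \<le> blinfun_apply (x' - u') (x - u)"
    and zeroS: "(0, s0) \<in> S" and zeroT: "(0, t0) \<in> T"
    and nonneg: "(x, t) \<in> T \<Longrightarrow> (x, s) \<in> S \<Longrightarrow> 0 \<le> blinfun_apply (t + s) x"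
    and approx: "0 < e \<Longrightarrow> \<exists>x t s. (x, t) \<in> T \<and> (x, s) \<in> S \<and> blinfun_apply (t + s - y') (x - y) \<le> e"
    and dir_bounded: "\<exists>\<epsilon>>0. \<exists>M. \<forall>c\<in>fst ` S \<inter> ball x0 \<epsilon>. \<exists>c'. (c, c') \<in> S \<and> blinfun_apply c' (c - y) \<le> M"
    and x0S: "x0 \<in> fst ` S" and x0T: "x0 \<in> fst ` T"
    and convD: "convex (closure (fst ` S))"
    and closedU: "closed U" and subspaceU: "subspace U"
    and U_iff: "w \<in> U \<longleftrightarrow> (\<exists>r>0. \<exists>d\<in>convex hull (fst ` T). \<exists>c\<in>closure (fst ` S). w = r *\<^sub>R (d - c))"
begin

section \<open>The Fitzpatrick epigraph and the convexified graphs\<close>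

abbreviation "D \<equiv> closure (fst ` S)"

text \<open>The epigraph of the Fitzpatrick function of T.\<close>
definition FT :: "('a \<times> ('a \<Rightarrow>\<^sub>L real) \<times> real) set" where
  "FT = {(x, x', r). \<forall>(d, d')\<in>T. blinfun_apply x' d + blinfun_apply d' x \<le> blinfun_apply d' d + r}"

text \<open>A convex set containing all points (x, t, s, t x, s x) with t in T x and s in S x. Passing from the
  graphs to this set is what makes a separation argument possible.\<close>
definition H :: "('a \<times> ('a \<Rightarrow>\<^sub>L real) \<times> ('a \<Rightarrow>\<^sub>L real) \<times> real \<times> real) set" where
  "H = {(x, t, s, \<sigma>, \<rho>).
     (\<forall>(c, c')\<in>S. blinfun_apply s c + blinfun_apply c' x \<le> \<rho> + blinfun_apply c' c) \<and>
     (\<forall>(d, d', r)\<in>FT. blinfun_apply t d + blinfun_apply d' x \<le> \<sigma> + r)}"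

lemma FT_D: "(x, x', r) \<in> FT \<Longrightarrow> (d, d') \<in> T \<Longrightarrow> blinfun_apply x' d + blinfun_apply d' x \<le> blinfun_apply d' d + r"
  unfolding FT_def by blast

lemma H_D1: "(x, t, s, \<sigma>, \<rho>) \<in> H \<Longrightarrow> (c, c') \<in> S \<Longrightarrow> blinfun_apply s c + blinfun_apply c' x \<le> \<rho> + blinfun_apply c' c"
  unfolding H_def by blast

lemma H_D2: "(x, t, s, \<sigma>, \<rho>) \<in> H \<Longrightarrow> (d, d', r) \<in> FT \<Longrightarrow> blinfun_apply t d + blinfun_apply d' x \<le> \<sigma> + r"
  unfolding H_def by blast

lemma graph_FT:
  assumes "(d, d') \<in> T" shows "(d, d', blinfun_apply d' d) \<in> FT"
proof -
  have "blinfun_apply d' e + blinfun_apply e' d \<le> blinfun_apply e' e + blinfun_apply d' d" if "(e, e') \<in> T" for e e'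
    using monT[OF assms that] by (simp add: blinfun.diff_left blinfun.diff_right)
  thus ?thesis unfolding FT_def by blast
qed

lemma graph_H:
  assumes t: "(x, t) \<in> T" and s: "(x, s) \<in> S"
  shows "(x, t, s, blinfun_apply t x, blinfun_apply s x) \<in> H"
proof -
  have "blinfun_apply s c + blinfun_apply c' x \<le> blinfun_apply s x + blinfun_apply c' c" if "(c, c') \<in> S" for c c'
    using monS[OF s that] by (simp add: blinfun.diff_left blinfun.diff_right)
  moreover have "blinfun_apply t d + blinfun_apply d' x \<le> blinfun_apply t x + r" if "(d, d', r) \<in> FT" for d d' r
    using FT_D[OF that t] by simp
  ultimately show ?thesis unfolding H_def by blast
qed

lemma convex_FT: "convex FT"
proof (rule convexI)
  fix p q and u v :: real assume pq: "p \<in> FT" "q \<in> FT" and uv: "0 \<le> u" "0 \<le> v" "u + v = 1"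
  obtain x x' r y y' s where p: "p = (x, x', r)" and q: "q = (y, y', s)" by (cases p, cases q)
  have "blinfun_apply (u *\<^sub>R x' + v *\<^sub>R y') d + blinfun_apply d' (u *\<^sub>R x + v *\<^sub>R y) \<le> blinfun_apply d' d + (u * r + v * s)"
    if d: "(d, d') \<in> T" for d d'
  proof -
    have "u * (blinfun_apply x' d + blinfun_apply d' x) + v * (blinfun_apply y' d + blinfun_apply d' y)
        \<le> u * (blinfun_apply d' d + r) + v * (blinfun_apply d' d + s)"
      by (rule add_mono[OF mult_left_mono mult_left_mono]) (use pq uv FT_D d in \<open>auto simp: p q\<close>)
    also have "\<dots> = (u + v) * blinfun_apply d' d + (u * r + v * s)" by (simp add: algebra_simps)
    finally show ?thesis
      using uv by (simp add: blinfun.add_left blinfun.scaleR_left blinfun.add_right blinfun.scaleR_right algebra_simps)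
  qed
  thus "u *\<^sub>R p + v *\<^sub>R q \<in> FT" unfolding p q FT_def by auto
qed

lemma closed_FT: "closed FT"
proof -
  have "FT = (\<Inter>(d, d')\<in>T. {z. blinfun_apply (fst (snd z)) d + blinfun_apply d' (fst z) \<le> blinfun_apply d' d + snd (snd z)})"
    unfolding FT_def by auto
  moreover have "closed {z :: 'a \<times> ('a \<Rightarrow>\<^sub>L real) \<times> real.
      blinfun_apply (fst (snd z)) d + blinfun_apply d' (fst z) \<le> blinfun_apply d' d + snd (snd z)}" for d d'
    by (intro closed_Collect_le continuous_intros)
  ultimately show ?thesis by (auto intro!: closed_INT)
qed

lemma FT_mono: "(x, x', r) \<in> FT \<Longrightarrow> r \<le> r' \<Longrightarrow> (x, x', r') \<in> FT"
  unfolding FT_def by fastforce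

text \<open>A point of the hull need not lie in the domain of \<open>T\<close>; a member of the
  Fitzpatrick epigraph above it replaces the missing graph element.\<close>

lemma hull_FT:
  assumes "d \<in> convex hull (fst ` T)" obtains d' r where "(d, d', r) \<in> FT"
proof -
  have "convex (fst ` FT)" by (rule convex_linear_image[OF linear_fst convex_FT])
  moreover have "fst ` T \<subseteq> fst ` FT" using graph_FT by (force simp: image_iff)
  ultimately have "convex hull (fst ` T) \<subseteq> fst ` FT" by (simp add: hull_minimal)
  thus ?thesis using assms that by fastforce
qed

lemma convex_H: "convex H"
proof (rule convexI)
  fix p q and u v :: real assume pq: "p \<in> H" "q \<in> H" and uv: "0 \<le> u" "0 \<le> v" "u + v = 1"
  obtain x t s \<sigma> \<rho> y t' s' \<sigma>' \<rho>' where p: "p = (x, t, s, \<sigma>, \<rho>)" and q: "q = (y, t', s', \<sigma>', \<rho>')"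
    by (cases p, cases q)
  have "blinfun_apply (u *\<^sub>R s + v *\<^sub>R s') c + blinfun_apply c' (u *\<^sub>R x + v *\<^sub>R y) \<le> (u * \<rho> + v * \<rho>') + blinfun_apply c' c"
    if c: "(c, c') \<in> S" for c c'
  proof -
    have "u * (blinfun_apply s c + blinfun_apply c' x) + v * (blinfun_apply s' c + blinfun_apply c' y)
        \<le> u * (\<rho> + blinfun_apply c' c) + v * (\<rho>' + blinfun_apply c' c)"
      by (rule add_mono[OF mult_left_mono mult_left_mono]) (use pq uv H_D1 c in \<open>auto simp: p q\<close>)
    also have "\<dots> = (u + v) * blinfun_apply c' c + (u * \<rho> + v * \<rho>')" by (simp add: algebra_simps)
    finally show ?thesis
      using uv by (simp add: blinfun.add_left blinfun.scaleR_left blinfun.add_right blinfun.scaleR_right algebra_simps)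
  qed
  moreover have "blinfun_apply (u *\<^sub>R t + v *\<^sub>R t') d + blinfun_apply d' (u *\<^sub>R x + v *\<^sub>R y) \<le> (u * \<sigma> + v * \<sigma>') + r"
    if d: "(d, d', r) \<in> FT" for d d' r
  proof -
    have "u * (blinfun_apply t d + blinfun_apply d' x) + v * (blinfun_apply t' d + blinfun_apply d' y)
        \<le> u * (\<sigma> + r) + v * (\<sigma>' + r)"
      by (rule add_mono[OF mult_left_mono mult_left_mono]) (use pq uv H_D2 d in \<open>auto simp: p q\<close>)
    also have "\<dots> = (u + v) * r + (u * \<sigma> + v * \<sigma>')" by (simp add: algebra_simps)
    finally show ?thesis
      using uv by (simp add: blinfun.add_left blinfun.scaleR_left blinfun.add_right blinfun.scaleR_right algebra_simps)
  qed
  ultimately show "u *\<^sub>R p + v *\<^sub>R q \<in> H" unfolding p q H_def by auto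
qed

lemma H_separation:
  fixes g :: "'a \<Rightarrow>\<^sub>L real"
  assumes e: "0 < e" and sep: "\<And>x t s \<sigma> \<rho>. (x, t, s, \<sigma>, \<rho>) \<in> H \<Longrightarrow>
      e \<le> blinfun_apply g x + blinfun_apply (t + s) v + \<gamma> * (\<sigma> + \<rho>)"
  shows False
proof -
  \<comment> \<open>As (t + s) x is nonnegative on the graphs, \<gamma> may be replaced by a large G > 0; completing the square then contradicts approx at (- v / G, - g / G).\<close>
  define G where "G = \<bar>\<gamma>\<bar> + 1 + 2 * \<bar>blinfun_apply g v\<bar> / e"
  have "0 \<le> 2 * \<bar>blinfun_apply g v\<bar> / e" using e by simp
  hence G: "0 < G" "\<gamma> \<le> G" unfolding G_def by linarith+
  have "2 * \<bar>blinfun_apply g v\<bar> / e \<le> G" by (simp add: G_def)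
  hence Ge: "\<bar>blinfun_apply g v\<bar> \<le> G * e / 2" using e by (simp add: field_simps)
  define y where "y = - (1 / G) *\<^sub>R v"
  define y' where "y' = - (1 / G) *\<^sub>R g"
  \<comment> \<open>Multiplied by \<open>G * G\<close>, this tolerance becomes
    \<open>G * e / 4\<close>. The last summand of \<open>G\<close> keeps
    \<open>\<bar>blinfun_apply g v\<bar>\<close> at most \<open>G * e / 2\<close>, so at least
    \<open>G * e / 2\<close> remains on the other side.\<close>
  obtain x t s where xts: "(x, t) \<in> T" "(x, s) \<in> S" "blinfun_apply (t + s - y') (x - y) \<le> e / (4 * G)"
    using approx[of "e / (4 * G)" y' y] e G by auto
  have "e \<le> blinfun_apply g x + blinfun_apply (t + s) v + \<gamma> * blinfun_apply (t + s) x"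
    using sep[OF graph_H[OF xts(1,2)]] by (simp add: blinfun.add_left)
  also have "\<dots> \<le> blinfun_apply g x + blinfun_apply (t + s) v + G * blinfun_apply (t + s) x"
    using nonneg[OF xts(1,2)] G by (intro add_left_mono mult_right_mono) auto
  finally have 1: "e \<le> blinfun_apply g x + blinfun_apply (t + s) v + G * blinfun_apply (t + s) x" .
  have "G * G * blinfun_apply (t + s - y') (x - y)
      = G * (blinfun_apply g x + blinfun_apply (t + s) v + G * blinfun_apply (t + s) x) + blinfun_apply g v"
    using G(1) by (simp add: y_def y'_def blinfun.diff_left blinfun.diff_right blinfun.minus_left blinfun.minus_right
        blinfun.scaleR_left blinfun.scaleR_right blinfun.add_left blinfun.add_right field_simps)
  hence "G * e + blinfun_apply g v \<le> G * G * blinfun_apply (t + s - y') (x - y)"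
    using 1 G by simp
  also have "\<dots> \<le> G * G * (e / (4 * G))" using xts(3) G by (intro mult_left_mono) auto
  also have "\<dots> = G * e / 4" using G by simp
  finally have "G * e + blinfun_apply g v \<le> G * e / 4" .
  moreover have "0 < G * e" using G e by simp
  ultimately show False using Ge by (simp add: abs_le_iff)
qed

section \<open>The filter of approximate solutions\<close>

definition near :: "'a set \<Rightarrow> real \<Rightarrow> ('a \<times> ('a \<Rightarrow>\<^sub>L real) \<times> ('a \<Rightarrow>\<^sub>L real) \<times> real \<times> real) set" where
  "near \<Phi> e = {(x, t, s, \<sigma>, \<rho>). (x, t, s, \<sigma>, \<rho>) \<in> H \<and> norm x < e \<and>
     (\<forall>\<phi>\<in>\<Phi>. \<bar>blinfun_apply (t + s) \<phi>\<bar> < e) \<and> \<bar>\<sigma> + \<rho>\<bar> < e}"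

text \<open>Otherwise the seminorm \<open>p\<close> is at least \<open>e\<close> on the image of
  \<open>H\<close>, and Hahn-Banach gives a linear \<open>f\<close> below \<open>p\<close> that
  separates this image from 0. It consists of a functional \<open>g\<close>, an evaluation at a
  point \<open>v\<close>, because only finitely many values of \<open>t + s\<close> enter
  \<open>p\<close>, and a scalar; \<open>H_separation\<close> excludes this.\<close>

lemma near_nonempty:
  assumes \<Phi>: "finite \<Phi>" and e: "0 < e"
  shows "near \<Phi> e \<noteq> {}"
proof
  assume empty: "near \<Phi> e = {}"
  define p where "p z = (case z of (x, g, r) \<Rightarrow> norm x + (\<Sum>\<phi>\<in>\<Phi>. \<bar>blinfun_apply g \<phi>\<bar>) + \<bar>r\<bar>)"
    for z :: "'a \<times> ('a \<Rightarrow>\<^sub>L real) \<times> real"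
  \<comment> \<open>The signs, together with the level \<open>- e\<close> added by the translation,
    make \<open>f w \<le> r\<close> say that \<open>f\<close> is at least \<open>e\<close> on the
    image of \<open>H\<close>.\<close>
  define G where "G = (\<lambda>(x, t, s, \<sigma>, \<rho>). ((- x, - (t + s), - (\<sigma> + \<rho>)), 0::real)) ` H"
  have lin: "linear (\<lambda>(x::'a, t::'a \<Rightarrow>\<^sub>L real, s, \<sigma>::real, \<rho>). ((- x, - (t + s), - (\<sigma> + \<rho>)), 0::real))"
    by (rule linearI) (auto simp: scaleR_add_right algebra_simps)
  have convG: "convex ((\<lambda>z. ((0, 0, 0), - e) + z) ` G)"
    unfolding G_def by (intro convex_translation convex_linear_image[OF lin] convex_H)
  have sub: "sublinear p"
  proof (rule sublinearI)
    fix a b show "p (a + b) \<le> p a + p b"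
    proof (cases a, cases b)
      fix x g r x' g' r' assume ab: "a = (x, g, r)" "b = (x', g', r')"
      have "(\<Sum>\<phi>\<in>\<Phi>. \<bar>blinfun_apply (g + g') \<phi>\<bar>) \<le> (\<Sum>\<phi>\<in>\<Phi>. \<bar>blinfun_apply g \<phi>\<bar> + \<bar>blinfun_apply g' \<phi>\<bar>)"
        by (intro sum_mono) (simp add: blinfun.add_left)
      thus ?thesis using norm_triangle_ineq[of x x'] abs_triangle_ineq[of r r']
        by (simp add: ab p_def sum.distrib)
    qed
  next
    fix a :: "'a \<times> ('a \<Rightarrow>\<^sub>L real) \<times> real" and c :: real assume "0 < c"
    thus "p (c *\<^sub>R a) \<le> c * p a"
      by (cases a) (simp add: p_def blinfun.scaleR_left abs_mult sum_distrib_left distrib_left)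
  qed
  have "- p (- w) \<le> r" if wr: "(w, r) \<in> (\<lambda>z. ((0, 0, 0), - e) + z) ` G" for w r
  proof -
    obtain x t s \<sigma> \<rho> where z: "(x, t, s, \<sigma>, \<rho>) \<in> H" "w = (- x, - (t + s), - (\<sigma> + \<rho>))" "r = - e"
      using wr by (auto simp: G_def)
    have "(x, t, s, \<sigma>, \<rho>) \<notin> near \<Phi> e" using empty by simp
    hence "e \<le> norm x \<or> (\<exists>\<phi>\<in>\<Phi>. e \<le> \<bar>blinfun_apply (t + s) \<phi>\<bar>) \<or> e \<le> \<bar>\<sigma> + \<rho>\<bar>"
      using z(1) by (auto simp: near_def not_less)
    moreover have "\<bar>blinfun_apply (t + s) \<phi>\<bar> \<le> (\<Sum>\<phi>\<in>\<Phi>. \<bar>blinfun_apply (t + s) \<phi>\<bar>)" if "\<phi> \<in> \<Phi>" for \<phi>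
      using \<Phi> that by (intro member_le_sum) auto
    moreover have "0 \<le> (\<Sum>\<phi>\<in>\<Phi>. \<bar>blinfun_apply (t + s) \<phi>\<bar>)" by (simp add: sum_nonneg)
    ultimately have "e \<le> norm x + (\<Sum>\<phi>\<in>\<Phi>. \<bar>blinfun_apply (t + s) \<phi>\<bar>) + \<bar>\<sigma> + \<rho>\<bar>"
      by (smt (verit) norm_ge_zero)
    moreover have "p (- w) = norm x + (\<Sum>\<phi>\<in>\<Phi>. \<bar>blinfun_apply (t + s) \<phi>\<bar>) + \<bar>\<sigma> + \<rho>\<bar>"
      by (simp add: z(2) p_def add.commute)
    ultimately show ?thesis by (simp add: z(3))
  qed
  from Hahn_Banach_convex_sublinear[OF sub convG this]
  obtain f where f: "linear f" "\<forall>z. f z \<le> p z" "\<forall>(w, r)\<in>(\<lambda>z. ((0, 0, 0), - e) + z) ` G. f w \<le> r" by blast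
  have "linear (\<lambda>x::'a. (x, 0::'a \<Rightarrow>\<^sub>L real, 0::real))" "linear (\<lambda>g::'a \<Rightarrow>\<^sub>L real. (0::'a, g, 0::real))"
    by (auto intro!: linearI)
  from this[THEN linear_compose, OF f(1)]
  have "linear (\<lambda>x. f (x, 0, 0))" "linear (\<lambda>g. f (0, g, 0))"
    by (simp_all add: o_def)
  have 1: "f (x, 0, 0) \<le> 1 * norm x" for x using f(2)[rule_format, of "(x, 0, 0)"] by (simp add: p_def)
  obtain g :: "'a \<Rightarrow>\<^sub>L real" where g: "\<And>x. blinfun_apply g x = f (x, 0, 0)"
    by (rule linear_bounded_blinfun[OF \<open>linear (\<lambda>x. f (x, 0, 0))\<close> 1]) (rule that)
  have "\<exists>v. \<forall>g. f (0, g, 0) = blinfun_apply g v"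
  proof (rule linear_functional_of_finite_kernel[OF \<Phi> \<open>linear (\<lambda>g. f (0, g, 0))\<close>])
    fix g :: "'a \<Rightarrow>\<^sub>L real" assume "\<And>\<phi>. \<phi> \<in> \<Phi> \<Longrightarrow> blinfun_apply g \<phi> = 0"
    hence "p (0, g, 0) = 0" "p (- (0, g, 0)) = 0" by (simp_all add: p_def blinfun.minus_left)
    thus "f (0, g, 0) = 0"
      using f(2)[rule_format, of "(0, g, 0)"] f(2)[rule_format, of "- (0, g, 0)"] linear_neg[OF f(1), of "(0, g, 0)"]
      by linarith
  qed
  then obtain v where v: "\<forall>g. f (0, g, 0) = blinfun_apply g v" by blast
  show False
  proof (rule H_separation[OF e])
    fix x t s \<sigma> \<rho> assume h: "(x, t, s, \<sigma>, \<rho>) \<in> H"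
    have "((- x, - (t + s), - (\<sigma> + \<rho>)), - e) \<in> (\<lambda>z. ((0, 0, 0), - e) + z) ` G"
      unfolding G_def image_image using h by (intro image_eqI[of _ _ "(x, t, s, \<sigma>, \<rho>)"]) auto
    hence "f (- x, - (t + s), - (\<sigma> + \<rho>)) \<le> - e" using f(3) by blast
    moreover have "(- x, - (t + s), - (\<sigma> + \<rho>)) = - ((x, 0, 0) + (0, t + s, 0) + (\<sigma> + \<rho>) *\<^sub>R (0, 0, 1))" by simp
    ultimately have "f (- ((x, 0, 0) + (0, t + s, 0) + (\<sigma> + \<rho>) *\<^sub>R (0, 0, 1))) \<le> - e" by metis
    hence "e \<le> f (x, 0, 0) + f (0, t + s, 0) + (\<sigma> + \<rho>) * f (0, 0, 1)"
      by (simp only: linear_neg[OF f(1)] linear_add[OF f(1)] linear_scale[OF f(1)]) simp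
    thus "e \<le> blinfun_apply g x + blinfun_apply (t + s) v + f (0, 0, 1) * (\<sigma> + \<rho>)"
      by (simp add: g v mult.commute)
  qed
qed
text \<open>Convergence along F means: x tends to 0 in norm, t + s tends to 0 pointwise, and \<sigma> + \<rho> tends to 0.\<close>
definition F :: "('a \<times> ('a \<Rightarrow>\<^sub>L real) \<times> ('a \<Rightarrow>\<^sub>L real) \<times> real \<times> real) filter" where
  "F = (INF (\<Phi>, e)\<in>{(\<Phi>, e). finite \<Phi> \<and> 0 < e}. principal (near \<Phi> e))"

lemma eventually_F: "eventually P F \<longleftrightarrow> (\<exists>\<Phi> e. finite \<Phi> \<and> 0 < e \<and> (\<forall>h\<in>near \<Phi> e. P h))"
proof -
  have *: "near (\<Phi> \<union> \<Phi>') (min e e') \<subseteq> near \<Phi> e \<inter> near \<Phi>' e'" for \<Phi> \<Phi>' and e e' :: real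
    by (auto simp: near_def)
  have "eventually P F \<longleftrightarrow> (\<exists>b\<in>{(\<Phi>, e). finite \<Phi> \<and> 0 < e}. eventually P (case b of (\<Phi>, e) \<Rightarrow> principal (near \<Phi> e)))"
    unfolding F_def
  proof (rule eventually_INF_base)
    show "{(\<Phi>::'a set, e::real). finite \<Phi> \<and> 0 < e} \<noteq> {}"
      by (auto intro!: exI[of _ "{}"] exI[of _ "1::real"])
    fix a b :: "'a set \<times> real" assume "a \<in> {(\<Phi>, e). finite \<Phi> \<and> 0 < e}" "b \<in> {(\<Phi>, e). finite \<Phi> \<and> 0 < e}"
    thus "\<exists>x\<in>{(\<Phi>, e). finite \<Phi> \<and> 0 < e}. (case x of (\<Phi>, e) \<Rightarrow> principal (near \<Phi> e))
        \<le> inf (case a of (\<Phi>, e) \<Rightarrow> principal (near \<Phi> e)) (case b of (\<Phi>, e) \<Rightarrow> principal (near \<Phi> e))"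
      using *[of "fst a" "fst b" "snd a" "snd b"]
      by (intro bexI[of _ "(fst a \<union> fst b, min (snd a) (snd b))"]) (auto simp: split_beta)
  qed
  thus ?thesis by (auto simp: eventually_principal)
qed

lemma F_not_bot: "F \<noteq> bot"
proof
  assume "F = bot"
  hence "eventually (\<lambda>_. False) F" by simp
  thus False using near_nonempty unfolding eventually_F by blast
qed

lemma ev_nearI:
  assumes "finite \<Phi>" "0 < e" "\<And>x t s \<sigma> \<rho>. (x, t, s, \<sigma>, \<rho>) \<in> near \<Phi> e \<Longrightarrow> P (x, t, s, \<sigma>, \<rho>)"
  shows "eventually P F"
  unfolding eventually_F using assms by (intro exI[of _ \<Phi>] exI[of _ e]) auto

lemma ev_H: "eventually (\<lambda>(x, t, s, \<sigma>, \<rho>). (x, t, s, \<sigma>, \<rho>) \<in> H) F"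
  by (rule ev_nearI[of "{}" 1]) (auto simp: near_def)

lemma ev_x: "0 < e \<Longrightarrow> eventually (\<lambda>(x, t, s, \<sigma>, \<rho>). norm x < e) F"
  by (rule ev_nearI[of "{}" e]) (auto simp: near_def)

lemma ev_blinfun_x:
  fixes g :: "'a \<Rightarrow>\<^sub>L real"
  assumes "0 < e" shows "eventually (\<lambda>(x, t, s, \<sigma>, \<rho>). \<bar>blinfun_apply g x\<bar> < e) F"
proof -
  have "0 < e / (norm g + 1)" using assms by (simp add: add_nonneg_pos)
  from ev_x[OF this] show ?thesis
  proof (elim eventually_mono, clarify)
    fix x :: 'a assume "norm x < e / (norm g + 1)"
    hence "(norm g + 1) * norm x < e" by (simp add: add_nonneg_pos pos_less_divide_eq mult.commute)
    moreover have "\<bar>blinfun_apply g x\<bar> \<le> norm g * norm x" using norm_blinfun[of g x] by simp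
    moreover have "norm g * norm x \<le> (norm g + 1) * norm x" by (simp add: distrib_right)
    ultimately show "\<bar>blinfun_apply g x\<bar> < e" by linarith
  qed
qed

text \<open>\<open>near\<close> controls only the sum \<open>\<sigma> + \<rho>\<close>. The graph
  points over the origin bound \<open>\<sigma>\<close> and \<open>\<rho>\<close> separately from
  below, by \<open>blinfun_apply t0 x\<close> and \<open>blinfun_apply s0 x\<close>, which tend to
  0.\<close>

lemma ev_bounds:
  assumes "0 < e" shows "eventually (\<lambda>(x, t, s, \<sigma>, \<rho>). \<bar>\<rho>\<bar> < e \<and> \<bar>\<sigma>\<bar> < e) F"
proof -
  have e: "0 < e / 2" using assms by simp
  have "eventually (\<lambda>(x, t, s, \<sigma>, \<rho>). \<bar>\<sigma> + \<rho>\<bar> < e / 2) F"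
    by (rule ev_nearI[of "{}" "e / 2"]) (use e in \<open>auto simp: near_def\<close>)
  with ev_blinfun_x[OF e, of s0] ev_blinfun_x[OF e, of t0] ev_H
  show ?thesis
  proof (eventually_elim, clarify)
    fix x t s \<sigma> \<rho> assume h: "\<bar>blinfun_apply s0 x\<bar> < e / 2" "\<bar>blinfun_apply t0 x\<bar> < e / 2"
      "(x, t, s, \<sigma>, \<rho>) \<in> H" "\<bar>\<sigma> + \<rho>\<bar> < e / 2"
    have "blinfun_apply s0 x \<le> \<rho>" using H_D1[OF h(3) zeroS] by simp
    moreover have "blinfun_apply t0 x \<le> \<sigma>" using H_D2[OF h(3) graph_FT[OF zeroT]] by simp
    ultimately show "\<bar>\<rho>\<bar> < e \<and> \<bar>\<sigma>\<bar> < e" using h by linarith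
  qed
qed

text \<open>In the inequality of \<open>H\<close> for \<open>S\<close>, both
  \<open>blinfun_apply c' x\<close> and \<open>\<rho>\<close> tend to 0.\<close>

lemma ev_upper_S:
  assumes c: "(c, c') \<in> S" and e: "0 < e"
  shows "eventually (\<lambda>(x, t, s, \<sigma>, \<rho>). blinfun_apply s c \<le> blinfun_apply c' c + e) F"
proof -
  have e2: "0 < e / 2" using e by simp
  from ev_H ev_blinfun_x[OF e2, of c'] ev_bounds[OF e2] show ?thesis
  proof (eventually_elim, clarify)
    fix x t s \<sigma> \<rho> assume h: "(x, t, s, \<sigma>, \<rho>) \<in> H" "\<bar>blinfun_apply c' x\<bar> < e / 2" "\<bar>\<rho>\<bar> < e / 2"
    thus "blinfun_apply s c \<le> blinfun_apply c' c + e" using H_D1[OF h(1) c] by linarith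
  qed
qed

text \<open>As \<open>t + s\<close> tends to 0 at \<open>d\<close>, the number
  \<open>- blinfun_apply s d\<close> is asymptotically \<open>blinfun_apply t d\<close>, which
  \<open>H\<close> bounds through \<open>FT\<close>. The limiting bound depends on \<open>d\<close>
  only through the level \<open>r\<close>; hence the interest in points of \<open>FT\<close> with a
  common level.\<close>

lemma ev_lower_FT:
  assumes d: "(d, d', r) \<in> FT" and e: "0 < e"
  shows "eventually (\<lambda>(x, t, s, \<sigma>, \<rho>). - blinfun_apply s d \<le> r + e) F"
proof -
  have e3: "0 < e / 3" using e by simp
  have "eventually (\<lambda>(x, t, s, \<sigma>, \<rho>). \<bar>blinfun_apply (t + s) d\<bar> < e / 3) F"
    by (rule ev_nearI[of "{d}" "e / 3"]) (use e3 in \<open>auto simp: near_def\<close>)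
  with ev_H ev_blinfun_x[OF e3, of d'] ev_bounds[OF e3] show ?thesis
  proof (eventually_elim, clarify)
    fix x t s \<sigma> \<rho> assume h: "(x, t, s, \<sigma>, \<rho>) \<in> H" "\<bar>blinfun_apply d' x\<bar> < e / 3" "\<bar>\<sigma>\<bar> < e / 3"
      "\<bar>blinfun_apply (t + s) d\<bar> < e / 3"
    from h(4) have "\<bar>blinfun_apply t d + blinfun_apply s d\<bar> < e / 3" by (simp add: blinfun.add_left)
    thus "- blinfun_apply s d \<le> r + e" using H_D2[OF h(1) d] h by linarith
  qed
qed

section \<open>The closed subspace generated by the two domains\<close>

lemma U_diff:
  assumes "c \<in> D" "d \<in> convex hull (fst ` T)" shows "d - c \<in> U" "c - d \<in> U"
proof -
  show "d - c \<in> U" unfolding U_iff using assms by (intro exI[of _ 1]) auto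
  from subspace_neg[OF subspaceU this] show "c - d \<in> U" by simp
qed

lemma x0_mem: "x0 \<in> D" "x0 \<in> convex hull (fst ` T)"
  using x0S x0T closure_subset[of "fst ` S"] by (auto intro: hull_inc)

text \<open>Moving \<open>c\<close> and \<open>d\<close> towards \<open>x0\<close> by the same
  factor shrinks \<open>c - d\<close> and stays in the two convex sets, so every large multiple is
  possible and \<open>c\<close> may be taken close to \<open>x0\<close>.\<close>

lemma U_scaled:
  assumes w: "w \<in> U" and \<epsilon>: "0 < \<epsilon>"
  obtains \<mu> where "0 < \<mu>" "\<And>l. \<mu> \<le> l \<Longrightarrow>
    \<exists>c d. c \<in> D \<and> norm (c - x0) \<le> \<epsilon> \<and> d \<in> convex hull (fst ` T) \<and> w = l *\<^sub>R (c - d)"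
proof -
  have "- w \<in> U" using subspace_neg[OF subspaceU w] .
  then obtain r d c where rdc: "0 < r" "d \<in> convex hull (fst ` T)" "c \<in> D" "- w = r *\<^sub>R (d - c)"
    unfolding U_iff by blast
  \<comment> \<open>The two summands ensure \<open>h \<le> 1\<close> and
    \<open>h * norm (c - x0) \<le> \<epsilon>\<close> for \<open>h = r / l\<close>.\<close>
  define \<mu> where "\<mu> = r * (1 + norm (c - x0) / \<epsilon>)"
  have "0 < \<mu>" using rdc(1) \<epsilon> by (simp add: \<mu>_def add_pos_nonneg)
  moreover have "\<exists>c d. c \<in> D \<and> norm (c - x0) \<le> \<epsilon> \<and> d \<in> convex hull (fst ` T) \<and> w = l *\<^sub>R (c - d)" if l: "\<mu> \<le> l" for l
  proof -
    have l0: "0 < l" using l \<open>0 < \<mu>\<close> by simp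
    define h where "h = r / l"
    have "r \<le> \<mu>" using rdc(1) \<epsilon> by (simp add: \<mu>_def distrib_left)
    hence h: "0 \<le> h" "h \<le> 1" using l l0 rdc(1) by (auto simp: h_def)
    have "r * norm (c - x0) \<le> \<mu> * \<epsilon>" using rdc(1) \<epsilon> by (simp add: \<mu>_def field_simps)
    also have "\<dots> \<le> l * \<epsilon>" using l \<epsilon> by simp
    finally have "h * norm (c - x0) \<le> \<epsilon>" using l0 by (simp add: h_def field_simps)
    moreover have "(1 - h) *\<^sub>R x0 + h *\<^sub>R c - x0 = h *\<^sub>R (c - x0)" by (simp add: algebra_simps)
    ultimately have "norm ((1 - h) *\<^sub>R x0 + h *\<^sub>R c - x0) \<le> \<epsilon>" using h by simp
    moreover have "(1 - h) *\<^sub>R x0 + h *\<^sub>R c \<in> D" using h rdc x0_mem by (intro convexD_alt[OF convD]) auto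
    moreover have "(1 - h) *\<^sub>R x0 + h *\<^sub>R d \<in> convex hull (fst ` T)"
      using h rdc x0_mem by (intro convexD_alt[OF convex_convex_hull]) auto
    moreover have "w = l *\<^sub>R (((1 - h) *\<^sub>R x0 + h *\<^sub>R c) - ((1 - h) *\<^sub>R x0 + h *\<^sub>R d))"
    proof -
      have "l *\<^sub>R (((1 - h) *\<^sub>R x0 + h *\<^sub>R c) - ((1 - h) *\<^sub>R x0 + h *\<^sub>R d)) = (l * h) *\<^sub>R (c - d)"
        by (simp add: algebra_simps)
      also have "l * h = r" using l0 by (simp add: h_def)
      also have "r *\<^sub>R (c - d) = - (r *\<^sub>R (d - c))" by (simp add: algebra_simps)
      also have "\<dots> = w" using rdc(4) by (metis minus_minus)
      finally show ?thesis by simp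
    qed
    ultimately show ?thesis by blast
  qed
  ultimately show ?thesis by (rule that)
qed

text \<open>Baire's theorem enters here; the second step removes the closure by summing a geometric series, which is
  legitimate because D and the Fitzpatrick epigraph are closed.\<close>
lemma U_ball_decomposition:
  obtains \<delta> n where "0 < \<delta>" "0 \<le> n" "\<And>w. w \<in> U \<Longrightarrow> norm w \<le> \<delta> \<Longrightarrow>
    \<exists>c x'. c \<in> D \<and> norm (c - x0) \<le> 1 \<and> (c - w, x', n) \<in> FT"
proof -
  \<comment> \<open>The witnesses \<open>c\<close> and \<open>x'\<close> are kept, in bounded sets,
    so that a dyadic series in the projection \<open>A\<close> lifts to a convergent series in the
    closed convex set \<open>K\<close>.\<close>
  define K where "K m = {(w, c, x'). w \<in> U \<and> c \<in> D \<inter> cball x0 1 \<and> x' \<in> cball 0 m \<and> (c - w, x', m) \<in> FT}" for m :: real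
  have "closed (K m)" for m
  proof -
    have "K m = (fst -` U) \<inter> ((fst \<circ> snd) -` (D \<inter> cball x0 1)) \<inter> ((snd \<circ> snd) -` cball 0 m)
        \<inter> ((\<lambda>z. (fst (snd z) - fst z, snd (snd z), m)) -` FT)"
      by (auto simp: K_def)
    thus ?thesis using closedU closed_FT
      by (auto intro!: closed_Int continuous_closed_vimage continuous_intros simp: o_def)
  qed
  moreover have "convex (K m)" for m
  proof (rule convexI)
    fix p q and u v :: real assume pq: "p \<in> K m" "q \<in> K m" and uv: "0 \<le> u" "0 \<le> v" "u + v = 1"
    obtain w c x' y e y' where p: "p = (w, c, x')" and q: "q = (y, e, y')" by (cases p, cases q)
    have "u *\<^sub>R w + v *\<^sub>R y \<in> U" using pq unfolding p q K_def
      by (intro subspace_add subspace_scale subspaceU) auto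
    moreover have "u *\<^sub>R c + v *\<^sub>R e \<in> D \<inter> cball x0 1" using pq uv unfolding p q K_def
      by (intro convexD[OF convex_Int[OF convD convex_cball]]) auto
    moreover have "u *\<^sub>R x' + v *\<^sub>R y' \<in> cball 0 m" using pq uv unfolding p q K_def
      by (intro convexD[OF convex_cball]) auto
    moreover have "u *\<^sub>R (c - w, x', m) + v *\<^sub>R (e - y, y', m) \<in> FT" using pq uv unfolding p q K_def
      by (intro convexD[OF convex_FT]) auto
    hence "(u *\<^sub>R c + v *\<^sub>R e - (u *\<^sub>R w + v *\<^sub>R y), u *\<^sub>R x' + v *\<^sub>R y', (u + v) * m) \<in> FT"
      by (simp add: algebra_simps)
    ultimately show "u *\<^sub>R p + v *\<^sub>R q \<in> K m" using uv by (simp add: p q K_def)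
  qed
  ultimately have K: "closed (K m)" "convex (K m)" for m by auto
  define A where "A m = fst ` K (real m)" for m :: nat
  have convA: "convex (A m)" for m unfolding A_def by (rule convex_linear_image[OF linear_fst K(2)])
  have AU: "A m \<subseteq> U" for m by (auto simp: A_def K_def)
  have mono: "A m \<subseteq> A n" if "m \<le> n" for m n
  proof -
    have "K (real m) \<subseteq> K (real n)" using that FT_mono by (fastforce simp: K_def)
    thus ?thesis unfolding A_def by (rule image_mono)
  qed
  have absorb: "\<exists>n\<ge>1. (1 / real n) *\<^sub>R w \<in> A n" if w: "w \<in> U" for w
  proof -
    obtain \<mu> where \<mu>: "0 < \<mu>" "\<And>l. \<mu> \<le> l \<Longrightarrow>
        \<exists>c d. c \<in> D \<and> norm (c - x0) \<le> 1 \<and> d \<in> convex hull (fst ` T) \<and> w = l *\<^sub>R (c - d)"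
      by (rule U_scaled[OF w zero_less_one]) (rule that)
    from \<mu>(2)[OF order_refl] obtain c d where cd: "c \<in> D" "norm (c - x0) \<le> 1" "d \<in> convex hull (fst ` T)" "w = \<mu> *\<^sub>R (c - d)"
      by blast
    obtain d' r where d': "(d, d', r) \<in> FT" using hull_FT[OF cd(3)] .
    obtain x' where x': "(x0, x') \<in> T" using x0T by auto
    \<comment> \<open>For \<open>n\<close> above \<open>R\<close> and \<open>\<mu>\<close>, the
      functionals \<open>x'\<close> and \<open>d'\<close> and their levels are within
      \<open>n\<close>, and moving from \<open>x0\<close> towards \<open>c\<close> and
      \<open>d\<close> with weight \<open>\<mu> / real n\<close> produces exactly the difference
      \<open>(1 / real n) *\<^sub>R w\<close>.\<close>
    define R where "R = max (max (norm d') (norm x')) (max r (blinfun_apply x' x0))"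
    obtain n where n: "real n \<ge> max 1 (max \<mu> R)" using real_arch_simple by blast
    define h where "h = \<mu> / real n"
    have n1: "1 \<le> real n" "\<mu> \<le> real n" "R \<le> real n" using n by auto
    have h: "0 \<le> h" "h \<le> 1" using \<mu>(1) n1 by (auto simp: h_def)
    have nr: "norm ((1 - h) *\<^sub>R x' + h *\<^sub>R d') \<le> real n"
    proof -
      have "(1 - h) *\<^sub>R x' + h *\<^sub>R d' \<in> cball 0 (real n)"
        using h n1 by (intro convexD_alt[OF convex_cball]) (auto simp: R_def)
      thus ?thesis by simp
    qed
    have "(1 - h) *\<^sub>R (x0, x', real n) + h *\<^sub>R (d, d', real n) \<in> FT"
      using h n1 FT_mono[OF graph_FT[OF x'], of "real n"] FT_mono[OF d', of "real n"]
      by (intro convexD_alt[OF convex_FT]) (auto simp: R_def)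
    hence comb: "((1 - h) *\<^sub>R x0 + h *\<^sub>R d, (1 - h) *\<^sub>R x' + h *\<^sub>R d', real n) \<in> FT"
      by (simp add: algebra_simps)
    have diff: "((1 - h) *\<^sub>R x0 + h *\<^sub>R c) - (1 / real n) *\<^sub>R w = (1 - h) *\<^sub>R x0 + h *\<^sub>R d"
      by (simp add: cd(4) h_def algebra_simps)
    have "(1 - h) *\<^sub>R x0 + h *\<^sub>R c \<in> D \<inter> cball x0 1"
      using h cd x0_mem by (intro convexD_alt[OF convex_Int[OF convD convex_cball]])
        (auto simp: dist_norm norm_minus_commute)
    hence "((1 / real n) *\<^sub>R w, (1 - h) *\<^sub>R x0 + h *\<^sub>R c, (1 - h) *\<^sub>R x' + h *\<^sub>R d') \<in> K (real n)"
      using nr subspace_scale[OF subspaceU w] comb unfolding K_def mem_Collect_eq prod.case diff by simp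
    hence "(1 / real n) *\<^sub>R w \<in> A n" unfolding A_def by force
    thus ?thesis using n1(1) by (intro exI[of _ n]) auto
  qed
  obtain n \<delta> where n: "0 < \<delta>" "U \<inter> ball 0 \<delta> \<subseteq> closure (A n)"
    using Baire_absorbing[OF closedU subspaceU convA AU mono absorb] by blast
  have cs: "x \<in> A n" if a: "\<And>k. a k \<in> A n" and s: "(\<lambda>k. (1/2) ^ Suc k *\<^sub>R a k) sums x" for a x
  proof -
    have "\<exists>p :: 'a \<times> ('a \<Rightarrow>\<^sub>L real). (a k, p) \<in> K (real n)" for k
    proof -
      obtain z where "z \<in> K (real n)" "a k = fst z" using a[of k] unfolding A_def by blast
      thus ?thesis by (intro exI[of _ "snd z"]) simp
    qed
    then obtain p where p: "\<And>k. (a k, p k) \<in> K (real n)" by metis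
    define B where "B = norm x0 + 1 + real n"
    have pB: "norm (p k) \<le> B" for k
    proof -
      obtain c x' where cx: "p k = (c, x')" by (cases "p k")
      have "norm c \<le> norm x0 + norm (c - x0)" using norm_triangle_ineq[of x0 "c - x0"] by simp
      moreover have "norm (c - x0) \<le> 1" "norm x' \<le> real n"
        using p[of k] by (auto simp: cx K_def dist_norm norm_minus_commute)
      ultimately show ?thesis using norm_Pair_le[of c x'] by (simp add: cx B_def)
    qed
    have "norm ((1/2) ^ Suc k *\<^sub>R p k) \<le> (1/2) ^ k * B" for k
    proof -
      have "(1/2) ^ Suc k * norm (p k) \<le> (1/2) ^ k * B"
        by (intro mult_mono pB) (auto simp: B_def)
      thus ?thesis by simp
    qed
    moreover have "summable (\<lambda>k. (1/2::real) ^ k * B)" by (intro summable_mult2 summable_geometric) auto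
    ultimately have "summable (\<lambda>k. (1/2) ^ Suc k *\<^sub>R p k)"
      by (rule summable_comparison_test'[where N = 0, rotated])
    then obtain y where y: "(\<lambda>k. (1/2) ^ Suc k *\<^sub>R p k) sums y" by (auto simp: summable_def)
    have "(\<Sum>k<m. (1/2) ^ Suc k *\<^sub>R (a k, p k)) = ((\<Sum>k<m. (1/2) ^ Suc k *\<^sub>R a k), (\<Sum>k<m. (1/2) ^ Suc k *\<^sub>R p k))" for m
      by (induction m) (auto simp: zero_prod_def)
    hence "(\<lambda>k. (1/2) ^ Suc k *\<^sub>R (a k, p k)) sums (x, y)"
      using tendsto_Pair[OF s[unfolded sums_def] y[unfolded sums_def]] by (simp add: sums_def)
    from sums_half_powers_mem[OF K p this] show ?thesis unfolding A_def by force
  qed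
  have sub: "U \<inter> ball 0 (\<delta> / 2) \<subseteq> A n"
    by (rule ball_subset_of_closure[OF cs subspaceU AU n])
  show ?thesis
  proof (rule that[of "\<delta> / 4" "real n"])
    fix w assume "w \<in> U" "norm w \<le> \<delta> / 4"
    hence "w \<in> A n" using sub n(1) by auto
    then obtain c x' where "(w, c, x') \<in> K (real n)" unfolding A_def by force
    thus "\<exists>c x'. c \<in> D \<and> norm (c - x0) \<le> 1 \<and> (c - w, x', real n) \<in> FT"
      by (auto simp: K_def dist_norm norm_minus_commute)
  qed (use n in auto)
qed
end

section \<open>The gliding hump\<close>

context monotone_pair
begin

text \<open>The constant K bounds s on D near x0; after division by K the functionals s become asymptotically
  nonnegative on D - x0. The point -(c0 - x0) is written as a finite combination of points of the two domains,
  up to an error which is small relative to K.\<close>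
lemma ev_reverse_bound:
  assumes c0: "c0 \<in> D" and \<kappa>: "0 < \<kappa>"
  obtains C where "eventually (\<lambda>(x, t, s, \<sigma>, \<rho>). \<forall>K. (\<forall>c\<in>D \<inter> cball x0 1. blinfun_apply s c \<le> K) \<longrightarrow>
    blinfun_apply s (x0 - c0) \<le> \<kappa> * K + C) F"
proof -
  obtain \<delta> n where \<delta>: "0 < \<delta>" "0 \<le> n" and dec: "\<And>w. w \<in> U \<Longrightarrow> norm w \<le> \<delta> \<Longrightarrow>
    \<exists>c x'. c \<in> D \<and> norm (c - x0) \<le> 1 \<and> (c - w, x', n) \<in> FT"
    by (rule U_ball_decomposition) (rule that)
  have U0: "x0 - c0 \<in> U" by (rule U_diff(1)[OF c0 x0_mem(2)])
  obtain l where l: "0 < l" "\<And>l'. l \<le> l' \<Longrightarrow>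
      \<exists>c d. c \<in> D \<and> norm (c - x0) \<le> 1/2 \<and> d \<in> convex hull (fst ` T) \<and> x0 - c0 = l' *\<^sub>R (c - d)"
    by (rule U_scaled[OF U0, of "1/2"]) (simp, rule that)
  from l(2)[OF order_refl] obtain c1 d1 where c1: "c1 \<in> D" "norm (c1 - x0) \<le> 1/2"
    and d1: "d1 \<in> convex hull (fst ` T)" and eq1: "x0 - c0 = l *\<^sub>R (c1 - d1)" by blast
  obtain d1' r1 where d1': "(d1, d1', r1) \<in> FT" using hull_FT[OF d1] .
  have "0 < min (1/2) (\<kappa> * \<delta> / l)" using \<kappa> \<delta> l by simp
  then obtain c2 where c2: "c2 \<in> fst ` S" "dist c2 c1 < min (1/2) (\<kappa> * \<delta> / l)"
    using c1(1) unfolding closure_approachable by blast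
  then obtain c2' where c2': "(c2, c2') \<in> S" by auto
  have c2D: "c2 \<in> D" using c2(1) closure_subset[of "fst ` S"] by blast
  \<comment> \<open>\<open>c1\<close> lies only in the closure of the domain. The error of replacing
    it by \<open>c2\<close>, magnified by \<open>l / \<kappa>\<close>, still has norm at most
    \<open>\<delta>\<close> and can be written as a difference, with the factor
    \<open>\<kappa>\<close> in front; this is the origin of \<open>\<kappa> * K\<close>.\<close>
  define w where "w = (l / \<kappa>) *\<^sub>R (c1 - c2)"
  have "(x0 - c2) - (x0 - c1) \<in> U"
    using U_diff(1)[OF c2D x0_mem(2)] U_diff(1)[OF c1(1) x0_mem(2)] by (rule subspace_diff[OF subspaceU])
  hence "w \<in> U" unfolding w_def by (intro subspace_scale[OF subspaceU]) simp
  moreover have "norm w \<le> \<delta>"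
  proof -
    have "norm (c1 - c2) < \<kappa> * \<delta> / l" using c2(2) by (simp add: dist_norm norm_minus_commute)
    hence "(l / \<kappa>) * norm (c1 - c2) \<le> \<delta>" using l(1) \<kappa> by (simp add: field_simps)
    thus ?thesis using l(1) \<kappa> by (simp add: w_def)
  qed
  ultimately obtain c3 x3' where c3: "c3 \<in> D" "norm (c3 - x0) \<le> 1" and x3: "(c3 - w, x3', n) \<in> FT"
    using dec by blast
  \<comment> \<open>\<open>s\<close> is bounded above at \<open>c2\<close> by the graph of
    \<open>S\<close> and at \<open>c3\<close> by \<open>K\<close>, and below at \<open>d1\<close>
    and \<open>c3 - w\<close> by the epigraph of \<open>T\<close>.\<close>
  have eq: "x0 - c0 = l *\<^sub>R (c2 - d1) + \<kappa> *\<^sub>R (c3 - (c3 - w))"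
    unfolding eq1 w_def using \<kappa> by (simp add: algebra_simps)
  show ?thesis
  proof (rule that)
    from ev_upper_S[OF c2' zero_less_one] ev_lower_FT[OF d1' zero_less_one] ev_lower_FT[OF x3 zero_less_one]
    show "eventually (\<lambda>(x, t, s, \<sigma>, \<rho>). \<forall>K. (\<forall>c\<in>D \<inter> cball x0 1. blinfun_apply s c \<le> K) \<longrightarrow>
      blinfun_apply s (x0 - c0) \<le> \<kappa> * K + (l * (blinfun_apply c2' c2 + 1) + l * (r1 + 1) + \<kappa> * (n + 1))) F"
    proof (eventually_elim, clarify)
      fix s :: "'a \<Rightarrow>\<^sub>L real" and K :: real
      assume s: "blinfun_apply s c2 \<le> blinfun_apply c2' c2 + 1" "- blinfun_apply s d1 \<le> r1 + 1"
        "- blinfun_apply s (c3 - w) \<le> n + 1" and K: "\<forall>c\<in>D \<inter> cball x0 1. blinfun_apply s c \<le> K"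
      have "blinfun_apply s c3 \<le> K" using K c3 by (simp add: dist_norm norm_minus_commute)
      hence "l * blinfun_apply s c2 + l * (- blinfun_apply s d1) + \<kappa> * blinfun_apply s c3 + \<kappa> * (- blinfun_apply s (c3 - w))
        \<le> l * (blinfun_apply c2' c2 + 1) + l * (r1 + 1) + \<kappa> * K + \<kappa> * (n + 1)"
        using l(1) \<kappa> s by (intro add_mono mult_left_mono) auto
      moreover have "blinfun_apply s (x0 - c0)
        = l * blinfun_apply s c2 + l * (- blinfun_apply s d1) + \<kappa> * blinfun_apply s c3 + \<kappa> * (- blinfun_apply s (c3 - w))"
        unfolding eq by (simp add: blinfun.add_right blinfun.diff_right blinfun.scaleR_right algebra_simps)
      ultimately show "blinfun_apply s (x0 - c0) \<le> \<kappa> * K + (l * (blinfun_apply c2' c2 + 1) + l * (r1 + 1) + \<kappa> * (n + 1))"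
        by linarith
    qed
  qed
qed

text \<open>One step of the gliding hump: z, s and \<rho> come from a point of H, c is a point of the domain of S close
  to x0 and w is the weight of z. The index k is the step, and the family f holds the earlier steps.\<close>
definition hump :: "real \<Rightarrow> (nat \<Rightarrow> 'a \<times> ('a \<Rightarrow>\<^sub>L real) \<times> real \<times> 'a \<times> real) \<Rightarrow> nat \<Rightarrow>
    'a \<times> ('a \<Rightarrow>\<^sub>L real) \<times> real \<times> 'a \<times> real \<Rightarrow> bool" where
  "hump B f k r = (case r of (z, s, \<rho>, c, w) \<Rightarrow>
     norm z \<le> 1 \<and> \<rho> \<le> 1 \<and> - B \<le> blinfun_apply s x0 \<and>
     (\<forall>(u, u')\<in>S. blinfun_apply s u + blinfun_apply u' z \<le> \<rho> + blinfun_apply u' u) \<and>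
     c \<in> fst ` S \<and> norm (c - x0) \<le> (1/2) ^ k \<and> 0 < w \<and> w \<le> (1/2) ^ (k + 2) \<and> 2 ^ k \<le> w * blinfun_apply s c \<and>
     (\<forall>j<k. case f j of (zj, sj, \<rho>j, cj, wj) \<Rightarrow>
        norm sj * norm (c - x0) \<le> 1 \<and> w * blinfun_apply s (x0 - cj) \<le> (1/2) ^ k))"

text \<open>The order of choices matters: \<open>e\<close>, \<open>\<kappa>\<close>, the constants
  \<open>C j\<close>, \<open>b\<close> and \<open>M\<close> depend on \<open>B\<close>,
  \<open>k\<close> and the earlier steps; only then is a point of \<open>H\<close> with large
  supremum \<open>K\<close> taken. The weight is inversely proportional to \<open>e * K\<close>, so
  a larger \<open>K\<close> means a smaller weight for the same gain.\<close>

lemma hump_exists: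
  assumes unbounded: "\<And>M. frequently (\<lambda>(x, t, s, \<sigma>, \<rho>). \<exists>c\<in>D \<inter> cball x0 1. M < blinfun_apply s c) F"
    and x0: "(x0, x0') \<in> T" and B: "B = blinfun_apply x0' x0 + 1"
    and prev: "\<And>j. j < k \<Longrightarrow> hump B f j (f j)"
  shows "\<exists>r. hump B f k r"
proof -
  define sf where "sf j = fst (snd (f j))" for j
  define cf where "cf j = fst (snd (snd (snd (f j))))" for j
  \<comment> \<open>The new point will be within \<open>2 * e\<close> of \<open>x0\<close>: at most
    \<open>(1/2) ^ k\<close>, and small against every earlier functional.\<close>
  define e where "e = min ((1/2) ^ (k + 1)) (1 / (2 * (1 + (\<Sum>j<k. norm (sf j)))))"
  have sum0: "0 \<le> (\<Sum>j<k. norm (sf j))" by (simp add: sum_nonneg)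
  have e: "0 < e" "e \<le> (1/2) ^ (k + 1)" "e \<le> 1 / (2 * (1 + (\<Sum>j<k. norm (sf j))))"
    using sum0 by (auto simp: e_def min_def)
  have e1: "e \<le> 1" using e(2) power_le_one[of "1/2::real" "k + 1"] by linarith
  have se: "norm (sf j) * (2 * e) \<le> 1" if "j < k" for j
  proof -
    have "norm (sf j) \<le> (\<Sum>j<k. norm (sf j))" using that by (intro member_le_sum) auto
    hence "norm (sf j) * (2 * e) \<le> (1 + (\<Sum>j<k. norm (sf j))) * (2 * e)"
      using e(1) by (intro mult_right_mono) auto
    also have "\<dots> \<le> 1" using e(3) sum0 by (simp add: field_simps)
    finally show ?thesis .
  qed
  \<comment> \<open>With \<open>w = 4 * 2 ^ k / (e * K)\<close> this gives
    \<open>w * (\<kappa> * K) = (1/2) ^ (k + 1)\<close>, half of what the reverse bound may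
    cost.\<close>
  define \<kappa> where "\<kappa> = e * (1/2) ^ (2 * k + 3)"
  have \<kappa>: "0 < \<kappa>" using e by (simp add: \<kappa>_def)
  have cD: "cf j \<in> D" if "j < k" for j
  proof -
    have "cf j \<in> fst ` S" using prev[OF that] by (simp add: hump_def cf_def split_beta)
    thus ?thesis using closure_subset[of "fst ` S"] by blast
  qed
  define E where "E j C = eventually (\<lambda>(x, t, s, \<sigma>, \<rho>). \<forall>K. (\<forall>c\<in>D \<inter> cball x0 1. blinfun_apply s c \<le> K) \<longrightarrow>
    blinfun_apply s (x0 - cf j) \<le> \<kappa> * K + C) F" for j C
  define C where "C j = (SOME C. E j C)" for j
  have C: "E j (C j)" if "j < k" for j
    unfolding C_def by (rule ev_reverse_bound[OF cD[OF that] \<kappa>], rule someI, unfold E_def)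
  define Cm where "Cm = (\<Sum>j<k. \<bar>C j\<bar>)"
  have Cm: "C j \<le> Cm" if "j < k" for j
  proof -
    have "\<bar>C j\<bar> \<le> Cm" unfolding Cm_def using that by (intro member_le_sum) auto
    thus ?thesis by simp
  qed
  have Cm0: "0 \<le> Cm" by (simp add: Cm_def sum_nonneg)
  \<comment> \<open>An upper bound for the weight: it makes the weights summable, the loss
    \<open>w * (\<bar>B\<bar> + 1)\<close> at most 1, and \<open>w * Cm\<close> at most the other
    half of the cost.\<close>
  define b where "b = min ((1/2) ^ (k + 2)) (min (1 / (\<bar>B\<bar> + 1)) ((1/2) ^ (k + 1) / (1 + Cm)))"
  have b: "0 < b" "b \<le> (1/2) ^ (k + 2)" "b * (\<bar>B\<bar> + 1) \<le> 1" "b * (1 + Cm) \<le> (1/2) ^ (k + 1)"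
  proof -
    show "0 < b" using Cm0 by (auto simp: b_def intro!: divide_pos_pos)
    show "b \<le> (1/2) ^ (k + 2)" unfolding b_def by (rule min.cobounded1)
    have "b \<le> 1 / (\<bar>B\<bar> + 1)" "b \<le> (1/2) ^ (k + 1) / (1 + Cm)"
      unfolding b_def by (meson min.cobounded1 min.cobounded2 order_trans)+
    thus "b * (\<bar>B\<bar> + 1) \<le> 1" "b * (1 + Cm) \<le> (1/2) ^ (k + 1)"
      using Cm0 pos_le_divide_eq[of "\<bar>B\<bar> + 1" b 1] pos_le_divide_eq[of "1 + Cm" b "(1/2) ^ (k + 1)"] by linarith+
  qed
  \<comment> \<open>A supremum \<open>K\<close> above \<open>M\<close> makes
    \<open>4 * 2 ^ k / (e * K)\<close> at most \<open>b\<close>.\<close>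
  define M where "M = 4 * 2 ^ k / (e * b)"
  have M: "0 < M" using e b by (simp add: M_def)
  have all_C: "eventually (\<lambda>h. \<forall>j\<in>{..<k}. case h of (x, t, s, \<sigma>, \<rho>) \<Rightarrow> \<forall>K. (\<forall>c\<in>D \<inter> cball x0 1. blinfun_apply s c \<le> K) \<longrightarrow>
    blinfun_apply s (x0 - cf j) \<le> \<kappa> * K + C j) F"
  proof (intro eventually_ball_finite ballI)
    fix j assume "j \<in> {..<k}"
    hence "E j (C j)" by (intro C) simp
    thus "eventually (\<lambda>h. case h of (x, t, s, \<sigma>, \<rho>) \<Rightarrow> \<forall>K. (\<forall>c\<in>D \<inter> cball x0 1. blinfun_apply s c \<le> K) \<longrightarrow>
      blinfun_apply s (x0 - cf j) \<le> \<kappa> * K + C j) F"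
      unfolding E_def by (rule eventually_mono) auto
  qed simp
  have "eventually (\<lambda>h. case h of (x, t, s, \<sigma>, \<rho>) \<Rightarrow> h \<in> H \<and> norm x < 1 \<and> \<bar>\<rho>\<bar> < 1 \<and> - blinfun_apply s x0 \<le> B \<and>
    (\<forall>j<k. \<forall>K. (\<forall>c\<in>D \<inter> cball x0 1. blinfun_apply s c \<le> K) \<longrightarrow> blinfun_apply s (x0 - cf j) \<le> \<kappa> * K + C j)) F"
    using ev_H ev_x[OF zero_less_one] ev_bounds[OF zero_less_one] ev_lower_FT[OF graph_FT[OF x0] zero_less_one] all_C
    by eventually_elim (auto simp: B)
  from frequently_ex[OF frequently_eventually_frequently[OF unbounded[of M] this]]
  obtain z t s \<sigma> \<rho> c where h: "(z, t, s, \<sigma>, \<rho>) \<in> H" "norm z < 1" "\<bar>\<rho>\<bar> < 1" "- blinfun_apply s x0 \<le> B"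
    "\<forall>j<k. \<forall>K. (\<forall>c\<in>D \<inter> cball x0 1. blinfun_apply s c \<le> K) \<longrightarrow> blinfun_apply s (x0 - cf j) \<le> \<kappa> * K + C j"
    and c: "c \<in> D \<inter> cball x0 1" "M < blinfun_apply s c" by auto
  define Y where "Y = blinfun_apply s ` (D \<inter> cball x0 1)"
  define K where "K = Sup Y"
  have "bdd_above Y" unfolding Y_def
  proof (rule bdd_aboveI2)
    fix c assume "c \<in> D \<inter> cball x0 1"
    hence "norm c \<le> norm x0 + 1"
      using norm_triangle_ineq[of x0 "c - x0"] by (simp add: dist_norm norm_minus_commute)
    hence "norm s * norm c \<le> norm s * (norm x0 + 1)" by (intro mult_left_mono) auto
    thus "blinfun_apply s c \<le> norm s * (norm x0 + 1)"
      using norm_blinfun[of s c] by simp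
  qed
  hence upper: "\<forall>c\<in>D \<inter> cball x0 1. blinfun_apply s c \<le> K"
    unfolding K_def Y_def by (auto intro: cSup_upper)
  have MK: "M < K" using upper c by force
  hence K0: "0 < K" using M by simp
  have "K / 2 < Sup Y" using K0 by (simp add: K_def)
  then obtain c' where c': "c' \<in> D \<inter> cball x0 1" "K / 2 < blinfun_apply s c'"
    using less_cSup_iff[OF _ \<open>bdd_above Y\<close>, of "K / 2"] c(1) unfolding Y_def by blast
  \<comment> \<open>Going from \<open>x0\<close> towards \<open>c'\<close> by the factor
    \<open>e\<close> keeps \<open>e * K / 2\<close> up to a constant, since \<open>s\<close> is
    bounded below at \<open>x0\<close>. Replacing \<open>p\<close> by a point \<open>q\<close> of
    the domain costs at most 1.\<close>
  define p where "p = (1 - e) *\<^sub>R x0 + e *\<^sub>R c'"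
  have "p \<in> D" unfolding p_def using e e1 c' x0_mem by (intro convexD_alt[OF convD]) auto
  moreover have "0 < min e (1 / (1 + norm s))" using e by (auto simp: add_pos_nonneg)
  ultimately obtain q where q: "q \<in> fst ` S" "dist q p < min e (1 / (1 + norm s))"
    unfolding closure_approachable by blast
  have "norm (q - x0) \<le> 2 * e"
  proof -
    have "p - x0 = e *\<^sub>R (c' - x0)" by (simp add: p_def algebra_simps)
    hence "norm (p - x0) \<le> e * 1" using c'(1) e by (simp add: dist_norm norm_minus_commute)
    moreover have "norm (q - p) \<le> e" using q(2) by (simp add: dist_norm)
    ultimately show ?thesis using norm_triangle_ineq[of "q - p" "p - x0"] by simp
  qed
  \<comment> \<open>Then \<open>w * (e * K / 2) = 2 * 2 ^ k\<close>, which leaves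
    \<open>2 ^ k\<close> after the loss of at most 1.\<close>
  define w where "w = 4 * 2 ^ k / (e * K)"
  have w0: "0 < w" using e K0 by (simp add: w_def)
  have wb: "w \<le> b"
  proof -
    have "4 * 2 ^ k < K * (e * b)" using MK e b by (simp add: M_def field_simps)
    thus ?thesis using e K0 by (simp add: w_def field_simps)
  qed
  have sq: "e * K / 2 - (\<bar>B\<bar> + 1) \<le> blinfun_apply s q"
  proof -
    have "blinfun_apply s (p - q) \<le> 1"
    proof -
      have "norm (p - q) \<le> 1 / (1 + norm s)" using q(2) by (simp add: dist_norm norm_minus_commute)
      hence "norm s * norm (p - q) \<le> norm s * (1 / (1 + norm s))" by (intro mult_left_mono) auto
      also have "\<dots> \<le> 1" by (simp add: add_pos_nonneg divide_le_eq_1)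
      finally show ?thesis using norm_blinfun[of s "p - q"] by simp
    qed
    moreover have "blinfun_apply s p = (1 - e) * blinfun_apply s x0 + e * blinfun_apply s c'"
      by (simp add: p_def blinfun.add_right blinfun.scaleR_right)
    moreover have "e * (K / 2) \<le> e * blinfun_apply s c'" using c'(2) e by (intro mult_left_mono) auto
    moreover have "- \<bar>B\<bar> \<le> (1 - e) * blinfun_apply s x0"
    proof -
      have "(1 - e) * (- \<bar>B\<bar>) \<le> (1 - e) * blinfun_apply s x0" using h(4) e1 by (intro mult_left_mono) auto
      moreover have "- \<bar>B\<bar> \<le> (1 - e) * (- \<bar>B\<bar>)" using e by (simp add: algebra_simps)
      ultimately show ?thesis by linarith
    qed
    ultimately show ?thesis by (simp add: blinfun.diff_right)
  qed
  have "2 ^ k \<le> w * blinfun_apply s q"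
  proof -
    have "w * (e * K / 2) = 2 * 2 ^ k" using e K0 by (simp add: w_def)
    moreover have "w * (\<bar>B\<bar> + 1) \<le> b * (\<bar>B\<bar> + 1)" using wb by (intro mult_right_mono) auto
    moreover have "w * (e * K / 2 - (\<bar>B\<bar> + 1)) \<le> w * blinfun_apply s q" using sq w0 by simp
    moreover have "(1::real) \<le> 2 ^ k" by simp
    ultimately show ?thesis using b(3) unfolding right_diff_distrib by linarith
  qed
  moreover have "w * blinfun_apply s (x0 - cf j) \<le> (1/2) ^ k" if "j < k" for j
  proof -
    have "blinfun_apply s (x0 - cf j) \<le> \<kappa> * K + Cm" using h(5) that upper Cm[OF that] by fastforce
    hence "w * blinfun_apply s (x0 - cf j) \<le> w * (\<kappa> * K) + w * Cm" using w0 by (simp flip: distrib_left)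
    moreover have "w * (\<kappa> * K) = (1/2) ^ (k + 1)"
    proof -
      have "w * (\<kappa> * K) = 4 * 2 ^ k * (1/2) ^ (2 * k + 3)" using e K0 by (simp add: w_def \<kappa>_def)
      also have "\<dots> = 4 * (2 ^ k * (1/2) ^ k) * ((1/2) ^ k * (1/2) ^ 3)"
        unfolding power_add mult_2 by (simp only: mult.assoc mult.left_commute)
      also have "(2::real) ^ k * (1/2) ^ k = 1" by (simp add: power_one_over)
      also have "4 * 1 * ((1/2::real) ^ k * (1/2) ^ 3) = (1/2) ^ (k + 1)" by (simp add: power3_eq_cube)
      finally show ?thesis .
    qed
    moreover have "w * Cm \<le> b * (1 + Cm)" using wb w0 Cm0 by (intro mult_mono) auto
    moreover have "(1/2::real) ^ k = (1/2) ^ (k + 1) + (1/2) ^ (k + 1)" by simp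
    ultimately show ?thesis using b(4) by linarith
  qed
  moreover have "norm (sf j) * norm (q - x0) \<le> 1" if "j < k" for j
    using mult_left_mono[OF \<open>norm (q - x0) \<le> 2 * e\<close>, of "norm (sf j)"] se[OF that] by simp
  moreover have "norm (q - x0) \<le> (1/2) ^ k"
    using \<open>norm (q - x0) \<le> 2 * e\<close> e(2) by simp
  moreover have "\<forall>(u, u')\<in>S. blinfun_apply s u + blinfun_apply u' z \<le> \<rho> + blinfun_apply u' u"
    using H_D1[OF h(1)] by blast
  ultimately have "hump B f k (z, s, \<rho>, q, w)"
    using h q w0 wb b(2) by (auto simp: hump_def sf_def cf_def split_beta)
  thus ?thesis by blast
qed
text \<open>Otherwise glide a hump: the point y is the weighted sum of the points z of all steps, with the missing weight at 0.
  Monotonicity bounds the values c'(c_k - y) from below by 2^k up to a constant, for all c' in S(c_k), and c_k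
  tends to x0; this contradicts the boundedness of S near x0 in the direction y.\<close>
lemma ev_bounded_above:
  obtains M where "eventually (\<lambda>(x, t, s, \<sigma>, \<rho>). \<forall>c\<in>D \<inter> cball x0 1. blinfun_apply s c \<le> M) F"
proof (rule ccontr)
  assume no: "\<not> thesis"
  have unbounded: "frequently (\<lambda>(x, t, s, \<sigma>, \<rho>). \<exists>c\<in>D \<inter> cball x0 1. M < blinfun_apply s c) F" for M
  proof (rule ccontr)
    assume "\<not> ?thesis"
    hence "eventually (\<lambda>(x, t, s, \<sigma>, \<rho>). \<forall>c\<in>D \<inter> cball x0 1. blinfun_apply s c \<le> M) F"
      unfolding not_frequently by (elim eventually_mono) (auto simp: not_less)
    thus False using no that by blast
  qed
  obtain x0' where x0': "(x0, x0') \<in> T" using x0T by auto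
  define B where "B = blinfun_apply x0' x0 + 1"
  \<comment> \<open>A step depends on all earlier ones, hence well-founded recursion instead of
    choice along the successor.\<close>
  have "\<exists>f. \<forall>k. hump B f k (f k)"
  proof (rule dependent_wf_choice[OF wf_less_than])
    fix f g :: "nat \<Rightarrow> 'a \<times> ('a \<Rightarrow>\<^sub>L real) \<times> real \<times> 'a \<times> real" and k r
    assume "\<And>z. (z, k) \<in> less_than \<Longrightarrow> f z = g z"
    thus "hump B f k r = hump B g k r" by (auto simp: hump_def split: prod.splits)
  next
    fix k and f :: "nat \<Rightarrow> 'a \<times> ('a \<Rightarrow>\<^sub>L real) \<times> real \<times> 'a \<times> real"
    assume "\<And>j. (j, k) \<in> less_than \<Longrightarrow> hump B f j (f j)"
    thus "\<exists>r. hump B f k r" by (intro hump_exists[OF unbounded x0' B_def]) auto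
  qed
  then obtain f where f: "hump B f k (f k)" for k by blast
  define z where "z j = fst (f j)" for j
  define s where "s j = fst (snd (f j))" for j
  define \<rho> where "\<rho> j = fst (snd (snd (f j)))" for j
  define c where "c j = fst (snd (snd (snd (f j))))" for j
  define w where "w j = snd (snd (snd (snd (f j))))" for j
  have hump: "norm (z k) \<le> 1" "\<rho> k \<le> 1" "- B \<le> blinfun_apply (s k) x0" "c k \<in> fst ` S" "norm (c k - x0) \<le> (1/2) ^ k"
    "0 < w k" "w k \<le> (1/2) ^ (k + 2)" "2 ^ k \<le> w k * blinfun_apply (s k) (c k)" for k
    using f[of k] by (simp_all add: hump_def z_def s_def \<rho>_def c_def w_def split_beta)
  have graph: "blinfun_apply (s k) u + blinfun_apply u' (z k) \<le> \<rho> k + blinfun_apply u' u" if "(u, u') \<in> S" for k u u'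
    using f[of k] that by (auto simp: hump_def z_def s_def \<rho>_def split_beta)
  have prev: "norm (s j) * norm (c k - x0) \<le> 1" "w k * blinfun_apply (s k) (x0 - c j) \<le> (1/2) ^ k" if "j < k" for j k
    using f[of k] that by (simp_all add: hump_def s_def c_def w_def split_beta)
  have wle: "w k \<le> (1/2) ^ k" for k
    by (rule order_trans[OF hump(7) power_decreasing]) auto
  have sum_half: "summable (\<lambda>k. (1/2::real) ^ k)" by (rule summable_geometric) simp
  have sum_w: "summable w"
    using wle hump(6) by (intro summable_comparison_test'[OF sum_half, of 0]) (auto simp: abs_of_pos)
  have "norm (w j *\<^sub>R z j) \<le> (1/2) ^ j" for j
  proof -
    have "w j * norm (z j) \<le> (1/2) ^ j * 1" using wle hump(1) hump(6)[of j] by (intro mult_mono) auto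
    thus ?thesis using hump(6)[of j] by simp
  qed
  hence "summable (\<lambda>j. w j *\<^sub>R z j)"
    by (intro summable_comparison_test'[OF sum_half, of 0]) auto
  then obtain y where y: "(\<lambda>j. w j *\<^sub>R z j) sums y" by (auto simp: summable_def)
  define W where "W = suminf w"
  have W: "w sums W" using sum_w by (simp add: W_def summable_sums)
  have W1: "0 \<le> W" "W \<le> 1"
  proof -
    show "0 \<le> W" unfolding W_def using hump(6) by (intro suminf_nonneg[OF sum_w]) (simp add: less_imp_le)
    have "(\<lambda>k. (1/4) * (1/2::real) ^ k) sums ((1/4) * 2)"
      using geometric_sums[of "1/2::real"] by (intro sums_mult) simp
    from sums_le[OF _ W this] show "W \<le> 1" using hump(7) by simp
  qed
  obtain \<epsilon> M where \<epsilon>: "0 < \<epsilon>" and M: "\<forall>c\<in>fst ` S \<inter> ball x0 \<epsilon>. \<exists>c'. (c, c') \<in> S \<and> blinfun_apply c' (c - y) \<le> M"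
    using dir_bounded[of y] by blast
  \<comment> \<open>\<open>B1\<close> collects the losses of step \<open>j\<close> in units of
    \<open>(1/2) ^ j\<close>: \<open>\<bar>B\<bar> + 1\<close> from \<open>s\<close> and 1 from
    \<open>\<rho>\<close>. By monotonicity against \<open>(0, s0)\<close>, \<open>- N\<close> is a
    lower bound for \<open>blinfun_apply c' (c k)\<close>.\<close>
  define B1 where "B1 = \<bar>B\<bar> + 2"
  define N where "N = norm s0 * (norm x0 + 1)"
  have key: "2 ^ k \<le> M + B1 * 2 + N + 1" if k: "(1/2) ^ k < \<epsilon>" for k
  proof -
    have "c k \<in> fst ` S \<inter> ball x0 \<epsilon>"
      using hump(4,5)[of k] k by (auto simp: dist_norm norm_minus_commute)
    then obtain c' where c': "(c k, c') \<in> S" "blinfun_apply c' (c k - y) \<le> M" using M by blast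
    \<comment> \<open>Earlier steps lose little because \<open>c k\<close> is close to
      \<open>x0\<close> relative to \<open>norm (s j)\<close>, later ones because their reverse
      bound covers \<open>c k\<close>; step \<open>k\<close> itself gains
      \<open>2 ^ k\<close>.\<close>
    have lower: "- (B1 * (1/2) ^ j) + (if j = k then 2 ^ k else 0) \<le> w j * blinfun_apply c' (c k - z j)" for j
    proof -
      have "w j * (blinfun_apply (s j) (c k) - \<rho> j) \<le> w j * blinfun_apply c' (c k - z j)"
        using graph[OF c'(1), of j] hump(6)[of j] by (intro mult_left_mono) (auto simp: blinfun.diff_right)
      moreover have "w j * \<rho> j \<le> (1/2) ^ j"
      proof -
        have "w j * \<rho> j \<le> w j * 1" using hump(2)[of j] hump(6)[of j] by (intro mult_left_mono) auto
        thus ?thesis using wle[of j] by simp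
      qed
      moreover have "- ((\<bar>B\<bar> + 1) * (1/2) ^ j) + (if j = k then 2 ^ k else 0) \<le> w j * blinfun_apply (s j) (c k)"
      proof (cases j k rule: linorder_cases)
        case less
        have "norm (s j) * norm (c k - x0) \<le> 1" by (rule prev(1)[OF less])
        hence "- 1 \<le> blinfun_apply (s j) (c k - x0)"
          using norm_blinfun[of "s j" "c k - x0"] by (simp add: abs_le_iff)
        hence "- (\<bar>B\<bar> + 1) \<le> blinfun_apply (s j) (c k)"
          using hump(3)[of j] by (simp add: blinfun.diff_right)
        hence "w j * (- (\<bar>B\<bar> + 1)) \<le> w j * blinfun_apply (s j) (c k)"
          using hump(6)[of j] by (intro mult_left_mono) auto
        moreover have "w j * (\<bar>B\<bar> + 1) \<le> (1/2) ^ j * (\<bar>B\<bar> + 1)" using wle by (intro mult_right_mono) auto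
        ultimately have "- ((1/2) ^ j * (\<bar>B\<bar> + 1)) \<le> w j * blinfun_apply (s j) (c k)"
          unfolding mult_minus_right by linarith
        thus ?thesis using less by (simp add: mult.commute)
      next
        case equal
        moreover have "0 \<le> (\<bar>B\<bar> + 1) * (1/2) ^ j" by simp
        moreover have "2 ^ k \<le> w k * blinfun_apply (s k) (c k)" by (rule hump(8))
        ultimately show ?thesis by (simp only: if_True simp_thms)
      next
        case greater
        have "w j * blinfun_apply (s j) (c k) = w j * blinfun_apply (s j) x0 - w j * blinfun_apply (s j) (x0 - c k)"
          by (simp add: blinfun.diff_right right_diff_distrib)
        moreover have "w j * (- \<bar>B\<bar>) \<le> w j * blinfun_apply (s j) x0"
          using hump(3)[of j] hump(6)[of j] by (intro mult_left_mono) auto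
        moreover have "w j * \<bar>B\<bar> \<le> (1/2) ^ j * \<bar>B\<bar>" using wle by (intro mult_right_mono) auto
        ultimately show ?thesis using greater prev(2)[OF greater] by (simp add: distrib_right mult.commute)
      qed
      ultimately show ?thesis by (simp add: B1_def right_diff_distrib distrib_right split: if_splits)
    qed
    have "(\<lambda>j. - (B1 * (1/2) ^ j) + (if j = k then 2 ^ k else 0)) sums (- (B1 * 2) + 2 ^ k)"
    proof (rule sums_add)
      have "(\<lambda>j. (1/2::real) ^ j) sums 2" using geometric_sums[of "1/2::real"] by simp
      thus "(\<lambda>j. - (B1 * (1/2) ^ j)) sums - (B1 * 2)" by (intro sums_minus sums_mult)
      show "(\<lambda>j. if j = k then 2 ^ k else 0) sums (2 ^ k :: real)"
        using sums_single[of k "\<lambda>_. 2 ^ k :: real"] by simp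
    qed
    moreover have "(\<lambda>j. w j * blinfun_apply c' (c k - z j)) sums (W * blinfun_apply c' (c k) - blinfun_apply c' y)"
    proof -
      have "(\<lambda>j. w j * blinfun_apply c' (c k)) sums (W * blinfun_apply c' (c k))" by (rule sums_mult2[OF W])
      moreover have "(\<lambda>j. blinfun_apply c' (w j *\<^sub>R z j)) sums blinfun_apply c' y"
        by (rule bounded_linear.sums[OF blinfun.bounded_linear_right y])
      ultimately have "(\<lambda>j. w j * blinfun_apply c' (c k) - blinfun_apply c' (w j *\<^sub>R z j))
        sums (W * blinfun_apply c' (c k) - blinfun_apply c' y)" by (rule sums_diff)
      thus ?thesis by (simp add: blinfun.diff_right blinfun.scaleR_right right_diff_distrib)
    qed
    ultimately have "- (B1 * 2) + 2 ^ k \<le> W * blinfun_apply c' (c k) - blinfun_apply c' y"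
      by (rule sums_le[OF lower])
    also have "\<dots> = blinfun_apply c' (c k - y) - (1 - W) * blinfun_apply c' (c k)"
      by (simp add: blinfun.diff_right algebra_simps)
    also have "\<dots> \<le> M + N"
    proof -
      have "norm (c k - x0) \<le> 1" using hump(5)[of k] power_le_one[of "1/2::real" k] by simp
      hence "norm (c k) \<le> norm x0 + 1" using norm_triangle_ineq[of x0 "c k - x0"] by simp
      hence "norm s0 * norm (c k) \<le> N" unfolding N_def by (intro mult_left_mono) auto
      hence "- N \<le> blinfun_apply s0 (c k)" using norm_blinfun[of s0 "c k"] by (simp add: abs_le_iff)
      also have "\<dots> \<le> blinfun_apply c' (c k)" using monS[OF c'(1) zeroS] by (simp add: blinfun.diff_left)
      finally have "(1 - W) * (- N) \<le> (1 - W) * blinfun_apply c' (c k)" using W1 by (intro mult_left_mono) auto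
      moreover have "0 \<le> W * N" using W1 by (simp add: N_def)
      ultimately show ?thesis using c'(2) by (simp add: algebra_simps)
    qed
    finally show ?thesis by simp
  qed
  obtain k1 where k1: "(1/2::real) ^ k1 < \<epsilon>" using real_arch_pow_inv[OF \<epsilon>, of "1/2"] by auto
  obtain k2 where k2: "M + B1 * 2 + N + 1 < 2 ^ k2" using real_arch_pow[of "2::real"] by auto
  have "(1/2::real) ^ (k1 + k2) \<le> (1/2) ^ k1" by (intro power_decreasing) auto
  from order_le_less_trans[OF this k1] have "2 ^ (k1 + k2) \<le> M + B1 * 2 + N + 1" by (rule key)
  moreover have "(2::real) ^ k2 \<le> 2 ^ (k1 + k2)" by (intro power_increasing) auto
  ultimately show False using k2 by simp
qed

text \<open>\<open>f\<close> is a linear functional below the upper limit of \<open>s\<close> along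
  \<open>F\<close>, which \<open>G\<close> encodes as an epigraph over \<open>U\<close>. A multiple
  of the norm bounds it below: a vector \<open>v\<close> of \<open>U\<close> with norm at most
  \<open>\<delta>\<close> equals \<open>c - (c - v)\<close>, where eventually \<open>s\<close> is at
  most \<open>M\<close> at \<open>c\<close> and at least \<open>- (n + 1)\<close> at
  \<open>c - v\<close>.\<close>

theorem decomposition_at_origin:
  "\<exists>f :: 'a \<Rightarrow>\<^sub>L real. (\<forall>(u, u')\<in>S. blinfun_apply f u \<le> blinfun_apply u' u) \<and>
    (\<forall>(d, d')\<in>T. - blinfun_apply f d \<le> blinfun_apply d' d)"
proof -
  obtain M where M: "eventually (\<lambda>(x, t, s, \<sigma>, \<rho>). \<forall>c\<in>D \<inter> cball x0 1. blinfun_apply s c \<le> M) F"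
    by (rule ev_bounded_above)
  obtain \<delta> n where \<delta>: "0 < \<delta>" "0 \<le> n" and dec: "\<And>w. w \<in> U \<Longrightarrow> norm w \<le> \<delta> \<Longrightarrow>
    \<exists>c x'. c \<in> D \<and> norm (c - x0) \<le> 1 \<and> (c - w, x', n) \<in> FT"
    by (rule U_ball_decomposition) (rule that)
  define G where "G = {(w, r). w \<in> U \<and> (\<forall>\<eta>>0. eventually (\<lambda>(x, t, s, \<sigma>, \<rho>). blinfun_apply s w \<le> r + \<eta>) F)}"
  have "convex G"
  proof (rule convexI)
    fix p q and u v :: real assume pq: "p \<in> G" "q \<in> G" and uv: "0 \<le> u" "0 \<le> v" "u + v = 1"
    obtain w r w' r' where p: "p = (w, r)" and q: "q = (w', r')" by (cases p, cases q)
    have "u *\<^sub>R w + v *\<^sub>R w' \<in> U" using pq unfolding p q G_def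
      by (intro subspace_add subspace_scale subspaceU) auto
    moreover have "eventually (\<lambda>(x, t, s, \<sigma>, \<rho>). blinfun_apply s (u *\<^sub>R w + v *\<^sub>R w') \<le> u * r + v * r' + \<eta>) F"
      if \<eta>: "0 < \<eta>" for \<eta>
    proof -
      have "eventually (\<lambda>(x, t, s, \<sigma>, \<rho>). blinfun_apply s w \<le> r + \<eta>) F"
        "eventually (\<lambda>(x, t, s, \<sigma>, \<rho>). blinfun_apply s w' \<le> r' + \<eta>) F"
        using pq \<eta> by (auto simp: p q G_def)
      thus ?thesis
      proof (eventually_elim, clarify)
        fix s :: "'a \<Rightarrow>\<^sub>L real" assume "blinfun_apply s w \<le> r + \<eta>" "blinfun_apply s w' \<le> r' + \<eta>"
        hence "u * blinfun_apply s w + v * blinfun_apply s w' \<le> u * (r + \<eta>) + v * (r' + \<eta>)"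
          using uv by (intro add_mono mult_left_mono)
        also have "\<dots> = u * r + v * r' + (u + v) * \<eta>" by (simp add: algebra_simps)
        finally show "blinfun_apply s (u *\<^sub>R w + v *\<^sub>R w') \<le> u * r + v * r' + \<eta>"
          using uv by (simp add: blinfun.add_right blinfun.scaleR_right)
      qed
    qed
    ultimately show "u *\<^sub>R p + v *\<^sub>R q \<in> G" by (simp add: p q G_def)
  qed
  define k where "k = (\<bar>M\<bar> + n + 2) / \<delta>"
  have k: "0 \<le> k" using \<delta> by (simp add: k_def)
  have "- (k * norm w) \<le> r" if wr: "(w, r) \<in> G" for w r
  proof -
    have wU: "w \<in> U" and ev: "\<And>\<eta>. 0 < \<eta> \<Longrightarrow> eventually (\<lambda>(x, t, s, \<sigma>, \<rho>). blinfun_apply s w \<le> r + \<eta>) F"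
      using wr by (auto simp: G_def)
    define \<kappa> where "\<kappa> = norm w / \<delta>"
    \<comment> \<open>Opposite to \<open>w\<close> with norm \<open>\<delta>\<close>, so that an
      upper bound for \<open>s\<close> at \<open>v\<close> is a lower bound at \<open>w\<close>. For
      \<open>w = 0\<close> both \<open>\<kappa>\<close> and \<open>v\<close> are 0.\<close>
    define v where "v = - (\<delta> / norm w) *\<^sub>R w"
    have \<kappa>: "0 \<le> \<kappa>" "\<kappa> *\<^sub>R v = - w" using \<delta> by (auto simp: \<kappa>_def v_def)
    have "v \<in> U" unfolding v_def by (rule subspace_scale[OF subspaceU wU])
    moreover have "norm v \<le> \<delta>" using \<delta>(1) by (simp add: v_def)
    ultimately obtain c x' where cx: "c \<in> D" "norm (c - x0) \<le> 1" "(c - v, x', n) \<in> FT" using dec by blast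
    have "- (k * norm w) \<le> r + \<eta>" if \<eta>: "0 < \<eta>" for \<eta>
    proof -
      have "eventually (\<lambda>h. - (k * norm w) \<le> r + \<eta>) F"
        using M ev[OF \<eta>] ev_lower_FT[OF cx(3) zero_less_one]
      proof (eventually_elim, clarify)
        fix s :: "'a \<Rightarrow>\<^sub>L real"
        assume s: "\<forall>c\<in>D \<inter> cball x0 1. blinfun_apply s c \<le> M" "blinfun_apply s w \<le> r + \<eta>"
          "- blinfun_apply s (c - v) \<le> n + 1"
        have "blinfun_apply s c \<le> M" using s(1) cx by (simp add: dist_norm norm_minus_commute)
        hence "blinfun_apply s v \<le> \<bar>M\<bar> + n + 2" using s(3) by (simp add: blinfun.diff_right)
        hence "\<kappa> * blinfun_apply s v \<le> \<kappa> * (\<bar>M\<bar> + n + 2)" using \<kappa>(1) by (rule mult_left_mono)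
        moreover have "\<kappa> * blinfun_apply s v = - blinfun_apply s w"
          using \<kappa>(2) by (metis blinfun.minus_right blinfun.scaleR_right real_scaleR_def)
        moreover have "\<kappa> * (\<bar>M\<bar> + n + 2) = k * norm w" by (simp add: \<kappa>_def k_def)
        ultimately show "- (k * norm w) \<le> r + \<eta>" using s(2) by linarith
      qed
      \<comment> \<open>The inequality does not involve the point of \<open>H\<close>, so it holds
        outright because \<open>F\<close> is proper.\<close>
      thus ?thesis using F_not_bot by simp
    qed
    thus ?thesis by (rule field_le_epsilon)
  qed
  from Hahn_Banach_convex[OF \<open>convex G\<close> this k]
  obtain f :: "'a \<Rightarrow>\<^sub>L real" where f: "\<forall>(w, r)\<in>G. blinfun_apply f w \<le> r" by blast
  \<comment> \<open>The origin lies in both domains, so points of either domain are differences up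
    to sign and belong to \<open>U\<close>.\<close>
  have zero: "0 \<in> D" "0 \<in> convex hull (fst ` T)"
    using zeroS zeroT closure_subset[of "fst ` S"] by (force intro: hull_inc)+
  have "blinfun_apply f u \<le> blinfun_apply u' u" if u: "(u, u') \<in> S" for u u'
  proof -
    have "u \<in> D" using u closure_subset[of "fst ` S"] by force
    from U_diff(2)[OF this zero(2)] have "u \<in> U" by simp
    hence "(u, blinfun_apply u' u) \<in> G" using ev_upper_S[OF u] by (auto simp: G_def)
    thus ?thesis using f by blast
  qed
  moreover have "- blinfun_apply f d \<le> blinfun_apply d' d" if d: "(d, d') \<in> T" for d d'
  proof -
    have "d \<in> convex hull (fst ` T)" using d by (force intro: hull_inc)
    from U_diff(2)[OF zero(1) this] have "- d \<in> U" by simp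
    hence "(- d, blinfun_apply d' d) \<in> G"
      using ev_lower_FT[OF graph_FT[OF d]] by (auto simp: G_def blinfun.minus_right)
    hence "blinfun_apply f (- d) \<le> blinfun_apply d' d" using f by blast
    thus ?thesis by (simp add: blinfun.minus_right)
  qed
  ultimately show ?thesis by blast
qed
end

section \<open>Operators whose domain has interior points\<close>

lemma exists_small_scale:
  fixes w :: "'a::real_normed_vector"
  assumes "0 < e" obtains h where "0 < h" "h \<le> 1" "h * norm w < e"
proof (rule that[of "e / (e + norm w + 1)"])
  have pos: "0 < e + norm w + 1" using assms norm_ge_zero[of w] by linarith
  show "0 < e / (e + norm w + 1)" using assms pos by simp
  show "e / (e + norm w + 1) \<le> 1" using pos by simp
  have "e * norm w < e * (e + norm w + 1)" using assms by (intro mult_strict_left_mono) auto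
  thus "e / (e + norm w + 1) * norm w < e" using pos by (simp only: times_divide_eq_left pos_divide_less_eq)
qed

lemma monotone_locally_bounded:
  fixes S :: "('a::banach) mop"
  assumes S: "monotone_op S" and x0: "x0 \<in> interior (dom_op S)"
  obtains r N where "0 < r" "0 \<le> N" "ball x0 r \<subseteq> dom_op S" "\<And>u u'. u \<in> ball x0 r \<Longrightarrow> u' \<in> S u \<Longrightarrow> norm u' \<le> N"
proof -
  obtain \<rho> where \<rho>: "0 < \<rho>" "ball x0 \<rho> \<subseteq> dom_op S" using x0 by (meson mem_interior)
  \<comment> \<open>By monotonicity v lies in some A n whenever x0 + v is in the domain, so these closed convex sets absorb.\<close>
  define A where "A n = {v. \<forall>u. \<forall>u'\<in>S u. norm (u - x0) \<le> 1 \<longrightarrow> blinfun_apply u' (x0 + v - u) \<le> real n}" for n :: nat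
  have "closed (A n)" for n
  proof -
    have "A n = (\<Inter>p\<in>{(u, u'). u' \<in> S u \<and> norm (u - x0) \<le> 1}. {v. blinfun_apply (snd p) (x0 + v - fst p) \<le> real n})"
      by (auto simp: A_def)
    thus ?thesis by (auto intro!: closed_INT closed_Collect_le continuous_intros)
  qed
  have conv: "convex (A n)" for n
  proof (rule convexI)
    fix a b and s t :: real assume ab: "a \<in> A n" "b \<in> A n" and st: "0 \<le> s" "0 \<le> t" "s + t = 1"
    have "blinfun_apply u' (x0 + (s *\<^sub>R a + t *\<^sub>R b) - u) \<le> real n" if u: "u' \<in> S u" "norm (u - x0) \<le> 1" for u u'
    proof -
      have "x0 + (s *\<^sub>R a + t *\<^sub>R b) - u = (s + t) *\<^sub>R (x0 - u) + (s *\<^sub>R a + t *\<^sub>R b)" using st by simp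
      also have "\<dots> = s *\<^sub>R (x0 + a - u) + t *\<^sub>R (x0 + b - u)" by (simp add: algebra_simps)
      finally have "blinfun_apply u' (x0 + (s *\<^sub>R a + t *\<^sub>R b) - u)
          = s * blinfun_apply u' (x0 + a - u) + t * blinfun_apply u' (x0 + b - u)"
        by (simp only: blinfun.add_right blinfun.scaleR_right real_scaleR_def)
      also have "\<dots> \<le> s * real n + t * real n"
        using ab u st unfolding A_def by (intro add_mono mult_left_mono) auto
      also have "\<dots> = real n" using st by (simp flip: distrib_right)
      finally show ?thesis .
    qed
    thus "s *\<^sub>R a + t *\<^sub>R b \<in> A n" by (auto simp: A_def)
  qed
  have mono: "A m \<subseteq> A n" if "m \<le> n" for m n
    using that by (fastforce simp: A_def)
  have mem: "v \<in> A n" if x': "x' \<in> S (x0 + v)" and n: "norm x' * (norm v + 1) \<le> real n" for v x' n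
  proof -
    have "blinfun_apply u' (x0 + v - u) \<le> real n" if u: "u' \<in> S u" "norm (u - x0) \<le> 1" for u u'
    proof -
      have "blinfun_apply u' (x0 + v - u) \<le> blinfun_apply x' (x0 + v - u)"
        using monotone_opD[OF S x' u(1)] by (simp add: blinfun.diff_left)
      also have "\<dots> \<le> norm x' * norm (x0 + v - u)" using norm_blinfun[of x' "x0 + v - u"] by simp
      also have "\<dots> \<le> norm x' * (norm v + 1)"
        using norm_triangle_ineq4[of v "u - x0"] u(2) by (intro mult_left_mono) (auto simp: algebra_simps)
      finally show ?thesis using n by simp
    qed
    thus ?thesis by (auto simp: A_def)
  qed
  have absorb: "\<exists>n\<ge>1. (1 / real n) *\<^sub>R w \<in> A n" if "w \<in> UNIV" for w
  proof -
    obtain h where h: "0 < h" "h \<le> 1" "h * norm w < \<rho>" by (rule exists_small_scale[OF \<rho>(1)])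
    have "x0 \<in> dom_op S" "x0 + h *\<^sub>R w \<in> dom_op S" using \<rho> h by (auto simp: dist_norm)
    then obtain a b where ab: "a \<in> S (x0 + 0)" "b \<in> S (x0 + h *\<^sub>R w)" by (auto simp: dom_op_def)
    obtain n where n: "real n \<ge> max (max 1 (1 / h)) (max (norm a * (norm (0::'a) + 1)) (norm b * (norm (h *\<^sub>R w) + 1)))"
      using real_arch_simple by blast
    have "0 \<in> A n" "h *\<^sub>R w \<in> A n" using mem[OF ab(1)] mem[OF ab(2)] n by auto
    moreover have n1: "1 \<le> real n" "1 / h \<le> real n" using n by auto
    moreover from n1 have "1 / (h * real n) \<le> 1" using h by (simp add: field_simps)
    ultimately have "(1 - 1 / (h * real n)) *\<^sub>R 0 + (1 / (h * real n)) *\<^sub>R h *\<^sub>R w \<in> A n"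
      using h by (intro convexD_alt[OF conv]) auto
    hence "(1 / real n) *\<^sub>R w \<in> A n" using h by simp
    thus ?thesis using n1 by (intro exI[of _ n]) auto
  qed
  obtain n \<delta> where n: "0 < \<delta>" "UNIV \<inter> ball 0 \<delta> \<subseteq> closure (A n)"
    using Baire_absorbing[OF closed_UNIV subspace_UNIV conv subset_UNIV mono absorb] by blast
  hence sub: "ball 0 \<delta> \<subseteq> A n" using \<open>closed (A n)\<close> by simp
  define r where "r = min (min 1 (\<delta> / 2)) \<rho>"
  have r: "0 < r" "r \<le> 1" "r \<le> \<delta> / 2" "r \<le> \<rho>" using n \<rho> by (auto simp: r_def)
  have bound: "norm u' \<le> 4 * real n / \<delta>" if u: "u \<in> ball x0 r" "u' \<in> S u" for u u'
  proof (rule norm_blinfun_bound)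
    show "0 \<le> 4 * real n / \<delta>" using n by simp
    fix v
    have le: "blinfun_apply u' v \<le> 4 * real n / \<delta> * norm v" for v
    proof (cases "v = 0")
      case False
      \<comment> \<open>At \<open>u - x0 + q\<close> the inequality of \<open>A n\<close> is a bound
        for \<open>blinfun_apply u' q\<close>; the norm \<open>\<delta> / 4\<close> of
        \<open>q\<close> keeps this point in the ball.\<close>
      define q where "q = (\<delta> / (4 * norm v)) *\<^sub>R v"
      have q: "norm q = \<delta> / 4" using n False by (simp add: q_def)
      have "norm (u - x0 + q) < \<delta>"
        using norm_triangle_ineq[of "u - x0" q] q u(1) r n(1) by (simp add: dist_norm norm_minus_commute)
      hence "u - x0 + q \<in> A n" using sub by auto
      moreover have "norm (u - x0) \<le> 1" using u(1) r by (simp add: dist_norm norm_minus_commute)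
      ultimately have "blinfun_apply u' (x0 + (u - x0 + q) - u) \<le> real n"
        using u(2) unfolding A_def by blast
      hence "blinfun_apply u' q \<le> real n" by simp
      hence "\<delta> / (4 * norm v) * blinfun_apply u' v \<le> real n" by (simp add: q_def blinfun.scaleR_right)
      thus ?thesis using n False by (simp add: field_simps)
    qed auto
    show "norm (blinfun_apply u' v) \<le> 4 * real n / \<delta> * norm v"
      using le[of v] le[of "- v"] by (simp add: blinfun.minus_right abs_le_iff)
  qed
  show ?thesis
    by (rule that[of r "4 * real n / \<delta>"]) (use r \<rho> n bound in auto)
qed

text \<open>With \<open>z\<close> on the segment from \<open>y\<close> to a point \<open>a\<close>
  of the ball, monotonicity between \<open>z\<close> and \<open>a\<close> bounds \<open>z'\<close>
  in the direction \<open>a - y\<close> by an element of \<open>S a\<close>, which local boundedness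
  controls. For \<open>t = 1\<close> the points coincide and \<open>z'\<close> itself is
  bounded.\<close>

lemma dir_inf_bounded_interior:
  fixes S :: "('a::banach) mop"
  assumes S: "monotone_op S" and x0: "x0 \<in> interior (dom_op S)"
  shows "dir_inf_bounded S x0"
proof -
  obtain r N where r: "0 < r" "0 \<le> N" "ball x0 r \<subseteq> dom_op S"
    and N: "\<And>u u'. u \<in> ball x0 r \<Longrightarrow> u' \<in> S u \<Longrightarrow> norm u' \<le> N"
    using monotone_locally_bounded[OF S x0] by blast
  have "\<exists>z'\<in>S z. blinfun_apply z' (z - y) \<le> (N + 1) * norm (z - y)" if z: "z \<in> Kset y (ball x0 r) \<inter> dom_op S" for y z
  proof -
    obtain t a where ta: "z = (1 - t) *\<^sub>R y + t *\<^sub>R a" "0 \<le> t" "t \<le> 1" "a \<in> ball x0 r"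
      using z unfolding Kset_def by blast
    obtain z' where z': "z' \<in> S z" using z by (auto simp: dom_op_def)
    have "a \<in> dom_op S" using ta(4) r(3) by blast
    then obtain a' where a': "a' \<in> S a" by (auto simp: dom_op_def)
    have zy: "z - y = t *\<^sub>R (a - y)" and za: "z - a = (1 - t) *\<^sub>R (y - a)"
      using ta(1) by (simp_all add: algebra_simps)
    have "blinfun_apply z' (z - y) \<le> N * norm (z - y)"
    proof (cases "t = 1")
      case True
      hence "z = a" using ta(1) by simp
      hence "norm z' * norm (z - y) \<le> N * norm (z - y)"
        using N[OF ta(4)] z' by (intro mult_right_mono) auto
      thus ?thesis using norm_blinfun[of z' "z - y"] by simp
    next
      case False
      have "0 \<le> (1 - t) * blinfun_apply (z' - a') (y - a)"
        using monotone_opD[OF S z' a'] unfolding za by (simp add: blinfun.scaleR_right)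
      hence "0 \<le> blinfun_apply (z' - a') (y - a)"
        using False ta(3) by (simp add: zero_le_mult_iff)
      hence "blinfun_apply z' (a - y) \<le> blinfun_apply a' (a - y)"
        by (simp add: blinfun.diff_left blinfun.diff_right)
      also have "\<dots> \<le> norm a' * norm (a - y)" using norm_blinfun[of a' "a - y"] by simp
      also have "\<dots> \<le> N * norm (a - y)" using N[OF ta(4) a'] by (intro mult_right_mono) auto
      finally have "t * blinfun_apply z' (a - y) \<le> t * (N * norm (a - y))" using ta(2) by (rule mult_left_mono)
      thus ?thesis using ta(2) by (simp add: zy blinfun.scaleR_right mult.left_commute)
    qed
    also have "\<dots> \<le> (N + 1) * norm (z - y)" by (intro mult_right_mono) auto
    finally show ?thesis using z' by blast
  qed
  moreover have "x0 \<in> dom_op S" using x0 interior_subset by blast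
  moreover have "0 < N + 1" using r(2) by simp
  ultimately show ?thesis unfolding dir_inf_bounded_def using r(1) by blast
qed

text \<open>A functional f in S(z) must satisfy f (u - z) <= u' (u - z) on the graph of S. Hahn-Banach provides it, because
  convex combinations with mean u = z have nonnegative mean of u' (u - z), by monotonicity.\<close>
lemma interior_convex_hull_dom:
  fixes S :: "('a::banach) mop"
  assumes S: "maximal_monotone S" and x0: "x0 \<in> interior (dom_op S)"
    and z: "z \<in> interior (convex hull (dom_op S))"
  shows "z \<in> dom_op S"
proof -
  have mon: "monotone_op S" using S by (simp add: maximal_monotone_def)
  define g where "g = {(u, u', blinfun_apply u' u) | u u'. u' \<in> S u}"
  \<comment> \<open>Monotonicity is affine in each of the two graph points, so it passes to the hull
    in one variable at a time. Applied to one point twice, it gives \<open>zero\<close>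
    below.\<close>
  have pair: "blinfun_apply s y + blinfun_apply t x \<le> \<rho> + \<tau>"
    if xs: "(x, s, \<rho>) \<in> convex hull g" and yt: "(y, t, \<tau>) \<in> convex hull g" for x s \<rho> y t \<tau>
  proof -
    have conv: "convex {(y, t, \<tau>). blinfun_apply s y + blinfun_apply t x \<le> \<rho> + \<tau>}" for x :: 'a and s :: "'a \<Rightarrow>\<^sub>L real" and \<rho> :: real
    proof (rule convexI)
      fix p q and u v :: real
      assume pq: "p \<in> {(y, t, \<tau>). blinfun_apply s y + blinfun_apply t x \<le> \<rho> + \<tau>}"
          "q \<in> {(y, t, \<tau>). blinfun_apply s y + blinfun_apply t x \<le> \<rho> + \<tau>}"
        and uv: "0 \<le> u" "0 \<le> v" "u + v = 1"
      obtain y1 t1 \<tau>1 y2 t2 \<tau>2 where p: "p = (y1, t1, \<tau>1)" and q: "q = (y2, t2, \<tau>2)" by (cases p, cases q)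
      have 1: "blinfun_apply s y1 + blinfun_apply t1 x \<le> \<rho> + \<tau>1" "blinfun_apply s y2 + blinfun_apply t2 x \<le> \<rho> + \<tau>2"
        using pq by (simp_all add: p q)
      have "u * (blinfun_apply s y1 + blinfun_apply t1 x) + v * (blinfun_apply s y2 + blinfun_apply t2 x)
          \<le> u * (\<rho> + \<tau>1) + v * (\<rho> + \<tau>2)"
        by (rule add_mono[OF mult_left_mono[OF 1(1) uv(1)] mult_left_mono[OF 1(2) uv(2)]])
      also have "\<dots> = (u + v) * \<rho> + (u * \<tau>1 + v * \<tau>2)" by (simp add: algebra_simps)
      finally have *: "u * (blinfun_apply s y1 + blinfun_apply t1 x) + v * (blinfun_apply s y2 + blinfun_apply t2 x)
          \<le> \<rho> + (u * \<tau>1 + v * \<tau>2)" using uv by simp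
      have "u *\<^sub>R (y1, t1, \<tau>1) + v *\<^sub>R (y2, t2, \<tau>2) = (u *\<^sub>R y1 + v *\<^sub>R y2, u *\<^sub>R t1 + v *\<^sub>R t2, u * \<tau>1 + v * \<tau>2)" by simp
      moreover have "blinfun_apply s (u *\<^sub>R y1 + v *\<^sub>R y2) + blinfun_apply (u *\<^sub>R t1 + v *\<^sub>R t2) x \<le> \<rho> + (u * \<tau>1 + v * \<tau>2)"
        using * by (simp add: blinfun.add_left blinfun.scaleR_left blinfun.add_right blinfun.scaleR_right algebra_simps)
      ultimately show "u *\<^sub>R p + v *\<^sub>R q \<in> {(y, t, \<tau>). blinfun_apply s y + blinfun_apply t x \<le> \<rho> + \<tau>}"
        by (simp add: p q)
    qed
    have "g \<subseteq> {(y, t, \<tau>). blinfun_apply s y + blinfun_apply t x \<le> \<rho> + \<tau>}" if "(x, s, \<rho>) \<in> g" for x s \<rho>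
    proof -
      have "blinfun_apply s y + blinfun_apply t x \<le> \<rho> + \<tau>" if "(y, t, \<tau>) \<in> g" for y t \<tau>
      proof -
        have "s \<in> S x" "t \<in> S y" "\<rho> = blinfun_apply s x" "\<tau> = blinfun_apply t y"
          using that \<open>(x, s, \<rho>) \<in> g\<close> by (auto simp: g_def)
        thus ?thesis using monotone_opD[OF mon, of s x t y] by (simp add: blinfun.diff_left blinfun.diff_right)
      qed
      thus ?thesis by auto
    qed
    hence *: "convex hull g \<subseteq> {(y, t, \<tau>). blinfun_apply s y + blinfun_apply t x \<le> \<rho> + \<tau>}" if "(x, s, \<rho>) \<in> g" for x s \<rho>
      using that conv by (simp add: hull_minimal)
    have "g \<subseteq> {(y', t', \<tau>'). blinfun_apply t y' + blinfun_apply t' y \<le> \<tau> + \<tau>'}"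
    proof
      fix p assume p: "p \<in> g"
      obtain y' t' \<tau>' where p': "p = (y', t', \<tau>')" by (cases p)
      from subsetD[OF *[OF p[unfolded p']] yt]
      show "p \<in> {(y', t', \<tau>'). blinfun_apply t y' + blinfun_apply t' y \<le> \<tau> + \<tau>'}"
        by (simp add: p' add.commute)
    qed
    hence "convex hull g \<subseteq> {(y', t', \<tau>'). blinfun_apply t y' + blinfun_apply t' y \<le> \<tau> + \<tau>'}"
      using conv by (simp add: hull_minimal)
    from subsetD[OF this xs] show ?thesis by (simp add: add.commute)
  qed
  define G where "G = (\<lambda>p. (- z, 0) + p) ` ((\<lambda>(x, s, \<rho>). (x, \<rho> - blinfun_apply s z)) ` (convex hull g))"
  have lin: "linear (\<lambda>(x::'a, s, \<rho>). (x, \<rho> - blinfun_apply s z))"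
    by (rule linearI) (auto simp: blinfun.add_left blinfun.scaleR_left algebra_simps)
  have convG: "convex G"
    unfolding G_def by (intro convex_translation convex_linear_image[OF lin] convex_convex_hull)
  have G_iff: "(w, r) \<in> G \<longleftrightarrow> (\<exists>s \<rho>. (z + w, s, \<rho>) \<in> convex hull g \<and> r = \<rho> - blinfun_apply s z)" for w r
    unfolding G_def image_image by (force simp: image_iff)
  have zero: "0 \<le> r" if "(0, r) \<in> G" for r
  proof -
    obtain s \<rho> where "(z, s, \<rho>) \<in> convex hull g" "r = \<rho> - blinfun_apply s z" using \<open>(0, r) \<in> G\<close> unfolding G_iff by auto
    thus ?thesis using pair[of z s \<rho> z s \<rho>] by simp
  qed
  obtain r0 N where r0: "0 < r0" "0 \<le> N" "ball x0 r0 \<subseteq> dom_op S"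
    and N: "\<And>u u'. u \<in> ball x0 r0 \<Longrightarrow> u' \<in> S u \<Longrightarrow> norm u' \<le> N"
    using monotone_locally_bounded[OF mon x0] by blast
  obtain e where e: "0 < e" "ball z e \<subseteq> convex hull (dom_op S)" using z by (meson mem_interior)
  obtain \<eta> where \<eta>: "0 < \<eta>" "\<eta> \<le> 1" "\<eta> * norm (z - x0) < e" by (rule exists_small_scale[OF e(1)])
  \<comment> \<open>\<open>b\<close> lies slightly beyond \<open>z\<close> on the ray from
    \<open>x0\<close>. Hence \<open>z\<close> is a convex combination of \<open>b\<close> and
    \<open>x0\<close>, and moving \<open>x0\<close> within its ball moves \<open>z\<close> in every
    direction.\<close>
  define b where "b = z + \<eta> *\<^sub>R (z - x0)"
  have "b \<in> convex hull (dom_op S)" using e(2) \<eta> by (auto simp: b_def dist_norm)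
  also have "dom_op S = fst ` g" by (force simp: g_def dom_op_def)
  also have "convex hull (fst ` g) = fst ` (convex hull g)" by (rule convex_hull_linear_image[OF linear_fst, symmetric])
  finally obtain sb \<rho>b where b: "(b, sb, \<rho>b) \<in> convex hull g" by force
  define \<tau> where "\<tau> = \<eta> / (1 + \<eta>)"
  have \<tau>: "0 < \<tau>" "\<tau> \<le> 1" using \<eta> by (auto simp: \<tau>_def)
  have zb: "(1 - \<tau>) *\<^sub>R b + \<tau> *\<^sub>R x0 = z"
  proof -
    have "(1 - \<tau>) * (1 + \<eta>) = 1" "(1 - \<tau>) * \<eta> = \<tau>" using \<eta> by (auto simp: \<tau>_def field_simps)
    moreover have "(1 - \<tau>) *\<^sub>R b + \<tau> *\<^sub>R x0 = ((1 - \<tau>) * (1 + \<eta>)) *\<^sub>R z + (\<tau> - (1 - \<tau>) * \<eta>) *\<^sub>R x0"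
      unfolding b_def by (simp add: algebra_simps)
    ultimately show ?thesis by simp
  qed
  define \<delta> where "\<delta> = \<tau> * r0 / 2"
  have \<delta>: "0 < \<delta>" using \<tau> r0 by (simp add: \<delta>_def)
  define R where "R = \<bar>\<rho>b - blinfun_apply sb z\<bar> + N * (norm x0 + r0 + norm z)"
  have R0: "0 \<le> R" using r0 by (simp add: R_def)
  have ball: "\<exists>r'\<le>R. (v, r') \<in> G" if v: "norm v \<le> \<delta>" for v
  proof -
    define u where "u = x0 + (1 / \<tau>) *\<^sub>R v"
    have "0 < \<tau> * r0" using \<tau> r0 by simp
    hence "norm v < \<tau> * r0" using v unfolding \<delta>_def by linarith
    hence "norm v / \<tau> < r0" using \<tau> by (simp add: pos_divide_less_eq mult.commute)
    hence u: "u \<in> ball x0 r0" using \<tau> by (simp add: u_def dist_norm)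
    hence "u \<in> dom_op S" using r0 by blast
    then obtain u' where u': "u' \<in> S u" by (auto simp: dom_op_def)
    hence "(u, u', blinfun_apply u' u) \<in> convex hull g" by (auto intro: hull_inc simp: g_def)
    hence "(1 - \<tau>) *\<^sub>R (b, sb, \<rho>b) + \<tau> *\<^sub>R (u, u', blinfun_apply u' u) \<in> convex hull g"
      using b \<tau> by (intro convexD_alt[OF convex_convex_hull]) auto
    moreover have "(1 - \<tau>) *\<^sub>R b + \<tau> *\<^sub>R u = z + v"
      using zb \<tau> by (simp add: u_def scaleR_add_right flip: add.assoc)
    ultimately have "(z + v, (1 - \<tau>) *\<^sub>R sb + \<tau> *\<^sub>R u', (1 - \<tau>) * \<rho>b + \<tau> * blinfun_apply u' u) \<in> convex hull g"
      by simp
    hence "(v, (1 - \<tau>) * \<rho>b + \<tau> * blinfun_apply u' u - blinfun_apply ((1 - \<tau>) *\<^sub>R sb + \<tau> *\<^sub>R u') z) \<in> G"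
      unfolding G_iff by blast
    moreover have "(1 - \<tau>) * \<rho>b + \<tau> * blinfun_apply u' u - blinfun_apply ((1 - \<tau>) *\<^sub>R sb + \<tau> *\<^sub>R u') z \<le> R"
    proof -
      have "blinfun_apply u' (u - z) \<le> norm u' * norm (u - z)" using norm_blinfun[of u' "u - z"] by simp
      also have "\<dots> \<le> N * (norm x0 + r0 + norm z)"
      proof (rule mult_mono)
        show "norm u' \<le> N" by (rule N[OF u u'])
        have "norm u \<le> norm x0 + norm (u - x0)" using norm_triangle_ineq[of x0 "u - x0"] by simp
        thus "norm (u - z) \<le> norm x0 + r0 + norm z"
          using norm_triangle_ineq4[of u z] u by (simp add: dist_norm norm_minus_commute)
      qed (use r0 in auto)
      finally have 1: "blinfun_apply u' (u - z) \<le> N * (norm x0 + r0 + norm z)" .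
      have 2: "0 \<le> N * (norm x0 + r0 + norm z)" using r0 by simp
      have "\<tau> * blinfun_apply u' (u - z) \<le> \<tau> * (N * (norm x0 + r0 + norm z))" using 1 \<tau> by (intro mult_left_mono) auto
      also have "\<dots> \<le> 1 * (N * (norm x0 + r0 + norm z))" using 2 \<tau> by (intro mult_right_mono) auto
      finally have 3: "\<tau> * blinfun_apply u' (u - z) \<le> N * (norm x0 + r0 + norm z)" by simp
      have "(1 - \<tau>) * (\<rho>b - blinfun_apply sb z) \<le> (1 - \<tau>) * \<bar>\<rho>b - blinfun_apply sb z\<bar>"
        using \<tau> by (intro mult_left_mono) auto
      also have "\<dots> \<le> 1 * \<bar>\<rho>b - blinfun_apply sb z\<bar>" using \<tau> by (intro mult_right_mono) auto
      finally have 4: "(1 - \<tau>) * (\<rho>b - blinfun_apply sb z) \<le> \<bar>\<rho>b - blinfun_apply sb z\<bar>" by simp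
      have "(1 - \<tau>) * \<rho>b + \<tau> * blinfun_apply u' u - blinfun_apply ((1 - \<tau>) *\<^sub>R sb + \<tau> *\<^sub>R u') z
        = (1 - \<tau>) * (\<rho>b - blinfun_apply sb z) + \<tau> * blinfun_apply u' (u - z)"
        by (simp add: blinfun.add_left blinfun.scaleR_left blinfun.diff_right right_diff_distrib)
      thus ?thesis using 3 4 by (simp add: R_def)
    qed
    ultimately show ?thesis by blast
  qed
  have lb: "- (R / \<delta> * norm w) \<le> r" if wr: "(w, r) \<in> G" for w r
  proof (cases "w = 0")
    case True thus ?thesis using zero wr by simp
  next
    case False
    have "norm (- (\<delta> / norm w) *\<^sub>R w) \<le> \<delta>" using \<delta> False by simp
    from ball[OF this] obtain r' where r': "r' \<le> R" "(- (\<delta> / norm w) *\<^sub>R w, r') \<in> G" by blast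
    \<comment> \<open>The weights that combine \<open>w\<close> and the opposite vector of norm
      \<open>\<delta>\<close> to the origin, where \<open>zero\<close> applies.\<close>
    define m where "m = norm w / (norm w + \<delta>)"
    have nw: "0 < norm w + \<delta>" using \<delta> by (simp add: add_nonneg_pos)
    have m: "0 \<le> m" "m \<le> 1" using \<delta> nw by (auto simp: m_def)
    have m1: "1 - m = \<delta> / (norm w + \<delta>)" using nw by (simp add: m_def field_simps)
    have "(1 - m) *\<^sub>R (w, r) + m *\<^sub>R (- (\<delta> / norm w) *\<^sub>R w, r') \<in> G"
      using m wr r' by (intro convexD_alt[OF convG]) auto
    hence "((1 - m) *\<^sub>R w + m *\<^sub>R (- (\<delta> / norm w) *\<^sub>R w), (1 - m) * r + m * r') \<in> G"
      by (simp only: scaleR_Pair add_Pair real_scaleR_def)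
    moreover have "(1 - m) *\<^sub>R w + m *\<^sub>R (- (\<delta> / norm w) *\<^sub>R w) = 0"
      unfolding m1 using False by (simp add: m_def)
    ultimately have "0 \<le> (1 - m) * r + m * r'" using zero by (simp only:)
    hence "0 \<le> (norm w + \<delta>) * ((1 - m) * r + m * r')" using nw by simp
    also have "(norm w + \<delta>) * ((1 - m) * r + m * r') = \<delta> * r + norm w * r'"
      unfolding m1 using nw by (simp add: m_def distrib_left)
    also have "\<dots> \<le> \<delta> * r + norm w * R" using r' by (simp add: mult_left_mono)
    finally show ?thesis using \<delta> by (simp add: field_simps)
  qed
  have "0 \<le> R / \<delta>" using R0 \<delta> by simp
  from Hahn_Banach_convex[OF convG lb this]
  obtain f :: "'a \<Rightarrow>\<^sub>L real" where f: "\<forall>(w, r)\<in>G. blinfun_apply f w \<le> r" by blast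
  have "f \<in> S z"
  proof (rule maximal_monotone_mem[OF S])
    fix u u' assume "u' \<in> S u"
    hence "(z + (u - z), u', blinfun_apply u' u) \<in> convex hull g" by (auto intro: hull_inc simp: g_def)
    hence "(u - z, blinfun_apply u' u - blinfun_apply u' z) \<in> G" unfolding G_iff by blast
    hence "blinfun_apply f (u - z) \<le> blinfun_apply u' u - blinfun_apply u' z" using f by blast
    thus "0 \<le> blinfun_apply (u' - f) (u - z)" by (simp add: blinfun.diff_left blinfun.diff_right)
  qed
  thus ?thesis by (auto simp: dom_op_def)
qed

text \<open>Pulling a point of the hull slightly towards \<open>x0\<close> makes it interior to the
  hull, hence a point of the domain; thus hull and domain have the same closure.\<close>

lemma convex_closure_dom:
  fixes S :: "('a::banach) mop"
  assumes S: "maximal_monotone S" and x0: "x0 \<in> interior (dom_op S)"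
  shows "convex (closure (dom_op S))"
proof -
  obtain r where r: "0 < r" "ball x0 r \<subseteq> dom_op S" using x0 by (meson mem_interior)
  have "convex hull (dom_op S) \<subseteq> closure (dom_op S)"
  proof
    fix x assume x: "x \<in> convex hull (dom_op S)"
    have mem: "(1 - t) *\<^sub>R x + t *\<^sub>R x0 \<in> dom_op S" if t: "0 < t" "t \<le> 1" for t
    proof (rule interior_convex_hull_dom[OF S x0])
      have "ball ((1 - t) *\<^sub>R x + t *\<^sub>R x0) (t * r) \<subseteq> convex hull (dom_op S)"
      proof
        fix v assume v: "v \<in> ball ((1 - t) *\<^sub>R x + t *\<^sub>R x0) (t * r)"
        define a where "a = x0 + (1 / t) *\<^sub>R (v - ((1 - t) *\<^sub>R x + t *\<^sub>R x0))"
        have "norm (v - ((1 - t) *\<^sub>R x + t *\<^sub>R x0)) < t * r" using v by (simp add: dist_norm norm_minus_commute)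
        hence "(1 / t) * norm (v - ((1 - t) *\<^sub>R x + t *\<^sub>R x0)) < r" using t by (simp add: pos_divide_less_eq mult.commute)
        moreover have "norm (a - x0) = (1 / t) * norm (v - ((1 - t) *\<^sub>R x + t *\<^sub>R x0))"
          using t by (simp add: a_def)
        ultimately have "norm (a - x0) < r" by simp
        hence "a \<in> convex hull (dom_op S)" using r by (auto intro!: hull_inc simp: dist_norm norm_minus_commute)
        hence "(1 - t) *\<^sub>R x + t *\<^sub>R a \<in> convex hull (dom_op S)"
          using t x by (intro convexD_alt[OF convex_convex_hull]) auto
        moreover have "(1 - t) *\<^sub>R x + t *\<^sub>R a = v" using t by (simp add: a_def scaleR_add_right)
        ultimately show "v \<in> convex hull (dom_op S)" by simp
      qed
      thus "(1 - t) *\<^sub>R x + t *\<^sub>R x0 \<in> interior (convex hull (dom_op S))"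
        using t r by (meson mem_interior mult_pos_pos)
    qed
    have lim: "(\<lambda>n. (1 - 1 / real (Suc n)) *\<^sub>R x + (1 / real (Suc n)) *\<^sub>R x0) \<longlonglongrightarrow> (1 - 0) *\<^sub>R x + 0 *\<^sub>R x0"
      by (intro tendsto_intros LIMSEQ_Suc[OF lim_1_over_n])
    have "(1 - 1 / real (Suc n)) *\<^sub>R x + (1 / real (Suc n)) *\<^sub>R x0 \<in> closure (dom_op S)" for n
      using mem[of "1 / real (Suc n)"] closure_subset[of "dom_op S"] by auto
    from closed_sequentially[OF closed_closure this lim] show "x \<in> closure (dom_op S)" by simp
  qed
  hence "closure (convex hull (dom_op S)) = closure (dom_op S)"
    by (intro antisym closure_minimal closed_closure closure_mono hull_subset)
  thus ?thesis using convex_closure[OF convex_convex_hull, of "dom_op S"] by simp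
qed

section \<open>Maximality of the sum\<close>

text \<open>The assumption \<open>max\<close> is the common consequence of both kinds of maximality:
  it concerns only sets that agree with the closure of the domain near \<open>x0\<close>.\<close>

lemma maximal_monotone_sum_op:
  fixes T S :: "('a::banach) mop"
  assumes T: "maximal_monotone T" and S: "maximal_monotone S"
    and dom: "dom_op T \<inter> closure (dom_op S) \<subseteq> dom_op S"
    and D: "convex (closure (dom_op S))"
    and max: "\<And>C. closed C \<Longrightarrow> convex C \<Longrightarrow> x0 \<in> interior C
      \<Longrightarrow> maximal_monotone (sum_op T (normal_cone (closure (dom_op S) \<inter> C)))"
    and x0: "x0 \<in> dom_op T \<inter> dom_op S" and bd: "dir_inf_bounded S x0"
    and U: "closed U" "subspace U"
    and U_iff: "\<And>w. w \<in> U \<longleftrightarrow> (\<exists>r>0. \<exists>d\<in>convex hull (dom_op T). \<exists>c\<in>closure (dom_op S). w = r *\<^sub>R (d - c))"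
  shows "maximal_monotone (sum_op T S)"
proof -
  have monT: "monotone_op T" and monS: "monotone_op S" using T S by (auto simp: maximal_monotone_def)
  have mon: "monotone_op (sum_op T S)"
    unfolding monotone_op_def
  proof (intro allI impI)
    fix x y x' y' assume "x' \<in> sum_op T S x" "y' \<in> sum_op T S y"
    then obtain t s t' s' where 1: "t \<in> T x" "s \<in> S x" "x' = t + s" "t' \<in> T y" "s' \<in> S y" "y' = t' + s'"
      unfolding sum_op_def by blast
    show "0 \<le> blinfun_apply (x' - y') (x - y)"
      using monotone_opD[OF monT 1(1,4)] monotone_opD[OF monS 1(2,5)] unfolding 1
      by (simp add: blinfun.diff_left blinfun.add_left)
  qed
  have dom_of_related: "y \<in> dom_op T \<inter> dom_op S"
    if "\<And>x t s. t \<in> T x \<Longrightarrow> s \<in> S x \<Longrightarrow> 0 \<le> blinfun_apply (t + s - y') (x - y)" for y y'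
    using S D dom max x0 bd that by (rule mem_dom_of_monotonically_related)
  have related_mem: "y' \<in> sum_op T S y"
    if rel: "\<And>x t s. t \<in> T x \<Longrightarrow> s \<in> S x \<Longrightarrow> 0 \<le> blinfun_apply (t + s - y') (x - y)" for y y'
  proof -
    obtain t1 s1 where t1: "t1 \<in> T y" and s1: "s1 \<in> S y"
      using dom_of_related[OF rel] by (auto simp: dom_op_def)
    define gS where "gS = {(x - y, s) | x s. s \<in> S x}"
    define gT where "gT = {(x - y, t - y') | x t. t \<in> T x}"
    have fS: "fst ` gS = (\<lambda>x. x - y) ` dom_op S" and fT: "fst ` gT = (\<lambda>x. x - y) ` dom_op T"
      by (force simp: gS_def gT_def dom_op_def image_iff)+
    have clS: "closure (fst ` gS) = (\<lambda>x. x - y) ` closure (dom_op S)"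
      unfolding fS by (rule closure_translation_subtract)
    have coT: "convex hull (fst ` gT) = (\<lambda>x. x - y) ` (convex hull (dom_op T))"
      unfolding fT using convex_hull_translation[of "- y" "dom_op T"] by simp
    have gS_iff: "(x, s) \<in> gS \<longleftrightarrow> s \<in> S (x + y)" for x s
      unfolding gS_def by (auto intro: exI[of _ "x + y"])
    have gT_iff: "(x, t) \<in> gT \<longleftrightarrow> t + y' \<in> T (x + y)" for x t
      unfolding gT_def by (auto intro!: exI[of _ "x + y"] exI[of _ "t + y'"])
    interpret monotone_pair gS gT "x0 - y" s1 "t1 - y'" U
    proof
      fix x x' u u' assume "(x, x') \<in> gS" "(u, u') \<in> gS"
      thus "0 \<le> blinfun_apply (x' - u') (x - u)"
        using monotone_opD[OF monS, of x' "x + y" u' "u + y"] by (simp add: gS_iff)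
    next
      fix x x' u u' assume "(x, x') \<in> gT" "(u, u') \<in> gT"
      thus "0 \<le> blinfun_apply (x' - u') (x - u)"
        using monotone_opD[OF monT, of "x' + y'" "x + y" "u' + y'" "u + y"] by (simp add: gT_iff)
    next
      show "(0, s1) \<in> gS" "(0, t1 - y') \<in> gT" using s1 t1 by (simp_all add: gS_iff gT_iff)
    next
      fix x t s assume "(x, t) \<in> gT" "(x, s) \<in> gS"
      thus "0 \<le> blinfun_apply (t + s) x"
        using rel[of "t + y'" "x + y" s] by (simp add: gS_iff gT_iff add.commute add.left_commute)
    next
      fix e :: real and v' :: "'a \<Rightarrow>\<^sub>L real" and v :: 'a assume e: "0 < e"
      show "\<exists>x t s. (x, t) \<in> gT \<and> (x, s) \<in> gS \<and> blinfun_apply (t + s - v') (x - v) \<le> e"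
      proof (rule ccontr)
        assume no: "\<not> ?thesis"
        \<comment> \<open>A pair whose values all exceed \<open>e\<close> is related to the sum, so
          its first component is a common domain point; but there the pairing vanishes.\<close>
        have far: "e < blinfun_apply (t + s - (v' + y')) (x - (v + y))" if "t \<in> T x" "s \<in> S x" for x t s
        proof -
          have "(x - y, t - y') \<in> gT" "(x - y, s) \<in> gS" using that by (simp_all add: gS_iff gT_iff)
          hence "\<not> blinfun_apply (t - y' + s - v') (x - y - v) \<le> e" using no by blast
          moreover have "t - y' + s - v' = t + s - (v' + y')" "x - y - v = x - (v + y)" by simp_all
          ultimately show ?thesis by simp
        qed
        have "v + y \<in> dom_op T \<inter> dom_op S"
          using far e by (intro dom_of_related[of "v' + y'"]) (meson less_le_trans less_imp_le)
        then obtain t s where "t \<in> T (v + y)" "s \<in> S (v + y)" by (auto simp: dom_op_def)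
        from far[OF this] e show False by simp
      qed
    next
      fix v :: 'a
      obtain \<epsilon> M where eM: "0 < \<epsilon>" "0 < M"
        "\<forall>z\<in>Kset (v + y) (ball x0 \<epsilon>) \<inter> dom_op S. \<exists>z'\<in>S z. blinfun_apply z' (z - (v + y)) \<le> M * norm (z - (v + y))"
        using bd unfolding dir_inf_bounded_def by blast
      have "\<exists>c'. (c, c') \<in> gS \<and> blinfun_apply c' (c - v) \<le> M * (norm (x0 - y) + \<epsilon> + norm v)"
        if c: "c \<in> fst ` gS \<inter> ball (x0 - y) \<epsilon>" for c
      proof -
        have cy: "c + y \<in> dom_op S" "norm (c - (x0 - y)) < \<epsilon>"
          using c by (auto simp: fS dist_norm norm_minus_commute)
        hence "c + y \<in> ball x0 \<epsilon>" by (simp add: dist_norm norm_minus_commute algebra_simps)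
        hence "c + y \<in> Kset (v + y) (ball x0 \<epsilon>)"
          unfolding Kset_def by (intro CollectI exI[of _ 1] exI[of _ "c + y"]) simp
        then obtain c' where c': "c' \<in> S (c + y)" "blinfun_apply c' (c + y - (v + y)) \<le> M * norm (c + y - (v + y))"
          using eM(3) cy(1) by blast
        have "norm (c - v) \<le> norm (x0 - y) + \<epsilon> + norm v"
          using norm_triangle_ineq4[of c v] norm_triangle_ineq[of "x0 - y" "c - (x0 - y)"] cy(2) by simp
        hence "M * norm (c - v) \<le> M * (norm (x0 - y) + \<epsilon> + norm v)" using eM(2) by simp
        thus ?thesis using c' by (intro exI[of _ c']) (simp add: gS_iff)
      qed
      thus "\<exists>\<epsilon>>0. \<exists>M. \<forall>c\<in>fst ` gS \<inter> ball (x0 - y) \<epsilon>. \<exists>c'. (c, c') \<in> gS \<and> blinfun_apply c' (c - v) \<le> M"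
        using eM(1) by blast
    next
      show "x0 - y \<in> fst ` gS" "x0 - y \<in> fst ` gT" using x0 unfolding fS fT by blast+
      show "convex (closure (fst ` gS))" unfolding clS using D by (rule convex_translation_subtract)
      show "closed U" "subspace U" by (fact U)+
      fix w show "w \<in> U \<longleftrightarrow> (\<exists>r>0. \<exists>d\<in>convex hull (fst ` gT). \<exists>c\<in>closure (fst ` gS). w = r *\<^sub>R (d - c))"
        unfolding U_iff clS coT by simp
    qed
    obtain f :: "'a \<Rightarrow>\<^sub>L real" where f: "\<forall>(u, u')\<in>gS. blinfun_apply f u \<le> blinfun_apply u' u"
      "\<forall>(d, d')\<in>gT. - blinfun_apply f d \<le> blinfun_apply d' d"
      using decomposition_at_origin by blast
    have "f \<in> S y"
    proof (rule maximal_monotone_mem[OF S])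
      fix u u' assume "u' \<in> S u"
      hence "(u - y, u') \<in> gS" by (simp add: gS_iff)
      thus "0 \<le> blinfun_apply (u' - f) (u - y)" using f(1) by (auto simp: blinfun.diff_left)
    qed
    moreover have "y' - f \<in> T y"
    proof (rule maximal_monotone_mem[OF T])
      fix d d' assume "d' \<in> T d"
      hence "(d - y, d' - y') \<in> gT" by (simp add: gT_iff)
      hence "- blinfun_apply f (d - y) \<le> blinfun_apply (d' - y') (d - y)" using f(2) by blast
      thus "0 \<le> blinfun_apply (d' - (y' - f)) (d - y)" by (simp add: blinfun.diff_left)
    qed
    ultimately show ?thesis unfolding sum_op_def by (intro CollectI exI[of _ "y' - f"] exI[of _ f]) simp
  qed
  show ?thesis
    unfolding maximal_monotone_def
  proof (intro conjI allI impI)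
    fix R assume R: "monotone_op R \<and> (\<forall>x. sum_op T S x \<subseteq> R x)"
    show "R = sum_op T S"
    proof
      fix y show "R y = sum_op T S y"
      proof
        show "R y \<subseteq> sum_op T S y"
        proof
          fix y' assume y': "y' \<in> R y"
          show "y' \<in> sum_op T S y"
          proof (rule related_mem)
            fix x t s assume "t \<in> T x" "s \<in> S x"
            hence "t + s \<in> R x" using R unfolding sum_op_def by blast
            thus "0 \<le> blinfun_apply (t + s - y') (x - y)" using monotone_opD R y' by blast
          qed
        qed
      qed (use R in blast)
    qed
  qed (rule mon)
qed

section \<open>The cone generated by a difference of sets\<close>

definition difference_cone :: "'a::real_vector set \<Rightarrow> 'a set \<Rightarrow> 'a set" where
  "difference_cone A C = (\<Union>r\<in>{0::real<..}. (\<lambda>v. r *\<^sub>R v) ` {a - c | a c. a \<in> A \<and> c \<in> C})"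

lemma mem_difference_cone: "w \<in> difference_cone A C \<longleftrightarrow> (\<exists>r>0. \<exists>a\<in>A. \<exists>c\<in>C. w = r *\<^sub>R (a - c))"
  unfolding difference_cone_def by auto

lemma C1_iff: "C \<in> C1 T \<longleftrightarrow> closed C \<and> convex C \<and> closed (difference_cone (convex hull (dom_op T)) C)
    \<and> subspace (difference_cone (convex hull (dom_op T)) C)"
  unfolding C1_def difference_cone_def Let_def by simp

text \<open>Intersecting with a neighbourhood of a common point does not change the cone: scale towards that point.\<close>
lemma difference_cone_Int:
  fixes A C E :: "'a::real_normed_vector set"
  assumes A: "convex A" and C: "convex C" and x0: "x0 \<in> A" "x0 \<in> C" "x0 \<in> interior E"
  shows "difference_cone A (C \<inter> E) = difference_cone A C"
proof
  show "difference_cone A (C \<inter> E) \<subseteq> difference_cone A C"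
    unfolding difference_cone_def by fast
  show "difference_cone A C \<subseteq> difference_cone A (C \<inter> E)"
  proof
    fix w assume "w \<in> difference_cone A C"
    then obtain r a c where w: "0 < r" "a \<in> A" "c \<in> C" "w = r *\<^sub>R (a - c)" unfolding mem_difference_cone by blast
    obtain e where e: "0 < e" "ball x0 e \<subseteq> E" using x0(3) by (meson mem_interior)
    obtain h where h: "0 < h" "h \<le> 1" "h * norm (c - x0) < e" by (rule exists_small_scale[OF e(1)])
    have "(1 - h) *\<^sub>R x0 + h *\<^sub>R c - x0 = h *\<^sub>R (c - x0)" by (simp add: algebra_simps)
    hence "norm ((1 - h) *\<^sub>R x0 + h *\<^sub>R c - x0) < e" using h by simp
    hence "(1 - h) *\<^sub>R x0 + h *\<^sub>R c \<in> E" using e by (auto simp: dist_norm norm_minus_commute)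
    moreover have "(1 - h) *\<^sub>R x0 + h *\<^sub>R c \<in> C" using h w x0 by (intro convexD_alt[OF C]) auto
    moreover have "(1 - h) *\<^sub>R x0 + h *\<^sub>R a \<in> A" using h w x0 by (intro convexD_alt[OF A]) auto
    moreover have "w = (r / h) *\<^sub>R (((1 - h) *\<^sub>R x0 + h *\<^sub>R a) - ((1 - h) *\<^sub>R x0 + h *\<^sub>R c))"
      using h w by (simp add: scaleR_diff_right)
    moreover have "0 < r / h" using h w by simp
    ultimately show "w \<in> difference_cone A (C \<inter> E)" unfolding mem_difference_cone by blast
  qed
qed

lemma difference_cone_interior:
  fixes A C :: "'a::real_normed_vector set"
  assumes x0: "x0 \<in> A" "x0 \<in> interior C"
  shows "difference_cone A C = UNIV"
proof -
  obtain e where e: "0 < e" "ball x0 e \<subseteq> C" using x0(2) by (meson mem_interior)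
  have "w \<in> difference_cone A C" for w
  proof -
    obtain h where h: "0 < h" "h \<le> 1" "h * norm w < e" by (rule exists_small_scale[OF e(1)])
    have "x0 - h *\<^sub>R w \<in> C" using e h by (auto simp: dist_norm)
    moreover have "w = (1 / h) *\<^sub>R (x0 - (x0 - h *\<^sub>R w))" using h by simp
    moreover have "0 < 1 / h" using h by simp
    ultimately show ?thesis unfolding mem_difference_cone using x0(1) by blast
  qed
  thus ?thesis by blast
qed

theorem theorem2p14:
  fixes T S :: "('a::banach) mop"
  assumes "maximal_monotone T" and "maximal_monotone S"
    and "dom_op T \<inter> closure (dom_op S) \<subseteq> dom_op S"
  shows "(C1_maximal T \<and> closure (dom_op S) \<in> C1 T \<and>
           (\<exists>x0 \<in> dom_op T \<inter> dom_op S. dir_inf_bounded S x0)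
           \<longrightarrow> maximal_monotone (sum_op T S))
       \<and> (C0_maximal T \<and> dom_op T \<inter> interior (dom_op S) \<noteq> {}
           \<longrightarrow> maximal_monotone (sum_op T S))"
proof (intro conjI impI; elim conjE)
  let ?D = "closure (dom_op S)" and ?A = "convex hull (dom_op T)"
  assume T: "C1_maximal T" and D: "?D \<in> C1 T" and "\<exists>x0 \<in> dom_op T \<inter> dom_op S. dir_inf_bounded S x0"
  then obtain x0 where x0: "x0 \<in> dom_op T \<inter> dom_op S" "dir_inf_bounded S x0" by blast
  have conv: "convex ?D" using D by (simp add: C1_iff)
  have x0': "x0 \<in> ?A" "x0 \<in> ?D" using x0(1) closure_subset[of "dom_op S"] by (auto intro: hull_inc)
  \<comment> \<open>\<open>C\<close> is a neighbourhood of \<open>x0\<close>, so the intersection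
    has the same difference cone as \<open>?D\<close>.\<close>
  have max: "maximal_monotone (sum_op T (normal_cone (?D \<inter> C)))" if C: "closed C" "convex C" "x0 \<in> interior C" for C
  proof -
    have "?D \<inter> C \<in> C1 T"
      using D C difference_cone_Int[OF convex_convex_hull conv x0' C(3)]
      by (simp add: C1_iff closed_Int convex_Int)
    thus ?thesis using T unfolding C1_maximal_def by blast
  qed
  show "maximal_monotone (sum_op T S)"
    by (rule maximal_monotone_sum_op[OF assms conv max x0, of "difference_cone ?A ?D"])
      (use D in \<open>auto simp: C1_iff mem_difference_cone\<close>)
next
  let ?D = "closure (dom_op S)" and ?A = "convex hull (dom_op T)"
  assume T: "C0_maximal T" and "dom_op T \<inter> interior (dom_op S) \<noteq> {}"
  then obtain x0 where x0: "x0 \<in> dom_op T" "x0 \<in> interior (dom_op S)" by blast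
  have conv: "convex ?D" by (rule convex_closure_dom[OF assms(2) x0(2)])
  have x0D: "x0 \<in> interior ?D" using x0(2) interior_mono[OF closure_subset[of "dom_op S"]] by blast
  have x0S: "x0 \<in> dom_op T \<inter> dom_op S" using x0 interior_subset by blast
  have bd: "dir_inf_bounded S x0"
    using assms(2) x0(2) by (intro dir_inf_bounded_interior) (simp_all add: maximal_monotone_def)
  have max: "maximal_monotone (sum_op T (normal_cone (?D \<inter> C)))" if C: "closed C" "convex C" "x0 \<in> interior C" for C
  proof -
    have "?D \<inter> C \<in> C0 T"
      using C conv x0(1) x0D by (auto simp: C0_def closed_Int convex_Int)
    thus ?thesis using T unfolding C0_maximal_def by blast
  qed
  have "difference_cone ?A ?D = UNIV" by (rule difference_cone_interior[OF hull_inc[OF x0(1)] x0D])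
  thus "maximal_monotone (sum_op T S)"
    by (intro maximal_monotone_sum_op[OF assms conv max x0S bd, of "difference_cone ?A ?D"])
      (simp_all add: subspace_UNIV flip: mem_difference_cone)
qed

end
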